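(* Let $(M,\omega_g)$ be a compact Hermitian manifold of complex dimension $n\ge 2$. If $\omega_g$ is Gauduchon and has constant Chern scalar curvature, then $\omega_g$ is $p$-conformal extremal for every real $p>1$.
   Context: For a Hermitian metric $\omega_g=\sqrt{-1}\,g_{i\bar j}\,dz^i\wedge d\bar z^j$ on a complex manifold $M$ of dimension $n$, the Chern scalar curvature is $s_g=g^{i\bar j}g^{k\bar\ell}\Theta_{i\bar jk\bar\ell}$, where $\Theta$ is the curvature tensor of the Chern connection; equivalently $s_g=\mathrm{tr}_{\omega_g}\left(-\sqrt{-1}\,\partial\bar\partial\log\det(g_{i\bar j})\right)$. The metric $\omega_g$ is Gauduchon if $\partial\bar\partial\omega_g^{n-1}=0$. For real $p>1$ the $p$-Calabi functional is $$C_p(\omega_g)=\left(\int_M|s_g|^p\frac{\omega_g^n}{n!}\right)\left(\int_M\frac{\omega_g^n}{n!}\right)^{-\frac{n-p}{n}}.$$ The metric $\omega_g$ is called $p$-conformal extremal if $\left.\frac{d}{dt}\right|_{t=0}C_p(e^{tf}\omega_g)=0$ for every $f\in C^\infty(M,\mathbb R)$. *)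

theory Defs
  imports "HOL-Analysis.Analysis" "HOL-Combinatorics.Permutations"
begin

section \<open>Calculus on open subsets of complex coordinate space\<close>

primrec times_differentiable_on ::
    "nat \<Rightarrow> 'a::real_normed_vector set \<Rightarrow> ('a \<Rightarrow> 'b::real_normed_vector) \<Rightarrow> bool" where
  "times_differentiable_on 0 S f \<longleftrightarrow> continuous_on S f"
| "times_differentiable_on (Suc k) S f \<longleftrightarrow>
     (\<forall>x\<in>S. f differentiable (at x)) \<and>
     (\<forall>v. times_differentiable_on k S (\<lambda>x. frechet_derivative f (at x) v))"

text \<open>Only meaningful for open sets, as the derivatives are full derivatives.\<close>

definition smooth_on :: "'a::real_normed_vector set \<Rightarrow> ('a \<Rightarrow> 'b::real_normed_vector) \<Rightarrow> bool" where
  "smooth_on S f \<longleftrightarrow> (\<forall>k. times_differentiable_on k S f)"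

text \<open>The Wirtinger operators: with \<open>z\<^sup>i = x\<^sup>i + \<i> y\<^sup>i\<close>, the vectors \<open>axis i 1\<close> and
  \<open>axis i \<i>\<close> are the coordinate directions of \<open>x\<^sup>i\<close> and \<open>y\<^sup>i\<close>.\<close>

definition del_z :: "'n \<Rightarrow> (complex^'n \<Rightarrow> complex) \<Rightarrow> complex^'n \<Rightarrow> complex" where
  "del_z i f z = (frechet_derivative f (at z) (axis i 1)
                  - \<i> * frechet_derivative f (at z) (axis i \<i>)) / 2"

definition del_zbar :: "'n \<Rightarrow> (complex^'n \<Rightarrow> complex) \<Rightarrow> complex^'n \<Rightarrow> complex" where
  "del_zbar i f z = (frechet_derivative f (at z) (axis i 1)
                     + \<i> * frechet_derivative f (at z) (axis i \<i>)) / 2"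

definition holomorphic_map_on :: "(complex^'n) set \<Rightarrow> (complex^'n \<Rightarrow> complex^'n) \<Rightarrow> bool" where
  "holomorphic_map_on S F \<longleftrightarrow>
     smooth_on S F \<and> (\<forall>z\<in>S. \<forall>a j. del_zbar j (\<lambda>w. F w $ a) z = 0)"


section \<open>Differential forms in coordinates\<close>

text \<open>A complex-valued \<open>k\<close>-covector is represented by an alternating real-multilinear function of the first
  \<open>k\<close> entries of a sequence of vectors; the degree is passed explicitly to the operations.
  A differential form on a coordinate domain is a function from points to covectors.\<close>

type_synonym 'n covector = "(nat \<Rightarrow> complex^'n) \<Rightarrow> complex"

definition wedge :: "nat \<Rightarrow> nat \<Rightarrow> 'n covector \<Rightarrow> 'n covector \<Rightarrow> 'n covector" where
  "wedge k l \<alpha> \<beta> v =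
     (\<Sum>\<sigma> | \<sigma> permutes {..<k + l}.
        of_int (sign \<sigma>) * \<alpha> (\<lambda>i. v (\<sigma> i)) * \<beta> (\<lambda>i. v (\<sigma> (k + i)))) / (fact k * fact l)"

text \<open>The exterior powers of a 2-covector.\<close>

primrec wedge_power :: "'n covector \<Rightarrow> nat \<Rightarrow> 'n covector" where
  "wedge_power \<omega> 0 = (\<lambda>v. 1)"
| "wedge_power \<omega> (Suc m) = wedge 2 (2 * m) \<omega> (wedge_power \<omega> m)"

definition dz :: "'n::finite \<Rightarrow> 'n covector" where
  "dz i v = v 0 $ i"

definition dzbar :: "'n::finite \<Rightarrow> 'n covector" where
  "dzbar i v = cnj (v 0 $ i)"

text \<open>For a \<open>k\<close>-form \<open>\<alpha>\<close> these are \<open>\<Sum>i. dz i \<and> del_z i \<alpha>\<close> and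
  \<open>\<Sum>i. dzbar i \<and> del_zbar i \<alpha>\<close>, where the derivatives act on the coefficients of \<open>\<alpha>\<close>, that
  is, on its values at constant vectors.\<close>

definition del_form ::
    "nat \<Rightarrow> (complex^'n \<Rightarrow> 'n covector) \<Rightarrow> complex^'n \<Rightarrow> ('n::finite) covector" where
  "del_form k \<alpha> z = (\<lambda>v. \<Sum>i\<in>UNIV. wedge 1 k (dz i) (\<lambda>u. del_z i (\<lambda>w. \<alpha> w u) z) v)"

definition delbar_form ::
    "nat \<Rightarrow> (complex^'n \<Rightarrow> 'n covector) \<Rightarrow> complex^'n \<Rightarrow> ('n::finite) covector" where
  "delbar_form k \<alpha> z = (\<lambda>v. \<Sum>i\<in>UNIV. wedge 1 k (dzbar i) (\<lambda>u. del_zbar i (\<lambda>w. \<alpha> w u) z) v)"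

text \<open>The frame \<open>\<partial>/\<partial>x\<^sup>1, \<partial>/\<partial>y\<^sup>1, \<partial>/\<partial>x\<^sup>2, \<partial>/\<partial>y\<^sup>2, \<dots>\<close>, orthonormal for Lebesgue measure and
  positively oriented for the complex orientation.  A form of top degree takes the same value on
  it whatever enumeration of the index type is used.\<close>

definition real_frame :: "nat \<Rightarrow> complex^('n::finite)" where
  "real_frame k = axis (from_nat_into UNIV (k div 2)) (if even k then 1 else \<i>)"


section \<open>Complex manifolds\<close>

text \<open>The manifold is the whole type \<open>'m\<close>.  A chart consists of its domain and a coordinate map,
  whose values outside the domain are irrelevant.\<close>

type_synonym ('m, 'n) chart = "'m set \<times> ('m \<Rightarrow> complex^'n)"

abbreviation chart_dom :: "('m, 'n) chart \<Rightarrow> 'm set" where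
  "chart_dom c \<equiv> fst c"

abbreviation chart_map :: "('m, 'n) chart \<Rightarrow> 'm \<Rightarrow> complex^'n" where
  "chart_map c \<equiv> snd c"

abbreviation chart_img :: "('m, 'n) chart \<Rightarrow> (complex^'n) set" where
  "chart_img c \<equiv> chart_map c ` chart_dom c"

definition chart_inv :: "('m, 'n) chart \<Rightarrow> complex^'n \<Rightarrow> 'm" where
  "chart_inv c = inv_into (chart_dom c) (chart_map c)"

definition transition :: "('m, 'n) chart \<Rightarrow> ('m, 'n) chart \<Rightarrow> complex^'n \<Rightarrow> complex^'n" where
  "transition c d = chart_map d \<circ> chart_inv c"

definition complex_atlas :: "('m::topological_space, 'n::finite) chart set \<Rightarrow> bool" where
  "complex_atlas A \<longleftrightarrow>
     (\<Union>c\<in>A. chart_dom c) = UNIV \<and>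
     (\<forall>c\<in>A. open (chart_dom c) \<and> open (chart_img c) \<and>
            homeomorphism (chart_dom c) (chart_img c) (chart_map c) (chart_inv c)) \<and>
     (\<forall>c\<in>A. \<forall>d\<in>A.
        holomorphic_map_on (chart_map c ` (chart_dom c \<inter> chart_dom d)) (transition c d))"

definition smooth_function :: "('m, 'n::finite) chart set \<Rightarrow> ('m \<Rightarrow> real) \<Rightarrow> bool" where
  "smooth_function A f \<longleftrightarrow> (\<forall>c\<in>A. smooth_on (chart_img c) (f \<circ> chart_inv c))"


section \<open>Hermitian metrics\<close>

text \<open>A metric is given by its coefficient matrices: \<open>g c x $ i $ j\<close> is the coefficient of
  \<open>dz i \<otimes> dzbar j\<close> at the point \<open>x\<close> in the coordinates of the chart \<open>c\<close>.\<close>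

type_synonym ('m, 'n) metric = "('m, 'n) chart \<Rightarrow> 'm \<Rightarrow> complex^'n^'n"

definition sesq :: "complex^'n^'n \<Rightarrow> complex^'n \<Rightarrow> complex^'n \<Rightarrow> complex" where
  "sesq G u v = (\<Sum>i\<in>UNIV. \<Sum>j\<in>UNIV. G $ i $ j * u $ i * cnj (v $ j))"

text \<open>The last condition says that the coefficients transform as those of a tensor.\<close>

definition hermitian_metric ::
    "('m::topological_space, 'n::finite) chart set \<Rightarrow> ('m, 'n) metric \<Rightarrow> bool" where
  "hermitian_metric A g \<longleftrightarrow>
     (\<forall>c\<in>A. \<forall>i j. smooth_on (chart_img c) (\<lambda>z. g c (chart_inv c z) $ i $ j)) \<and>
     (\<forall>c\<in>A. \<forall>x\<in>chart_dom c.
        (\<forall>i j. g c x $ j $ i = cnj (g c x $ i $ j)) \<and>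
        (\<forall>v. v \<noteq> 0 \<longrightarrow> 0 < Re (sesq (g c x) v v))) \<and>
     (\<forall>c\<in>A. \<forall>d\<in>A. \<forall>x \<in> chart_dom c \<inter> chart_dom d. \<forall>u v.
        sesq (g c x) u v =
        sesq (g d x) (frechet_derivative (transition c d) (at (chart_map c x)) u)
                     (frechet_derivative (transition c d) (at (chart_map c x)) v))"

definition local_metric :: "('m, 'n) metric \<Rightarrow> ('m, 'n) chart \<Rightarrow> complex^'n \<Rightarrow> complex^'n^'n" where
  "local_metric g c z = g c (chart_inv c z)"

definition conformal :: "('m \<Rightarrow> real) \<Rightarrow> ('m, 'n::finite) metric \<Rightarrow> ('m, 'n) metric" where
  "conformal u g = (\<lambda>c x. exp (u x) *\<^sub>R g c x)"

text \<open>The fundamental form \<open>\<i> \<Sum>i j. G $ i $ j * (dz i \<and> dzbar j)\<close>.\<close>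

definition fundamental_form :: "complex^'n^'n \<Rightarrow> ('n::finite) covector" where
  "fundamental_form G v =
     \<i> * (\<Sum>i\<in>UNIV. \<Sum>j\<in>UNIV. G $ i $ j * wedge 1 1 (dz i) (dzbar j) v)"

definition gauduchon :: "('m, 'n::finite) chart set \<Rightarrow> ('m, 'n) metric \<Rightarrow> bool" where
  "gauduchon A g \<longleftrightarrow>
     (\<forall>c\<in>A. \<forall>z\<in>chart_img c. \<forall>v.
        del_form (2 * CARD('n) - 1)
          (delbar_form (2 * CARD('n) - 2)
            (\<lambda>w. wedge_power (fundamental_form (local_metric g c w)) (CARD('n) - 1))) z v = 0)"


section \<open>Chern scalar curvature\<close>

text \<open>The entry \<open>g\<^sup>k\<^sup>l\<close> of the inverse metric, normalised by
  \<open>(\<Sum>l. inv_metric G k l * G $ p $ l) = (if k = p then 1 else 0)\<close>.\<close>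

definition inv_metric :: "complex^'n^'n \<Rightarrow> 'n::finite \<Rightarrow> 'n \<Rightarrow> complex" where
  "inv_metric G k l = matrix_inv G $ l $ k"

text \<open>Here \<open>H\<close> is the coefficient matrix of the metric as a function of the coordinates.
  The Chern connection is \<open>\<nabla>\<^sub>i \<partial>\<^sub>k = \<Sum>p. chern_connection H i k p \<partial>\<^sub>p\<close> with vanishing
  mixed symbols, so that its curvature is \<open>- del_zbar j\<close> of the symbols, with the upper index lowered.\<close>

definition chern_connection ::
    "(complex^'n \<Rightarrow> complex^'n^'n) \<Rightarrow> 'n::finite \<Rightarrow> 'n \<Rightarrow> 'n \<Rightarrow> complex^'n \<Rightarrow> complex" where
  "chern_connection H i k p z =
     (\<Sum>q\<in>UNIV. inv_metric (H z) p q * del_z i (\<lambda>w. H w $ k $ q) z)"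

definition chern_curvature ::
    "(complex^'n \<Rightarrow> complex^'n^'n) \<Rightarrow> 'n::finite \<Rightarrow> 'n \<Rightarrow> 'n \<Rightarrow> 'n \<Rightarrow> complex^'n \<Rightarrow> complex" where
  "chern_curvature H i j k l z =
     (\<Sum>p\<in>UNIV. H z $ p $ l * (- del_zbar j (chern_connection H i k p) z))"

definition local_chern_scalar ::
    "(complex^'n \<Rightarrow> complex^'n^'n) \<Rightarrow> complex^('n::finite) \<Rightarrow> complex" where
  "local_chern_scalar H z =
     (\<Sum>i\<in>UNIV. \<Sum>j\<in>UNIV. \<Sum>k\<in>UNIV. \<Sum>l\<in>UNIV.
        inv_metric (H z) i j * inv_metric (H z) k l * chern_curvature H i j k l z)"

text \<open>The full contraction is real and does not depend on the chart, so any chart around the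
  point may be used.\<close>

definition chern_scalar ::
    "('m, 'n::finite) chart set \<Rightarrow> ('m, 'n) metric \<Rightarrow> 'm \<Rightarrow> real" where
  "chern_scalar A g x =
     (let c = (SOME c. c \<in> A \<and> x \<in> chart_dom c)
      in Re (local_chern_scalar (local_metric g c) (chart_map c x)))"


section \<open>Integration and the \<open>p\<close>-Calabi functional\<close>

text \<open>The value of \<open>\<omega>\<^sup>n / n!\<close> on the oriented frame, i.e. its density with respect to
  Lebesgue measure of the coordinates \<open>x\<^sup>i, y\<^sup>i\<close>.\<close>

definition volume_density :: "complex^'n^('n::finite) \<Rightarrow> real" where
  "volume_density G =
     Re (wedge_power (fundamental_form G) CARD('n) real_frame / fact CARD('n))"

text \<open>Integration against the top form \<open>\<omega>\<^sup>n / n!\<close>, as a Borel measure on the manifold: the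
  unique one that in each chart is given by the density above.  It exists because the densities
  transform by the absolute value of the Jacobian determinant, and it is unique because countably
  many charts cover (in particular when the manifold is compact).\<close>

definition volume_measure ::
    "('m::topological_space, 'n::finite) chart set \<Rightarrow> ('m, 'n) metric \<Rightarrow> 'm measure" where
  "volume_measure A g =
     (THE \<mu>. sets \<mu> = sets borel \<and>
        (\<forall>c\<in>A. \<forall>B\<in>sets borel. B \<subseteq> chart_dom c \<longrightarrow>
           emeasure \<mu> B =
             (\<integral>\<^sup>+ z. ennreal (volume_density (local_metric g c z))
                    * indicator (chart_map c ` B) z \<partial>lborel)))"

definition calabi ::
    "real \<Rightarrow> ('m::topological_space, 'n::finite) chart set \<Rightarrow> ('m, 'n) metric \<Rightarrow> real" where
  "calabi p A g =
     (\<integral>x. \<bar>chern_scalar A g x\<bar> powr p \<partial>volume_measure A g)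
     * (\<integral>x. 1 \<partial>volume_measure A g) powr (- ((real CARD('n) - p) / real CARD('n)))"

definition conformal_extremal ::
    "real \<Rightarrow> ('m::topological_space, 'n::finite) chart set \<Rightarrow> ('m, 'n) metric \<Rightarrow> bool" where
  "conformal_extremal p A g \<longleftrightarrow>
     (\<forall>f. smooth_function A f \<longrightarrow>
        ((\<lambda>t. calabi p A (conformal (\<lambda>x. t * f x) g)) has_real_derivative 0) (at 0))"

end

theory Submission
  imports Defs
begin

text \<open>Write \<open>\<Delta> f = g\<^sup>i\<^sup>j \<partial>\<^sub>i \<partial>\<^sub>j f\<close> for the Chern Laplacian, \<open>j\<close> being the barred index. Under
  \<open>g \<mapsto> e\<^sup>t\<^sup>f g\<close> the Chern scalar curvature \<open>s\<close> becomes \<open>e\<^sup>-\<^sup>t\<^sup>f (s - n t \<Delta> f)\<close> and the volume form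
  \<open>dV\<close> is multiplied by \<open>e\<^sup>n\<^sup>t\<^sup>f\<close>. If \<open>s = \<kappa>\<close> is constant, the derivative at \<open>t = 0\<close> of the integral of
  \<open>\<bar>s\<bar>\<^sup>p\<close> is therefore \<open>(n - p) \<bar>\<kappa>\<bar>\<^sup>p \<integral>f dV\<close> plus a multiple of \<open>\<integral>\<Delta> f dV\<close>. The Gauduchon
  condition makes the second integral vanish: \<open>\<Delta> f dV\<close> is a constant multiple of the wedge product of
  \<open>\<omega>\<^sup>n\<^sup>-\<^sup>1\<close> with the complex Hessian of \<open>f\<close>, and both derivatives can be moved to \<open>\<omega>\<^sup>n\<^sup>-\<^sup>1\<close>, in
  charts after multiplying \<open>f\<close> by a partition of unity. The first term is compensated by the power of
  the volume in the functional.\<close>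

section \<open>Derivatives of functions on open sets\<close>

text \<open>Pointwise, everything rests on one identity: the coefficients of
  \<open>\<omega>\<^sup>n\<^sup>-\<^sup>1\<close>, collected in \<open>cofactor\<close>, are the
  inverse metric times the top form, up to the constant \<open>2 * \<i> * n\<close>. Hence the
  Laplacian times the volume density is a sum of \<open>cofactor\<close> entries times second
  derivatives of the function, and the Gauduchon condition, evaluated on the standard frame, says
  that the matching second derivatives of \<open>cofactor\<close> add up to zero. The identity also
  yields smoothness of the inverse metric. As forms are sums over permutations, it is proved by row
  expansion of Pfaffians on the fixed frame \<open>real_frame\<close>, whereas a unitary frame would
  vary with the point. The other obstacle is the volume measure, a definite description: its
  existence needs the change of variables formula for transition maps, and positivity of the density
  supplies the absolute value of the Jacobian. Finally, \<open>\<kappa>\<close> may be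
  \<open>0\<close>; it is \<open>p > 1\<close> that makes the \<open>p\<close>-th power of the
  absolute value differentiable there.\<close>

lemma times_differentiable_on_cong:
  assumes "open S" and "\<And>x. x \<in> S \<Longrightarrow> f x = g x"
  shows "times_differentiable_on k S f \<longleftrightarrow> times_differentiable_on k S g"
  using assms(2)
proof (induction k arbitrary: f g)
  case 0
  then show ?case by (simp cong: continuous_on_cong)
next
  case (Suc k)
  have d: "(f has_derivative D) (at x) \<longleftrightarrow> (g has_derivative D) (at x)" if "x \<in> S" for x D
    using has_derivative_transform_within_open[OF _ \<open>open S\<close> that] Suc.prems by metis
  have fd: "frechet_derivative f (at x) = frechet_derivative g (at x)" if "x \<in> S" for x
    unfolding frechet_derivative_def using d[OF that] by simp
  have df: "f differentiable (at x) \<longleftrightarrow> g differentiable (at x)" if "x \<in> S" for x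
    unfolding differentiable_def using d[OF that] by simp
  show ?case
    using df Suc.IH[of "\<lambda>x. frechet_derivative f (at x) _" "\<lambda>x. frechet_derivative g (at x) _"] fd
    by simp
qed

lemma times_differentiable_on_Un:
  "open S \<Longrightarrow> open S' \<Longrightarrow> times_differentiable_on k S f \<Longrightarrow> times_differentiable_on k S' f \<Longrightarrow>
    times_differentiable_on k (S \<union> S') f"
  by (induction k arbitrary: f) (auto intro: continuous_on_open_Un)

lemma times_differentiable_on_imp_continuous_on:
  "times_differentiable_on k S f \<Longrightarrow> continuous_on S f"
  by (cases k) (auto intro!: differentiable_imp_continuous_on differentiable_at_imp_differentiable_on)

lemma times_differentiable_on_SucD:
  "times_differentiable_on (Suc k) S f \<Longrightarrow> times_differentiable_on k S f"
proof (induction k arbitrary: f)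
  case 0
  then show ?case using times_differentiable_on_imp_continuous_on by fastforce
next
  case (Suc k)
  then show ?case by (meson times_differentiable_on.simps(2))
qed

lemma times_differentiable_on_le:
  assumes "times_differentiable_on k S f" "j \<le> k"
  shows "times_differentiable_on j S f"
  using assms(2,1)
  by (induction rule: inc_induct) (blast dest: times_differentiable_on_SucD)+

text \<open>Lets any explicit formula \<open>f'\<close> stand for the derivative, so that the
  inductions below argue about formulas and never about \<open>frechet_derivative\<close> of a
  compound function.\<close>

lemma times_differentiable_on_SucI:
  assumes "open S" and "\<And>x. x \<in> S \<Longrightarrow> (f has_derivative f' x) (at x)"
    and "\<And>v. times_differentiable_on k S (\<lambda>x. f' x v)"
  shows "times_differentiable_on (Suc k) S f"
proof -
  have "frechet_derivative f (at x) = f' x" if "x \<in> S" for x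
    using frechet_derivative_at[OF assms(2)[OF that]] by simp
  then have "times_differentiable_on k S (\<lambda>x. frechet_derivative f (at x) v)" for v
    using assms(3)[of v] times_differentiable_on_cong[OF \<open>open S\<close>, of "\<lambda>x. frechet_derivative f (at x) v" "\<lambda>x. f' x v"] by simp
  then show ?thesis
    using assms(2) by (auto simp: differentiable_def)
qed

lemma times_differentiable_on_const [simp]: "times_differentiable_on k S (\<lambda>x. c)"
proof (induction k arbitrary: c)
  case (Suc k)
  have "frechet_derivative (\<lambda>x. c) (at x) = (\<lambda>h. 0)" for x :: 'a
    using frechet_derivative_at[of "\<lambda>x. c" "\<lambda>h. 0" x] by simp
  then show ?case using Suc by simp
qed simp

lemma times_differentiable_on_bounded_linear:
  assumes "open S" "bounded_linear L" "times_differentiable_on k S f"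
  shows "times_differentiable_on k S (\<lambda>x. L (f x))"
  using assms(3)
proof (induction k arbitrary: f)
  case 0
  then show ?case using bounded_linear.continuous_on[OF assms(2)] by simp
next
  case (Suc k)
  show ?case
  proof (rule times_differentiable_on_SucI[OF assms(1)])
    show "((\<lambda>x. L (f x)) has_derivative (\<lambda>v. L (frechet_derivative f (at x) v))) (at x)" if "x \<in> S" for x
      by (rule bounded_linear.has_derivative[OF assms(2)])
        (use Suc.prems that in \<open>auto simp: frechet_derivative_works[symmetric]\<close>)
    show "times_differentiable_on k S (\<lambda>x. L (frechet_derivative f (at x) v))" for v
      using Suc.prems by (intro Suc.IH) simp
  qed
qed

lemma times_differentiable_on_add:
  assumes "open S" "times_differentiable_on k S f" "times_differentiable_on k S g"
  shows "times_differentiable_on k S (\<lambda>x. f x + g x)"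
  using assms(2,3)
proof (induction k arbitrary: f g)
  case 0
  then show ?case by (auto intro: continuous_intros)
next
  case (Suc k)
  show ?case
  proof (rule times_differentiable_on_SucI[OF assms(1)])
    show "((\<lambda>x. f x + g x) has_derivative
        (\<lambda>v. frechet_derivative f (at x) v + frechet_derivative g (at x) v)) (at x)" if "x \<in> S" for x
      using Suc.prems that by (intro has_derivative_add) (auto simp: frechet_derivative_works[symmetric])
    show "times_differentiable_on k S (\<lambda>x. frechet_derivative f (at x) v + frechet_derivative g (at x) v)" for v
      using Suc.prems by (intro Suc.IH) simp_all
  qed
qed

text \<open>One induction serves products, scalar multiples and inner products. The product rule
  pairs each derivative with an undifferentiated factor, which has to be weakened to order
  \<open>k\<close> before the induction hypothesis applies.\<close>

lemma times_differentiable_on_bilinear: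
  assumes "open S" "bounded_bilinear B" "times_differentiable_on k S f" "times_differentiable_on k S g"
  shows "times_differentiable_on k S (\<lambda>x. B (f x) (g x))"
  using assms(3,4)
proof (induction k arbitrary: f g)
  case 0
  then show ?case using bounded_bilinear.continuous_on[OF assms(2)] by auto
next
  case (Suc k)
  have "times_differentiable_on k S f" "times_differentiable_on k S g"
    using Suc.prems times_differentiable_on_SucD by blast+
  show ?case
  proof (rule times_differentiable_on_SucI[OF assms(1), where
        f' = "\<lambda>x v. B (f x) (frechet_derivative g (at x) v) + B (frechet_derivative f (at x) v) (g x)"])
    show "((\<lambda>x. B (f x) (g x)) has_derivative
        (\<lambda>v. B (f x) (frechet_derivative g (at x) v) + B (frechet_derivative f (at x) v) (g x))) (at x)"
      if "x \<in> S" for x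
      using Suc.prems that
      by (intro bounded_bilinear.FDERIV[OF assms(2)]) (auto simp: frechet_derivative_works[symmetric])
  next
    fix v
    show "times_differentiable_on k S
        (\<lambda>x. B (f x) (frechet_derivative g (at x) v) + B (frechet_derivative f (at x) v) (g x))"
      using Suc.prems \<open>times_differentiable_on k S f\<close> \<open>times_differentiable_on k S g\<close>
      by (intro times_differentiable_on_add[OF assms(1)] Suc.IH) auto
  qed
qed

lemmas times_differentiable_on_mult =
  times_differentiable_on_bilinear[OF _ bounded_bilinear_mult]
lemmas times_differentiable_on_scaleR =
  times_differentiable_on_bilinear[OF _ bounded_bilinear_scaleR]
lemmas times_differentiable_on_inner =
  times_differentiable_on_bilinear[OF _ bounded_bilinear_inner]

lemma times_differentiable_on_uminus:
  "open S \<Longrightarrow> times_differentiable_on k S f \<Longrightarrow> times_differentiable_on k S (\<lambda>x. - f x)"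
  by (rule times_differentiable_on_bounded_linear[OF _ bounded_linear_minus[OF bounded_linear_ident]])

lemma times_differentiable_on_diff:
  "open S \<Longrightarrow> times_differentiable_on k S f \<Longrightarrow> times_differentiable_on k S g \<Longrightarrow>
    times_differentiable_on k S (\<lambda>x. f x - g x)"
  using times_differentiable_on_add[of S k f "\<lambda>x. - g x"] times_differentiable_on_uminus[of S k g] by simp

lemma times_differentiable_on_sum:
  "open S \<Longrightarrow> (\<And>i. i \<in> I \<Longrightarrow> times_differentiable_on k S (f i)) \<Longrightarrow>
    times_differentiable_on k S (\<lambda>x. \<Sum>i\<in>I. f i x)"
proof (induction I rule: infinite_finite_induct)
  case (insert i I)
  then show ?case by (simp add: times_differentiable_on_add del: times_differentiable_on.simps)
qed (simp_all del: times_differentiable_on.simps)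

lemma times_differentiable_on_prod:
  fixes f :: "'i \<Rightarrow> 'a::real_normed_vector \<Rightarrow> 'b::real_normed_field"
  shows "open S \<Longrightarrow> (\<And>i. i \<in> I \<Longrightarrow> times_differentiable_on k S (f i)) \<Longrightarrow>
    times_differentiable_on k S (\<lambda>x. \<Prod>i\<in>I. f i x)"
proof (induction I rule: infinite_finite_induct)
  case (insert i I)
  then show ?case by (simp add: times_differentiable_on_mult del: times_differentiable_on.simps)
qed (simp_all del: times_differentiable_on.simps)

lemma times_differentiable_on_ident: "open S \<Longrightarrow> times_differentiable_on k S (\<lambda>x. x)"
proof (cases k)
  case (Suc j)
  assume "open S"
  then have "times_differentiable_on (Suc j) S (\<lambda>x. x)"
    by (rule times_differentiable_on_SucI[where f' = "\<lambda>x v. v"]) (simp_all del: times_differentiable_on.simps)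
  then show ?thesis using Suc by simp
qed simp

lemma times_differentiable_on_inverse:
  fixes f :: "'a::real_normed_vector \<Rightarrow> 'b::real_normed_field"
  assumes "open S" "times_differentiable_on k S f" "\<And>x. x \<in> S \<Longrightarrow> f x \<noteq> 0"
  shows "times_differentiable_on k S (\<lambda>x. inverse (f x))"
  using assms(2)
proof (induction k)
  case 0
  then show ?case using assms(3) by (auto intro!: continuous_intros)
next
  case (Suc k)
  have td: "times_differentiable_on k S (\<lambda>x. inverse (f x))"
    using Suc times_differentiable_on_SucD by blast
  show ?case
  proof (rule times_differentiable_on_SucI[OF assms(1)])
    show "((\<lambda>x. inverse (f x)) has_derivative
        (\<lambda>v. - (inverse (f x) * frechet_derivative f (at x) v * inverse (f x)))) (at x)" if "x \<in> S" for x
      using Suc.prems that assms(3) by (intro Deriv.has_derivative_inverse) (auto simp: frechet_derivative_works[symmetric])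
    show "times_differentiable_on k S (\<lambda>x. - (inverse (f x) * frechet_derivative f (at x) v * inverse (f x)))" for v
      using Suc.prems
      by (intro times_differentiable_on_uminus times_differentiable_on_mult assms(1) td) simp
  qed
qed

lemma times_differentiable_on_divide:
  fixes f :: "'a::real_normed_vector \<Rightarrow> 'b::real_normed_field"
  assumes "open S" "times_differentiable_on k S f" "times_differentiable_on k S g"
    and "\<And>x. x \<in> S \<Longrightarrow> g x \<noteq> 0"
  shows "times_differentiable_on k S (\<lambda>x. f x / g x)"
  unfolding divide_inverse
  using assms by (intro times_differentiable_on_mult times_differentiable_on_inverse) auto

text \<open>The chain rule applies one varying linear map to another varying vector. Expanding that
  vector in a basis of the intermediate space leaves a finite sum of products, in which
  \<open>f\<close> is replaced by its derivative in a fixed direction \<open>b\<close>. Hence the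
  induction generalises over \<open>f\<close>, and \<open>'b\<close> is Euclidean.\<close>

lemma times_differentiable_on_compose:
  fixes T :: "'a::real_normed_vector \<Rightarrow> 'b::euclidean_space"
  assumes "open S" "open U" "times_differentiable_on k U f" "times_differentiable_on k S T" "T ` S \<subseteq> U"
  shows "times_differentiable_on k S (\<lambda>x. f (T x))"
  using assms(3,4)
proof (induction k arbitrary: f)
  case 0
  then show ?case using assms(5) by (auto intro: continuous_on_compose2)
next
  case (Suc k)
  show ?case
  proof (rule times_differentiable_on_SucI[OF assms(1), where
        f' = "\<lambda>x v. frechet_derivative f (at (T x)) (frechet_derivative T (at x) v)"])
    show "((\<lambda>x. f (T x)) has_derivative (\<lambda>v. frechet_derivative f (at (T x)) (frechet_derivative T (at x) v))) (at x)"
      if "x \<in> S" for x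
      by (rule has_derivative_compose[where g = f and f = T])
        (use Suc.prems that assms(5) in \<open>auto simp: frechet_derivative_works[symmetric]\<close>)
  next
    fix v
    have 1: "frechet_derivative f (at (T x)) (frechet_derivative T (at x) v) =
      (\<Sum>b\<in>Basis. (frechet_derivative T (at x) v \<bullet> b) *\<^sub>R frechet_derivative f (at (T x)) b)" if "x \<in> S" for x
    proof -
      have "linear (frechet_derivative f (at (T x)))"
        using Suc.prems that assms(5) by (auto intro!: linear_frechet_derivative)
      then show ?thesis
        by (subst euclidean_representation[of "frechet_derivative T (at x) v", symmetric])
          (simp add: linear_sum linear_scale)
    qed
    have "times_differentiable_on k S
      (\<lambda>x. \<Sum>b\<in>Basis. (frechet_derivative T (at x) v \<bullet> b) *\<^sub>R frechet_derivative f (at (T x)) b)"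
      using Suc.prems times_differentiable_on_SucD[OF Suc.prems(2)]
      by (intro times_differentiable_on_sum times_differentiable_on_scaleR times_differentiable_on_inner Suc.IH
          assms(1) times_differentiable_on_const) simp_all
    then show "times_differentiable_on k S (\<lambda>x. frechet_derivative f (at (T x)) (frechet_derivative T (at x) v))"
      by (subst times_differentiable_on_cong[OF assms(1) 1])
  qed
qed

section \<open>Symmetry of second derivatives\<close>

lemma has_real_derivative_line:
  fixes f :: "'a::real_normed_vector \<Rightarrow> real"
  assumes "f differentiable (at (a + s *\<^sub>R u))"
  shows "((\<lambda>s. f (a + s *\<^sub>R u)) has_real_derivative frechet_derivative f (at (a + s *\<^sub>R u)) u) (at s)"
proof -
  let ?F = "frechet_derivative f (at (a + s *\<^sub>R u))"
  have F: "(f has_derivative ?F) (at (a + s *\<^sub>R u))"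
    using assms by (simp add: frechet_derivative_works)
  have "((\<lambda>s. f (a + s *\<^sub>R u)) has_derivative (\<lambda>h. ?F (h *\<^sub>R u))) (at s)"
    by (rule has_derivative_compose[where f = "\<lambda>s. a + s *\<^sub>R u" and g = f, OF _ F]) (auto intro!: derivative_eq_intros)
  moreover have "(\<lambda>h. ?F (h *\<^sub>R u)) = (*) (?F u)"
    using linear_scale[OF linear_frechet_derivative[OF assms]] by auto
  ultimately show ?thesis by (simp add: has_field_derivative_def)
qed

text \<open>Two applications of the mean value theorem, in direction \<open>u\<close> and then in
  direction \<open>v\<close>, turn the quotient into the exact value of the mixed derivative at a
  point near \<open>z\<close>; continuity of that derivative gives the limit. The quotient is
  symmetric in \<open>u\<close> and \<open>v\<close>, so the two orders of differentiation
  agree.\<close>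

lemma second_difference_quotient_tendsto:
  fixes f :: "'a::real_normed_vector \<Rightarrow> real"
  assumes "open S" "times_differentiable_on 2 S f" "z \<in> S"
  shows "((\<lambda>h. (f (z + h *\<^sub>R u + h *\<^sub>R v) - f (z + h *\<^sub>R u) - f (z + h *\<^sub>R v) + f z) / h\<^sup>2)
    \<longlongrightarrow> frechet_derivative (\<lambda>x. frechet_derivative f (at x) u) (at z) v) (at_right 0)"
proof (rule tendstoI)
  fix e :: real assume "e > 0"
  define Du where "Du = (\<lambda>x. frechet_derivative f (at x) u)"
  define Dvu where "Dvu = (\<lambda>x. frechet_derivative Du (at x) v)"
  have dif: "f differentiable (at x)" "Du differentiable (at x)" if "x \<in> S" for x
    using assms(2) that by (auto simp: numeral_2_eq_2 Du_def)
  have "continuous_on S Dvu"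
    using assms(2) by (auto simp: numeral_2_eq_2 Du_def Dvu_def)
  then have "isCont Dvu z"
    using assms continuous_on_eq_continuous_at by blast
  then obtain d0 where "d0 > 0" and d0: "\<And>x. dist x z < d0 \<Longrightarrow> dist (Dvu x) (Dvu z) < e"
    using \<open>e > 0\<close> by (auto simp: continuous_at_eps_delta)
  obtain d1 where "d1 > 0" and d1: "ball z d1 \<subseteq> S"
    using assms open_contains_ball by blast
  \<comment> \<open>All points \<open>z + s *\<^sub>R u + t *\<^sub>R v\<close> with
    \<open>s\<close> and \<open>t\<close> below \<open>d\<close> stay within
    \<open>min d0 d1\<close> of \<open>z\<close>; the summand \<open>1\<close> keeps the denominator
    positive when \<open>u\<close> and \<open>v\<close> vanish.\<close>
  define d where "d = min d0 d1 / (norm u + norm v + 1)"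
  have "d > 0" using \<open>d0 > 0\<close> \<open>d1 > 0\<close>
    by (auto simp: d_def intro!: divide_pos_pos add_nonneg_pos)
  have near: "dist (z + s *\<^sub>R u + t *\<^sub>R v) z < min d0 d1" if "0 \<le> s" "s \<le> h" "0 \<le> t" "t \<le> h" "h < d" for s t h
  proof -
    have "dist (z + s *\<^sub>R u + t *\<^sub>R v) z = norm (s *\<^sub>R u + t *\<^sub>R v)"
      by (simp add: dist_norm)
    also have "\<dots> \<le> s * norm u + t * norm v"
      using that by (metis abs_of_nonneg norm_scaleR norm_triangle_ineq)
    also have "\<dots> \<le> h * norm u + h * norm v"
      using that by (intro add_mono mult_right_mono) auto
    also have "\<dots> \<le> h * (norm u + norm v + 1)"
      using that by (simp add: algebra_simps)
    also have "\<dots> < d * (norm u + norm v + 1)"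
      using that by (intro mult_strict_right_mono add_nonneg_pos) auto
    also have "\<dots> = min d0 d1"
      unfolding d_def by (metis add_nonneg_pos less_irrefl nonzero_mult_div_cancel_right norm_ge_zero times_divide_eq_left zero_less_one add_nonneg_nonneg)
    finally show ?thesis .
  qed
  have inS: "z + s *\<^sub>R u + t *\<^sub>R v \<in> S" if "0 \<le> s" "s \<le> h" "0 \<le> t" "t \<le> h" "h < d" for s t h
    using near[OF that] d1 by (auto simp: dist_commute)
  have "dist ((f (z + h *\<^sub>R u + h *\<^sub>R v) - f (z + h *\<^sub>R u) - f (z + h *\<^sub>R v) + f z) / h\<^sup>2) (Dvu z) < e"
    if "0 < h" "h < d" for h
  proof -
    let ?g = "\<lambda>s. f (z + h *\<^sub>R v + s *\<^sub>R u) - f (z + s *\<^sub>R u)"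
    have "\<exists>s>0. s < h \<and> ?g h - ?g 0 = (h - 0) * (Du (z + h *\<^sub>R v + s *\<^sub>R u) - Du (z + s *\<^sub>R u))"
    proof (rule MVT2)
      fix s assume s: "0 \<le> s" "s \<le> h"
      have "z + h *\<^sub>R v + s *\<^sub>R u \<in> S" "z + s *\<^sub>R u \<in> S"
        using inS[of s h h] inS[of s h 0] s that by (auto simp: algebra_simps)
      then show "(?g has_real_derivative (Du (z + h *\<^sub>R v + s *\<^sub>R u) - Du (z + s *\<^sub>R u))) (at s)"
        unfolding Du_def by (intro DERIV_diff has_real_derivative_line dif)
    qed (use that in auto)
    then obtain s where s: "0 < s" "s < h"
      and g: "?g h - ?g 0 = h * (Du (z + h *\<^sub>R v + s *\<^sub>R u) - Du (z + s *\<^sub>R u))" by auto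
    have "\<exists>t>0. t < h \<and> Du (z + s *\<^sub>R u + h *\<^sub>R v) - Du (z + s *\<^sub>R u + 0 *\<^sub>R v) = (h - 0) * Dvu (z + s *\<^sub>R u + t *\<^sub>R v)"
    proof (rule MVT2)
      fix t assume t: "0 \<le> t" "t \<le> h"
      show "((\<lambda>t. Du (z + s *\<^sub>R u + t *\<^sub>R v)) has_real_derivative Dvu (z + s *\<^sub>R u + t *\<^sub>R v)) (at t)"
        unfolding Dvu_def by (rule has_real_derivative_line, rule dif, rule inS[of s h]) (use s t that in auto)
    qed (use that in auto)
    then obtain t where t: "0 < t" "t < h"
      and "Du (z + s *\<^sub>R u + h *\<^sub>R v) - Du (z + s *\<^sub>R u) = h * Dvu (z + s *\<^sub>R u + t *\<^sub>R v)" by auto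
    with g have "?g h - ?g 0 = h * (h * Dvu (z + s *\<^sub>R u + t *\<^sub>R v))"
      by (simp add: algebra_simps)
    then have "f (z + h *\<^sub>R u + h *\<^sub>R v) - f (z + h *\<^sub>R u) - f (z + h *\<^sub>R v) + f z = h\<^sup>2 * Dvu (z + s *\<^sub>R u + t *\<^sub>R v)"
      by (simp add: algebra_simps power2_eq_square)
    then have "(f (z + h *\<^sub>R u + h *\<^sub>R v) - f (z + h *\<^sub>R u) - f (z + h *\<^sub>R v) + f z) / h\<^sup>2 = Dvu (z + s *\<^sub>R u + t *\<^sub>R v)"
      using that by simp
    then show ?thesis
      using d0[of "z + s *\<^sub>R u + t *\<^sub>R v"] near[of s h t] s t that by simp
  qed
  then show "\<forall>\<^sub>F h in at_right 0. dist ((f (z + h *\<^sub>R u + h *\<^sub>R v) - f (z + h *\<^sub>R u) - f (z + h *\<^sub>R v) + f z) / h\<^sup>2)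
      (frechet_derivative (\<lambda>x. frechet_derivative f (at x) u) (at z) v) < e"
    unfolding eventually_at_right_field Dvu_def Du_def using \<open>d > 0\<close> by blast
qed

lemma second_derivative_symmetric_real:
  fixes f :: "'a::real_normed_vector \<Rightarrow> real"
  assumes "open S" "times_differentiable_on 2 S f" "z \<in> S"
  shows "frechet_derivative (\<lambda>x. frechet_derivative f (at x) u) (at z) v =
    frechet_derivative (\<lambda>x. frechet_derivative f (at x) v) (at z) u"
proof (rule tendsto_unique[OF _ second_difference_quotient_tendsto[OF assms]])
  show "((\<lambda>h. (f (z + h *\<^sub>R u + h *\<^sub>R v) - f (z + h *\<^sub>R u) - f (z + h *\<^sub>R v) + f z) / h\<^sup>2) \<longlongrightarrow>
     frechet_derivative (\<lambda>x. frechet_derivative f (at x) v) (at z) u) (at_right 0)"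
    using second_difference_quotient_tendsto[OF assms, of v u] by (simp add: algebra_simps)
qed simp

lemma frechet_derivative_bounded_linear:
  assumes "bounded_linear L" "f differentiable (at x)"
  shows "frechet_derivative (\<lambda>x. L (f x)) (at x) v = L (frechet_derivative f (at x) v)"
proof -
  have "((\<lambda>x. L (f x)) has_derivative (\<lambda>v. L (frechet_derivative f (at x) v))) (at x)"
    using assms by (intro bounded_linear.has_derivative[OF assms(1)]) (simp add: frechet_derivative_works[symmetric])
  then show ?thesis
    using frechet_derivative_at by metis
qed

lemma frechet_derivative_cong_open:
  assumes "open S" "x \<in> S" "\<And>y. y \<in> S \<Longrightarrow> f y = g y"
  shows "frechet_derivative f (at x) = frechet_derivative g (at x)"
proof -
  have "(f has_derivative D) (at x) \<longleftrightarrow> (g has_derivative D) (at x)" for D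
    using has_derivative_transform_within_open[OF _ assms(1,2)] assms(3) by metis
  then show ?thesis unfolding frechet_derivative_def by simp
qed

text \<open>The mean value theorem needs real values, so the real case is applied to
  \<open>L \<circ> f\<close> for the two functionals \<open>L = Re\<close> and
  \<open>L = Im\<close>.\<close>

lemma second_derivative_symmetric:
  fixes f :: "'a::real_normed_vector \<Rightarrow> complex"
  assumes S: "open S" and f: "times_differentiable_on 2 S f" and "z \<in> S"
  shows "frechet_derivative (\<lambda>x. frechet_derivative f (at x) u) (at z) v =
    frechet_derivative (\<lambda>x. frechet_derivative f (at x) v) (at z) u"
proof -
  have *: "L (frechet_derivative (\<lambda>x. frechet_derivative f (at x) u) (at z) v) =
    L (frechet_derivative (\<lambda>x. frechet_derivative f (at x) v) (at z) u)" if L: "bounded_linear L"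
  for L :: "complex \<Rightarrow> real"
  proof -
    have "L (frechet_derivative (\<lambda>x. frechet_derivative f (at x) a) (at z) b) =
      frechet_derivative (\<lambda>x. frechet_derivative (\<lambda>y. L (f y)) (at x) a) (at z) b" for a b
    proof -
      have "L (frechet_derivative (\<lambda>x. frechet_derivative f (at x) a) (at z) b) =
        frechet_derivative (\<lambda>x. L (frechet_derivative f (at x) a)) (at z) b"
        using f \<open>z \<in> S\<close> by (subst frechet_derivative_bounded_linear[OF L]) (auto simp: numeral_2_eq_2)
      also have "frechet_derivative (\<lambda>x. L (frechet_derivative f (at x) a)) (at z) =
        frechet_derivative (\<lambda>x. frechet_derivative (\<lambda>y. L (f y)) (at x) a) (at z)"
        using f by (intro frechet_derivative_cong_open[OF S \<open>z \<in> S\<close>] frechet_derivative_bounded_linear[OF L, symmetric])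
          (auto simp: numeral_2_eq_2)
      finally show ?thesis .
    qed
    then show ?thesis
      using second_derivative_symmetric_real[OF S times_differentiable_on_bounded_linear[OF S L f] \<open>z \<in> S\<close>] by simp
  qed
  show ?thesis
    using *[OF bounded_linear_Re] *[OF bounded_linear_Im] by (rule complex_eqI)
qed

section \<open>Wirtinger operators and the holomorphic chain rule\<close>

text \<open>A common form of both operators, with \<open>s = - \<i>\<close> for \<open>del_z\<close>
  and \<open>s = \<i>\<close> for \<open>del_zbar\<close>, so that every rule of calculus is proved
  once.\<close>

definition wirtinger :: "complex \<Rightarrow> 'n \<Rightarrow> (complex^'n \<Rightarrow> complex) \<Rightarrow> complex^'n \<Rightarrow> complex" where
  "wirtinger s i f z = (frechet_derivative f (at z) (axis i 1) + s * frechet_derivative f (at z) (axis i \<i>)) / 2"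

lemma del_z_eq_wirtinger: "del_z = wirtinger (- \<i>)"
  by (auto simp: fun_eq_iff del_z_def wirtinger_def)

lemma del_zbar_eq_wirtinger: "del_zbar = wirtinger \<i>"
  by (auto simp: fun_eq_iff del_zbar_def wirtinger_def)

lemma wirtinger_has_derivative:
  "(f has_derivative f') (at z) \<Longrightarrow> wirtinger s i f z = (f' (axis i 1) + s * f' (axis i \<i>)) / 2"
  using frechet_derivative_at[of f f' z] by (simp add: wirtinger_def)

lemma wirtinger_cong:
  assumes "open S" "z \<in> S" "\<And>w. w \<in> S \<Longrightarrow> f w = g w"
  shows "wirtinger s i f z = wirtinger s i g z"
  using frechet_derivative_cong_open[OF assms] by (simp add: wirtinger_def)

lemma wirtinger_const [simp]: "wirtinger s i (\<lambda>w. c) z = 0"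
  by (subst wirtinger_has_derivative[OF has_derivative_const]) simp

lemma wirtinger_add:
  assumes "f differentiable (at z)" "g differentiable (at z)"
  shows "wirtinger s i (\<lambda>w. f w + g w) z = wirtinger s i f z + wirtinger s i g z"
proof -
  have "((\<lambda>w. f w + g w) has_derivative (\<lambda>v. frechet_derivative f (at z) v + frechet_derivative g (at z) v)) (at z)"
    using assms by (intro has_derivative_add) (simp_all add: frechet_derivative_works[symmetric])
  moreover have "(a + b + s * (c + d)) / 2 = (a + s * c) / 2 + (b + s * d) / 2" for a b c d
    by (simp add: field_simps)
  ultimately show ?thesis
    by (simp only: wirtinger_has_derivative wirtinger_def[of s i f] wirtinger_def[of s i g])
qed

lemma wirtinger_mult:
  assumes "f differentiable (at z)" "g differentiable (at z)"
  shows "wirtinger s i (\<lambda>w. f w * g w) z = f z * wirtinger s i g z + wirtinger s i f z * g z"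
proof -
  have "((\<lambda>w. f w * g w) has_derivative (\<lambda>v. f z * frechet_derivative g (at z) v + frechet_derivative f (at z) v * g z)) (at z)"
    using assms by (intro has_derivative_mult) (simp_all add: frechet_derivative_works[symmetric])
  moreover have "(x * a + b * y + s * (x * c + d * y)) / 2 = x * ((a + s * c) / 2) + (b + s * d) / 2 * y" for x y a b c d
    by (simp add: field_simps)
  ultimately show ?thesis
    by (simp only: wirtinger_has_derivative wirtinger_def[of s i f] wirtinger_def[of s i g])
qed

lemma wirtinger_cmult:
  "f differentiable (at z) \<Longrightarrow> wirtinger s i (\<lambda>w. c * f w) z = c * wirtinger s i f z"
  using wirtinger_mult[of "\<lambda>w. c" z f s i] by simp

lemma wirtinger_sum:
  assumes "\<And>a. a \<in> I \<Longrightarrow> f a differentiable (at z)"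
  shows "wirtinger s i (\<lambda>w. \<Sum>a\<in>I. f a w) z = (\<Sum>a\<in>I. wirtinger s i (f a) z)"
  using assms
proof (induction I rule: infinite_finite_induct)
  case (insert a I)
  then show ?case by (simp add: wirtinger_add)
qed simp_all

lemma times_differentiable_on_wirtinger:
  assumes "open S" "times_differentiable_on (Suc k) S f"
  shows "times_differentiable_on k S (wirtinger s i f)"
proof -
  have "times_differentiable_on k S (\<lambda>z. (1/2) * (frechet_derivative f (at z) (axis i 1) + s * frechet_derivative f (at z) (axis i \<i>)))"
    using assms(2) by (intro times_differentiable_on_mult times_differentiable_on_add assms(1)
        times_differentiable_on_const) simp_all
  then show ?thesis by (simp add: wirtinger_def[abs_def] mult.commute)
qed

lemma times_differentiable_onD:
  "times_differentiable_on k S f \<Longrightarrow> 0 < k \<Longrightarrow> z \<in> S \<Longrightarrow> f differentiable (at z)"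
  by (cases k) auto

lemma wirtinger_commute:
  assumes S: "open S" and f: "times_differentiable_on 2 S f" and z: "z \<in> S"
  shows "wirtinger s i (wirtinger t j f) z = wirtinger t j (wirtinger s i f) z"
proof -
  let ?D = "\<lambda>u x. frechet_derivative f (at x) u"
  have dif: "?D u differentiable (at z)" for u
    using f z by (auto simp: numeral_2_eq_2)
  have w: "wirtinger s i (wirtinger t j f) z = (1/2) * (wirtinger s i (?D (axis j 1)) z + t * wirtinger s i (?D (axis j \<i>)) z)"
    for s i t j
  proof -
    have "wirtinger s i (wirtinger t j f) z = wirtinger s i (\<lambda>z. (1/2) * (?D (axis j 1) z + t * ?D (axis j \<i>) z)) z"
      by (simp add: wirtinger_def[abs_def] mult.commute)
    also have "\<dots> = (1/2) * (wirtinger s i (?D (axis j 1)) z + t * wirtinger s i (?D (axis j \<i>)) z)"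
      using dif by (simp only: wirtinger_cmult wirtinger_add differentiable_add differentiable_mult differentiable_const)
    finally show ?thesis .
  qed
  show ?thesis
    unfolding w unfolding wirtinger_def
    using second_derivative_symmetric[OF S f z] by (simp add: field_simps)
qed

lemma axis_decomposition:
  fixes V :: "complex^'n::finite"
  shows "V = (\<Sum>a\<in>UNIV. Re (V $ a) *\<^sub>R axis a 1 + Im (V $ a) *\<^sub>R axis a \<i>)"
proof -
  have "Re x *\<^sub>R 1 + Im x *\<^sub>R \<i> = x" for x by (simp add: complex_eq_iff)
  then show ?thesis
    by (auto simp: vec_eq_iff axis_def if_distrib cong: if_cong)
qed

text \<open>This is the splitting of the real differential into its parts of type (1,0) and
  (0,1).\<close>

lemma frechet_derivative_eq_wirtinger:
  fixes h :: "complex^'n::finite \<Rightarrow> complex"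
  assumes "h differentiable (at w)"
  shows "frechet_derivative h (at w) V =
    (\<Sum>a\<in>UNIV. V $ a * del_z a h w + cnj (V $ a) * del_zbar a h w)"
proof -
  have lin: "linear (frechet_derivative h (at w))"
    by (rule linear_frechet_derivative[OF assms])
  have "frechet_derivative h (at w) V = (\<Sum>a\<in>UNIV. Re (V $ a) *\<^sub>R frechet_derivative h (at w) (axis a 1)
      + Im (V $ a) *\<^sub>R frechet_derivative h (at w) (axis a \<i>))"
    by (subst (1) axis_decomposition) (simp add: linear_sum[OF lin] linear_add[OF lin] linear_scale[OF lin])
  also have "\<dots> = (\<Sum>a\<in>UNIV. V $ a * del_z a h w + cnj (V $ a) * del_zbar a h w)"
  proof (rule sum.cong[OF refl])
    fix a
    have "Re x *\<^sub>R p + Im x *\<^sub>R q = x * ((p - \<i> * q) / 2) + cnj x * ((p + \<i> * q) / 2)" for x p q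
      by (simp add: complex_eq_iff field_simps)
    then show "Re (V $ a) *\<^sub>R frechet_derivative h (at w) (axis a 1)
      + Im (V $ a) *\<^sub>R frechet_derivative h (at w) (axis a \<i>) = V $ a * del_z a h w + cnj (V $ a) * del_zbar a h w"
      by (simp add: del_z_def del_zbar_def)
  qed
  finally show ?thesis .
qed


lemma holomorphic_map_component:
  assumes "open S" "holomorphic_map_on S T"
  shows "times_differentiable_on k S (\<lambda>w. T w $ a)"
  using assms unfolding holomorphic_map_on_def smooth_on_def
  by (intro times_differentiable_on_bounded_linear[OF _ bounded_linear_vec_nth]) auto

lemma holomorphic_map_frechet_derivative:
  fixes T :: "complex^'n::finite \<Rightarrow> complex^'n"
  assumes S: "open S" and T: "holomorphic_map_on S T" and z: "z \<in> S"
  shows "frechet_derivative T (at z) V $ a = (\<Sum>i\<in>UNIV. V $ i * del_z i (\<lambda>w. T w $ a) z)"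
proof -
  have "T differentiable (at z)"
    using T z unfolding holomorphic_map_on_def smooth_on_def
    by (auto intro: times_differentiable_onD[of 1])
  then have "frechet_derivative T (at z) V $ a = frechet_derivative (\<lambda>w. T w $ a) (at z) V"
    using frechet_derivative_bounded_linear[OF bounded_linear_vec_nth] by metis
  also have "\<dots> = (\<Sum>i\<in>UNIV. V $ i * del_z i (\<lambda>w. T w $ a) z + cnj (V $ i) * del_zbar i (\<lambda>w. T w $ a) z)"
    by (rule frechet_derivative_eq_wirtinger)
      (use times_differentiable_onD[OF holomorphic_map_component[OF S T, of 1]] z in auto)
  also have "\<dots> = (\<Sum>i\<in>UNIV. V $ i * del_z i (\<lambda>w. T w $ a) z)"
    using T z by (simp add: holomorphic_map_on_def)
  finally show ?thesis .
qed

lemma holomorphic_compose_frechet_derivative: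
  fixes T :: "complex^'n::finite \<Rightarrow> complex^'n"
  assumes S: "open S" and T: "holomorphic_map_on S T" and z: "z \<in> S"
    and h: "h differentiable (at (T z))"
  shows "frechet_derivative (\<lambda>w. h (T w)) (at z) V = frechet_derivative h (at (T z)) (frechet_derivative T (at z) V)"
proof -
  have "T differentiable (at z)"
    using T z unfolding holomorphic_map_on_def smooth_on_def
    by (auto intro: times_differentiable_onD[of 1])
  then have "((\<lambda>w. h (T w)) has_derivative (\<lambda>V. frechet_derivative h (at (T z)) (frechet_derivative T (at z) V))) (at z)"
    using h by (intro has_derivative_compose[where f = T and g = h]) (simp_all add: frechet_derivative_works[symmetric])
  then show ?thesis using frechet_derivative_at by metis
qed

lemma
  fixes T :: "complex^'n::finite \<Rightarrow> complex^'n"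
  assumes S: "open S" and T: "holomorphic_map_on S T" and z: "z \<in> S"
    and h: "h differentiable (at (T z))"
  shows del_z_compose: "del_z i (\<lambda>w. h (T w)) z = (\<Sum>a\<in>UNIV. del_z a h (T z) * del_z i (\<lambda>w. T w $ a) z)"
    and del_zbar_compose: "del_zbar i (\<lambda>w. h (T w)) z = (\<Sum>a\<in>UNIV. del_zbar a h (T z) * cnj (del_z i (\<lambda>w. T w $ a) z))"
proof -
  have ax: "(\<Sum>j\<in>UNIV. axis i c $ j * x j) = c * x i" for c :: complex and x
    by (simp add: axis_def if_distrib[of "\<lambda>y. y * _"] cong: if_cong)
  have D: "frechet_derivative (\<lambda>w. h (T w)) (at z) (axis i c) =
    (\<Sum>a\<in>UNIV. c * del_z i (\<lambda>w. T w $ a) z * del_z a h (T z) +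
      cnj (c * del_z i (\<lambda>w. T w $ a) z) * del_zbar a h (T z))" for c
    by (simp only: holomorphic_compose_frechet_derivative[OF S T z h] frechet_derivative_eq_wirtinger[OF h]
        holomorphic_map_frechet_derivative[OF S T z] ax)
  show "del_z i (\<lambda>w. h (T w)) z = (\<Sum>a\<in>UNIV. del_z a h (T z) * del_z i (\<lambda>w. T w $ a) z)"
    by (simp only: del_z_def[of i "\<lambda>w. h (T w)"] D sum_distrib_left sum_subtractf[symmetric] sum_divide_distrib)
      (rule sum.cong, simp_all add: field_simps)
  show "del_zbar i (\<lambda>w. h (T w)) z = (\<Sum>a\<in>UNIV. del_zbar a h (T z) * cnj (del_z i (\<lambda>w. T w $ a) z))"
    by (simp only: del_zbar_def[of i "\<lambda>w. h (T w)"] D sum_distrib_left sum.distrib[symmetric] sum_divide_distrib)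
      (rule sum.cong, simp_all add: field_simps)
qed

text \<open>No first derivatives of \<open>h\<close> occur, since a holomorphic map has vanishing
  mixed second derivatives. So the complex Hessian transforms as a tensor, and its trace will not
  depend on the chart.\<close>

lemma del_zbar_del_z_compose:
  fixes T :: "complex^'n::finite \<Rightarrow> complex^'n"
  assumes S: "open S" and U: "open U" and T: "holomorphic_map_on S T" and TS: "T ` S \<subseteq> U"
    and h: "times_differentiable_on 2 U h" and z: "z \<in> S"
  shows "del_zbar j (del_z i (\<lambda>w. h (T w))) z =
    (\<Sum>a\<in>UNIV. \<Sum>b\<in>UNIV. del_zbar b (del_z a h) (T z) * del_z i (\<lambda>w. T w $ a) z * cnj (del_z j (\<lambda>w. T w $ b) z))"
proof -
  have hz: "times_differentiable_on 1 U (del_z a h)" for a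
    unfolding del_z_eq_wirtinger
    by (rule times_differentiable_on_wirtinger[OF U]) (use h in \<open>simp only: numeral_2_eq_2 One_nat_def\<close>)
  have hd: "h differentiable (at (T w))" "del_z a h differentiable (at (T w))" if "w \<in> S" for w a
    using times_differentiable_onD[OF h] times_differentiable_onD[OF hz] TS that by auto
  have Tsm: "times_differentiable_on k S T" for k
    using T by (auto simp: holomorphic_map_on_def smooth_on_def)
  have Tz: "times_differentiable_on k S (del_z i (\<lambda>w. T w $ a))" for a k
    unfolding del_z_eq_wirtinger
    by (rule times_differentiable_on_wirtinger[OF S holomorphic_map_component[OF S T]])
  have d1: "(\<lambda>w. del_z a h (T w)) differentiable (at z)" for a
    using times_differentiable_on_compose[OF S U hz Tsm TS] times_differentiable_onD z by fastforce
  have d2: "del_z i (\<lambda>w. T w $ a) differentiable (at z)" for a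
    using Tz[of 1] times_differentiable_onD z by fastforce
  \<comment> \<open>The operators commute, and \<open>del_zbar j\<close> of the component vanishes
    on all of \<open>S\<close>, hence near \<open>z\<close>, so it may be differentiated once
    more.\<close>
  have zero: "del_zbar j (del_z i (\<lambda>w. T w $ a)) z = 0" for a
  proof -
    have "del_zbar j (del_z i (\<lambda>w. T w $ a)) z = del_z i (del_zbar j (\<lambda>w. T w $ a)) z"
      unfolding del_z_eq_wirtinger del_zbar_eq_wirtinger
      by (rule wirtinger_commute[OF S holomorphic_map_component[OF S T] z])
    also have "\<dots> = del_z i (\<lambda>w. 0) z"
      unfolding del_z_eq_wirtinger
      by (rule wirtinger_cong[OF S z]) (use T in \<open>simp add: holomorphic_map_on_def\<close>)
    finally show ?thesis by (simp add: del_z_eq_wirtinger)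
  qed
  have "del_zbar j (del_z i (\<lambda>w. h (T w))) z =
    del_zbar j (\<lambda>w. \<Sum>a\<in>UNIV. del_z a h (T w) * del_z i (\<lambda>w. T w $ a) w) z"
    unfolding del_zbar_eq_wirtinger
    by (rule wirtinger_cong[OF S z], rule del_z_compose[OF S T _ hd(1)])
  also have "\<dots> = (\<Sum>a\<in>UNIV. del_zbar j (\<lambda>w. del_z a h (T w) * del_z i (\<lambda>w. T w $ a) w) z)"
    unfolding del_zbar_eq_wirtinger by (intro wirtinger_sum differentiable_mult d1 d2)
  also have "\<dots> = (\<Sum>a\<in>UNIV. del_zbar j (\<lambda>w. del_z a h (T w)) z * del_z i (\<lambda>w. T w $ a) z)"
    using zero unfolding del_zbar_eq_wirtinger by (simp add: wirtinger_mult d1 d2)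
  also have "\<dots> = (\<Sum>a\<in>UNIV. \<Sum>b\<in>UNIV. del_zbar b (del_z a h) (T z) * del_z i (\<lambda>w. T w $ a) z * cnj (del_z j (\<lambda>w. T w $ b) z))"
    by (simp add: del_zbar_compose[OF S T z hd(2)[OF z]] sum_distrib_left mult_ac)
  finally show ?thesis .
qed

section \<open>Alternating sums and Pfaffians\<close>

text \<open>A wedge product is a normalised alternation of a tensor product; working with the
  unnormalised sum confines the factorials to \<open>alternation_absorb\<close>. The argument type
  is left open because the arguments will be either vectors or their labels.\<close>

definition alternation :: "nat \<Rightarrow> ((nat \<Rightarrow> 'v) \<Rightarrow> complex) \<Rightarrow> (nat \<Rightarrow> 'v) \<Rightarrow> complex" where
  "alternation k T v = (\<Sum>\<sigma> | \<sigma> permutes {..<k}. of_int (sign \<sigma>) * T (\<lambda>i. v (\<sigma> i)))"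

lemma wedge_eq_alternation:
  "wedge k l \<alpha> \<beta> v = alternation (k + l) (\<lambda>u. \<alpha> u * \<beta> (\<lambda>i. u (k + i))) v / (fact k * fact l)"
  by (simp add: wedge_def alternation_def mult.assoc)

lemma alternation_cong:
  assumes "\<And>\<sigma>. \<sigma> permutes {..<k} \<Longrightarrow> T (\<lambda>i. v (\<sigma> i)) = T' (\<lambda>i. v' (\<sigma> i))"
  shows "alternation k T v = alternation k T' v'"
  unfolding alternation_def using assms by (intro sum.cong) auto

lemma alternation_cmult: "alternation k (\<lambda>u. c * T u) v = c * alternation k T v"
  by (simp add: alternation_def sum_distrib_left mult_ac)

lemma alternation_sum: "alternation k (\<lambda>u. \<Sum>a\<in>I. T a u) v = (\<Sum>a\<in>I. alternation k (T a) v)"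
  unfolding alternation_def sum_distrib_left by (rule sum.swap)

lemma alternation_add: "alternation k (\<lambda>u. T u + T' u) v = alternation k T v + alternation k T' v"
  by (simp add: alternation_def distrib_left sum.distrib)

lemma permutation_if_permutes_lessThan: "\<sigma> permutes {..<k::nat} \<Longrightarrow> permutation \<sigma>"
  using permutation_permutes by blast

lemma alternation_permute:
  assumes "\<tau> permutes {..<k}"
  shows "alternation k (\<lambda>u. T (\<lambda>i. u (\<tau> i))) v = of_int (sign \<tau>) * alternation k T v"
proof -
  have "alternation k T v = (\<Sum>\<sigma> | \<sigma> permutes {..<k}. of_int (sign (\<sigma> \<circ> \<tau>)) * T (\<lambda>i. v ((\<sigma> \<circ> \<tau>) i)))"
    unfolding alternation_def by (rule sum_permutations_compose_right[OF assms])
  also have "\<dots> = (\<Sum>\<sigma> | \<sigma> permutes {..<k}. of_int (sign \<tau>) * (of_int (sign \<sigma>) * T (\<lambda>i. v (\<sigma> (\<tau> i)))))"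
    using assms by (intro sum.cong) (auto simp: sign_compose permutation_if_permutes_lessThan)
  also have "\<dots> = of_int (sign \<tau>) * alternation k (\<lambda>u. T (\<lambda>i. u (\<tau> i))) v"
    by (simp add: alternation_def sum_distrib_left)
  finally show ?thesis
    by (simp add: mult.assoc[symmetric] of_int_mult[symmetric] del: of_int_mult)
qed

text \<open>Exchanging the slots \<open>a\<close> and \<open>b\<close> negates the alternation but
  by assumption leaves each of its terms unchanged.\<close>

lemma alternation_eq_0:
  assumes "a \<noteq> b" "a < k" "b < k"
    and "\<And>\<sigma>. \<sigma> permutes {..<k} \<Longrightarrow> T (\<lambda>i. v (\<sigma> (Transposition.transpose a b i))) = T (\<lambda>i. v (\<sigma> i))"
  shows "alternation k T v = 0"
proof -
  have "alternation k (\<lambda>u. T (\<lambda>i. u (Transposition.transpose a b i))) v = - alternation k T v"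
    using assms by (subst alternation_permute) (auto intro: permutes_swap_id simp: sign_swap_id)
  moreover have "alternation k (\<lambda>u. T (\<lambda>i. u (Transposition.transpose a b i))) v = alternation k T v"
    by (rule alternation_cong) (use assms(4) in simp)
  ultimately show ?thesis by simp
qed

text \<open>With labels as arguments, the slot in which a given argument stands can be tested by an
  equation, even if some of the vectors coincide.\<close>

lemma alternation_labels: "alternation k T v = alternation k (\<lambda>u. T (\<lambda>i. v (u i))) (\<lambda>i. i)"
  by (simp add: alternation_def)

abbreviation shift_permutation :: "nat \<Rightarrow> nat \<Rightarrow> (nat \<Rightarrow> nat) \<Rightarrow> nat \<Rightarrow> nat" where
  "shift_permutation k l \<equiv> map_permutation {..<l} ((+) k)"

lemma bij_betw_shift: "bij_betw ((+) k) {..<l} {k..<k + l::nat}"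
  by (rule bij_betw_byWitness[where f' = "\<lambda>i. i - k"]) auto

lemma
  assumes "\<tau> permutes {..<l}"
  shows shift_permutation_permutes: "shift_permutation k l \<tau> permutes {..<k + l}"
    and shift_permutation_add: "shift_permutation k l \<tau> (k + i) = k + \<tau> i"
    and shift_permutation_less: "i < k \<Longrightarrow> shift_permutation k l \<tau> i = i"
    and sign_shift_permutation: "sign (shift_permutation k l \<tau>) = sign \<tau>"
proof -
  have 1: "shift_permutation k l \<tau> permutes {k..<k + l}"
    by (rule map_permutation_permutes[OF bij_betw_shift assms])
  then show "shift_permutation k l \<tau> permutes {..<k + l}"
    by (rule permutes_subset) auto
  show "shift_permutation k l \<tau> (k + i) = k + \<tau> i"
  proof (cases "i < l")
    case True
    then show ?thesis by (intro map_permutation_apply) auto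
  next
    case False
    then show ?thesis using 1 assms by (simp add: permutes_not_in)
  qed
  show "i < k \<Longrightarrow> shift_permutation k l \<tau> i = i"
    using 1 by (simp add: permutes_not_in)
  show "sign (shift_permutation k l \<tau>) = sign \<tau>"
    by (rule sign_map_permutation[OF _ assms]) auto
qed

text \<open>A permutation of the last \<open>l\<close> slots extends to all slots with the same sign
  and fixes the first \<open>k\<close>, the only ones that \<open>\<alpha>\<close> sees.
  Substituting it shows that each of the \<open>fact l\<close> terms of the inner alternation
  contributes the same. This is associativity of the wedge product in disguise.\<close>

lemma alternation_absorb:
  assumes "\<And>u u'. (\<And>i. i < k \<Longrightarrow> u i = u' i) \<Longrightarrow> \<alpha> u = \<alpha> u'"
  shows "alternation (k + l) (\<lambda>u. \<alpha> u * alternation l T (\<lambda>i. u (k + i))) v =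
    fact l * alternation (k + l) (\<lambda>u. \<alpha> u * T (\<lambda>i. u (k + i))) v"
proof -
  let ?T = "\<lambda>u. \<alpha> u * T (\<lambda>i. u (k + i))"
  have "alternation (k + l) (\<lambda>u. \<alpha> u * alternation l T (\<lambda>i. u (k + i))) v =
    (\<Sum>\<tau> | \<tau> permutes {..<l}. of_int (sign \<tau>) * alternation (k + l) (\<lambda>u. \<alpha> u * T (\<lambda>i. u (k + \<tau> i))) v)"
    unfolding alternation_cmult[symmetric] alternation_sum[symmetric]
    by (simp add: alternation_def[of l] sum_distrib_left mult_ac)
  also have "\<dots> = (\<Sum>\<tau> | \<tau> permutes {..<l}. alternation (k + l) ?T v)"
  proof (rule sum.cong[OF refl])
    fix \<tau> assume "\<tau> \<in> {\<tau>. \<tau> permutes {..<l}}"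
    then have \<tau>: "\<tau> permutes {..<l}" by simp
    have \<alpha>: "\<alpha> (\<lambda>i. u (shift_permutation k l \<tau> i)) = \<alpha> u" for u
      using shift_permutation_less[OF \<tau>] by (intro assms) auto
    have "alternation (k + l) (\<lambda>u. \<alpha> u * T (\<lambda>i. u (k + \<tau> i))) v =
      alternation (k + l) (\<lambda>u. ?T (\<lambda>i. u (shift_permutation k l \<tau> i))) v"
      by (simp add: shift_permutation_add[OF \<tau>] \<alpha>)
    also have "\<dots> = of_int (sign \<tau>) * alternation (k + l) ?T v"
      using alternation_permute[OF shift_permutation_permutes[OF \<tau>], where T = ?T and v = v]
      by (simp add: sign_shift_permutation[OF \<tau>])
    finally show "of_int (sign \<tau>) * alternation (k + l) (\<lambda>u. \<alpha> u * T (\<lambda>i. u (k + \<tau> i))) v = alternation (k + l) ?T v"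
      by (simp add: mult.assoc[symmetric] of_int_mult[symmetric] del: of_int_mult)
  qed
  also have "\<dots> = fact l * alternation (k + l) ?T v"
    using card_permutations[of "{..<l}" l] by simp
  finally show ?thesis .
qed

section \<open>Powers of a two-form\<close>

text \<open>The \<open>m\<close>-fold tensor power of \<open>b\<close>. For an antisymmetric
  \<open>b\<close>, its alternation is \<open>2 ^ m * fact m\<close> times the Pfaffian of the
  matrix of values of \<open>b\<close>.\<close>

definition pair_prod :: "nat \<Rightarrow> ('v \<Rightarrow> 'v \<Rightarrow> complex) \<Rightarrow> (nat \<Rightarrow> 'v) \<Rightarrow> complex" where
  "pair_prod m b u = (\<Prod>i<m. b (u (2 * i)) (u (2 * i + 1)))"

lemma pair_prod_Suc: "pair_prod (Suc m) b u = b (u 0) (u 1) * pair_prod m b (\<lambda>i. u (2 + i))"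
  by (simp add: pair_prod_def prod.lessThan_Suc_shift del: prod.lessThan_Suc)

text \<open>Each wedge with \<open>\<omega>\<close> divides by \<open>fact 2 * fact (2 * m)\<close>.
  Absorption of the inner alternation cancels the second factor, so that one \<open>2\<close> per
  step remains.\<close>

lemma wedge_power_eq_alternation:
  assumes "\<And>v. \<omega> v = b (v 0) (v 1)"
  shows "wedge_power \<omega> m v = alternation (2 * m) (pair_prod m b) v / 2 ^ m"
proof (induction m arbitrary: v)
  case 0
  then show ?case by (simp add: alternation_def pair_prod_def)
next
  case (Suc m)
  have "wedge_power \<omega> (Suc m) v =
    alternation (2 + 2 * m) (\<lambda>u. b (u 0) (u 1) / 2 ^ m * alternation (2 * m) (pair_prod m b) (\<lambda>i. u (2 + i))) v / (2 * fact (2 * m))"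
    by (simp add: wedge_eq_alternation Suc.IH assms)
  also have "\<dots> = fact (2 * m) * alternation (2 + 2 * m) (\<lambda>u. b (u 0) (u 1) / 2 ^ m * pair_prod m b (\<lambda>i. u (2 + i))) v / (2 * fact (2 * m))"
    by (subst alternation_absorb) auto
  also have "\<dots> = alternation (2 + 2 * m) (\<lambda>u. (1 / 2 ^ m) * pair_prod (Suc m) b u) v / 2"
    by (simp add: pair_prod_Suc)
  also have "\<dots> = alternation (2 * Suc m) (pair_prod (Suc m) b) v / 2 ^ Suc m"
    by (subst alternation_cmult) simp
  finally show ?case .
qed

lemma pair_prod_swap_pairs:
  assumes "i < m" "\<And>j. \<tau> (2 * j) = 2 * Transposition.transpose 0 i j"
    "\<And>j. \<tau> (2 * j + 1) = 2 * Transposition.transpose 0 i j + 1"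
  shows "pair_prod m b (\<lambda>j. u (\<tau> j)) = pair_prod m b u"
proof -
  have "pair_prod m b u = (\<Prod>j<m. b (u (2 * Transposition.transpose 0 i j)) (u (2 * Transposition.transpose 0 i j + 1)))"
    unfolding pair_prod_def using assms(1)
    by (subst prod.permute[OF permutes_swap_id, of 0 _ i]) auto
  then show ?thesis
    by (simp only: pair_prod_def assms(2,3))
qed

section \<open>Expansion of Pfaffians along a row\<close>

locale antisymmetric_matrix =
  fixes b :: "nat \<Rightarrow> nat \<Rightarrow> complex"
  assumes antisym: "b i j = - b j i"
begin

lemma diag [simp]: "b i i = 0"
  using antisym[of i i] by simp

text \<open>The terms of the Pfaffian sorted by the slot that the label \<open>a\<close> occupies;
  all slots turn out to contribute equally.\<close>

definition pfaffian_at :: "nat \<Rightarrow> nat \<Rightarrow> nat \<Rightarrow> complex" where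
  "pfaffian_at n a j = alternation (2 * n) (\<lambda>u. of_bool (u j = a) * pair_prod n b u) (\<lambda>i. i)"

text \<open>Exchanging the pair number \<open>i\<close> with the first pair takes two
  transpositions, so the sign is unchanged, and it only reorders the factors of
  \<open>pair_prod\<close>.\<close>

lemma pfaffian_at_even:
  assumes "i < n"
  shows "pfaffian_at n a (2 * i) = pfaffian_at n a 0"
proof -
  define \<tau> where "\<tau> = Transposition.transpose 0 (2 * i) \<circ> Transposition.transpose 1 (2 * i + 1)"
  have p: "Transposition.transpose 0 (2 * i) permutes {..<2 * n}" "Transposition.transpose 1 (2 * i + 1) permutes {..<2 * n}"
    using assms by (auto intro!: permutes_swap_id)
  then have \<tau>: "\<tau> permutes {..<2 * n}"
    unfolding \<tau>_def by (intro permutes_compose)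
  have "sign \<tau> = 1"
    unfolding \<tau>_def using p by (subst sign_compose) (auto simp: sign_swap_id permutation_if_permutes_lessThan)
  have ev: "\<tau> (2 * j) = 2 * Transposition.transpose 0 i j" "\<tau> (2 * j + 1) = 2 * Transposition.transpose 0 i j + 1" for j
    by (auto simp: \<tau>_def Transposition.transpose_def) presburger+
  have "pfaffian_at n a 0 = alternation (2 * n) (\<lambda>u. of_bool (u (\<tau> 0) = a) * pair_prod n b (\<lambda>i. u (\<tau> i))) (\<lambda>i. i)"
    using alternation_permute[OF \<tau>, of "\<lambda>u. of_bool (u 0 = a) * pair_prod n b u" "\<lambda>i. i"] \<open>sign \<tau> = 1\<close>
    by (simp add: pfaffian_at_def)
  also have "\<tau> 0 = 2 * i" using ev(1)[of 0] by simp
  finally show ?thesis by (simp only: pfaffian_at_def pair_prod_swap_pairs[OF assms ev])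
qed

text \<open>The exchange of the two slots of a pair is odd, and antisymmetry of \<open>b\<close> in
  that one factor makes up for the sign.\<close>

lemma pfaffian_at_odd:
  assumes "i < n"
  shows "pfaffian_at n a (2 * i + 1) = pfaffian_at n a (2 * i)"
proof -
  define \<tau> where "\<tau> = Transposition.transpose (2 * i) (2 * i + 1)"
  have \<tau>: "\<tau> permutes {..<2 * n}"
    unfolding \<tau>_def using assms by (auto intro!: permutes_swap_id)
  have "sign \<tau> = - 1"
    unfolding \<tau>_def by (simp add: sign_swap_id)
  have pp: "pair_prod n b (\<lambda>j. u (\<tau> j)) = - pair_prod n b u" for u
  proof -
    have "pair_prod n b (\<lambda>j. u (\<tau> j)) = (\<Prod>j<n. (if j = i then - 1 else 1) * b (u (2 * j)) (u (2 * j + 1)))"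
      unfolding pair_prod_def
    proof (rule prod.cong[OF refl])
      fix j
      have "2 * i \<noteq> 2 * j + 1" "2 * i + 1 \<noteq> 2 * j" by presburger+
      then show "b (u (\<tau> (2 * j))) (u (\<tau> (2 * j + 1))) = (if j = i then - 1 else 1) * b (u (2 * j)) (u (2 * j + 1))"
        using antisym[of "u (2 * i + 1)" "u (2 * i)"] by (auto simp: \<tau>_def Transposition.transpose_def)
    qed
    also have "\<dots> = - pair_prod n b u"
      using assms by (simp add: prod.distrib pair_prod_def prod.delta)
    finally show ?thesis .
  qed
  have "- pfaffian_at n a (2 * i) = alternation (2 * n) (\<lambda>u. of_bool (u (\<tau> (2 * i)) = a) * pair_prod n b (\<lambda>i. u (\<tau> i))) (\<lambda>i. i)"
    using alternation_permute[OF \<tau>, of "\<lambda>u. of_bool (u (2 * i) = a) * pair_prod n b u" "\<lambda>i. i"] \<open>sign \<tau> = - 1\<close>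
    by (simp add: pfaffian_at_def)
  also have "\<tau> (2 * i) = 2 * i + 1" by (simp add: \<tau>_def)
  also have "alternation (2 * n) (\<lambda>u. of_bool (u (2 * i + 1) = a) * pair_prod n b (\<lambda>i. u (\<tau> i))) (\<lambda>i. i) =
      - pfaffian_at n a (2 * i + 1)"
    using alternation_cmult[of "2 * n" "- 1"] by (simp add: pp pfaffian_at_def)
  finally show ?thesis by simp
qed

lemma pfaffian_at_eq: "j < 2 * n \<Longrightarrow> pfaffian_at n a j = pfaffian_at n a 0"
proof (cases "even j")
  case True
  assume "j < 2 * n"
  then show ?thesis using True pfaffian_at_even[of "j div 2" n a] by auto
next
  case False
  assume "j < 2 * n"
  then show ?thesis using False pfaffian_at_even[of "j div 2" n a] pfaffian_at_odd[of "j div 2" n a] by auto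
qed

lemma sum_of_bool_permutes:
  fixes a k :: nat
  assumes "\<sigma> permutes {..<k}" "a < k"
  shows "(\<Sum>j<k. of_bool (\<sigma> j = a)) = (1 :: complex)"
proof -
  have "(\<sigma> j = a) = (j = inv \<sigma> a)" for j
    using assms(1) by (metis permutes_inverses)
  moreover have "inv \<sigma> a < k"
    using permutes_in_image[OF permutes_inv[OF assms(1)], of a] assms(2) by simp
  ultimately show ?thesis by simp
qed

lemma alternation_split_position:
  assumes "a < k"
  shows "alternation k T (\<lambda>i. i) = (\<Sum>j<k. alternation k (\<lambda>u. of_bool (u j = a) * T u) (\<lambda>i. i))"
  unfolding alternation_sum[symmetric] sum_distrib_right[symmetric]
  by (rule alternation_cong) (simp only: sum_of_bool_permutes[OF _ assms] mult_1)

lemma pfaffian_at_0: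
  assumes "a < 2 * n"
  shows "alternation (2 * n) (pair_prod n b) (\<lambda>i. i) = of_nat (2 * n) * pfaffian_at n a 0"
proof -
  have "alternation (2 * n) (pair_prod n b) (\<lambda>i. i) = (\<Sum>j<2 * n. pfaffian_at n a j)"
    unfolding pfaffian_at_def by (rule alternation_split_position[OF assms])
  also have "\<dots> = (\<Sum>j<2 * n. pfaffian_at n a 0)"
    by (rule sum.cong[OF refl], rule pfaffian_at_eq) simp
  finally show ?thesis by simp
qed

text \<open>In the sum, the row \<open>a\<close> of \<open>b\<close> sits at some position \<open>j\<close>; unless \<open>j = 0\<close>, exchanging position
  \<open>1\<close> with the partner of \<open>j\<close> shows that the terms cancel.\<close>

lemma alternation_row_contraction:
  assumes "a < 2 * Suc m"
  shows "alternation (2 * Suc m) (\<lambda>u. \<beta> (u 0) * b a (u 1) * pair_prod m b (\<lambda>i. u (2 + i))) (\<lambda>i. i) =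
    \<beta> a * pfaffian_at (Suc m) a 0"
proof -
  let ?T = "\<lambda>u. \<beta> (u 0) * b a (u 1) * pair_prod m b (\<lambda>i. u (2 + i))"
  let ?A = "\<lambda>j. alternation (2 * Suc m) (\<lambda>u. of_bool (u j = a) * ?T u) (\<lambda>i. i)"
  have A0: "?A 0 = \<beta> a * pfaffian_at (Suc m) a 0"
    unfolding pfaffian_at_def alternation_cmult[symmetric]
    by (rule alternation_cong) (auto simp: pair_prod_Suc)
  have A1: "?A 1 = 0"
    unfolding alternation_def by (rule sum.neutral) auto
  have A2: "?A (2 + j) = 0" if "j < 2 * m" for j
  proof -
    define i where "i = j div 2"
    define q where "q = (if even j then 2 + (2 * i + 1) else 2 + 2 * i)"
    have "i < m" using that by (auto simp: i_def)
    have j: "j = (if even j then 2 * i else 2 * i + 1)" by (auto simp: i_def)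
    show ?thesis
    proof (rule alternation_eq_0[of 1 q])
      show "1 \<noteq> q" "1 < 2 * Suc m" "q < 2 * Suc m" using \<open>i < m\<close> by (auto simp: q_def)
      fix \<sigma> :: "nat \<Rightarrow> nat"
      let ?t = "Transposition.transpose 1 q"
      have PP: "pair_prod m b (\<lambda>i. w (2 + i)) = b (w (2 + 2 * i)) (w (2 + (2 * i + 1))) * (\<Prod>l\<in>{..<m} - {i}. b (w (2 + 2 * l)) (w (2 + (2 * l + 1))))"
        for w using \<open>i < m\<close> unfolding pair_prod_def by (subst prod.remove[of _ i]) auto
      have R: "(\<Prod>l\<in>{..<m} - {i}. b (\<sigma> (?t (2 + 2 * l))) (\<sigma> (?t (2 + (2 * l + 1))))) =
        (\<Prod>l\<in>{..<m} - {i}. b (\<sigma> (2 + 2 * l)) (\<sigma> (2 + (2 * l + 1))))"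
      proof (rule prod.cong[OF refl])
        fix l assume "l \<in> {..<m} - {i}"
        then have "2 + 2 * l \<noteq> q" "2 + (2 * l + 1) \<noteq> q"
          unfolding q_def by auto
        then show "b (\<sigma> (?t (2 + 2 * l))) (\<sigma> (?t (2 + (2 * l + 1)))) = b (\<sigma> (2 + 2 * l)) (\<sigma> (2 + (2 * l + 1)))"
          by (auto simp: Transposition.transpose_def)
      qed
      have j': "?t (2 + j) = 2 + j" "?t 0 = 0" "?t 1 = q"
        using j by (auto simp: q_def Transposition.transpose_def split: if_splits)
      show "of_bool (\<sigma> (?t (2 + j)) = a) * ?T (\<lambda>i. \<sigma> (?t i)) = of_bool (\<sigma> (2 + j) = a) * ?T (\<lambda>i. \<sigma> i)"
      proof (cases "\<sigma> (2 + j) = a")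
        case True
        \<comment> \<open>With \<open>a\<close> in one slot of the pair, the product is symmetric in
          the labels at the slots \<open>1\<close> and \<open>q\<close>. If \<open>a\<close> stands
          in the second slot of the pair, antisymmetry enters once on each side and the signs
          agree.\<close>
        have "b a (\<sigma> q) * b (\<sigma> (?t (2 + 2 * i))) (\<sigma> (?t (2 + (2 * i + 1)))) =
          b a (\<sigma> 1) * b (\<sigma> (2 + 2 * i)) (\<sigma> (2 + (2 * i + 1)))"
        proof (cases "even j")
          case T: True
          then have "\<sigma> (2 + 2 * i) = a" "q = 2 + (2 * i + 1)" using True j by (auto simp: q_def)
          then show ?thesis by (simp add: Transposition.transpose_def)
        next
          case F: False
          then have "\<sigma> (2 + (2 * i + 1)) = a" "q = 2 + 2 * i" using True j by (auto simp: q_def)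
          then show ?thesis
            using antisym[of "\<sigma> 1" a] antisym[of "\<sigma> q" a] by (simp add: Transposition.transpose_def)
        qed
        from arg_cong[OF this, of "\<lambda>y. \<beta> (\<sigma> 0) * y * (\<Prod>l\<in>{..<m} - {i}. b (\<sigma> (2 + 2 * l)) (\<sigma> (2 + (2 * l + 1))))"]
        show ?thesis
          by (simp only: PP[of "\<lambda>i. \<sigma> (?t i)"] PP[of \<sigma>] R j' mult.assoc)
      next
        case False
        then show ?thesis
          by (simp only: j'(1) of_bool_eq(1) mult_zero_left)
      qed
    qed
  qed
  have split: "(\<Sum>j<2 * Suc m. f j) = f 0 + (f 1 + (\<Sum>j<2 * m. f (2 + j)))" for f :: "nat \<Rightarrow> complex"
    by (simp add: sum.lessThan_Suc_shift del: sum.lessThan_Suc)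
  have "alternation (2 * Suc m) ?T (\<lambda>i. i) = (\<Sum>j<2 * Suc m. ?A j)"
    by (rule alternation_split_position[OF assms])
  also have "\<dots> = ?A 0 + (?A 1 + (\<Sum>j<2 * m. ?A (2 + j)))"
    by (rule split)
  also have "(\<Sum>j<2 * m. ?A (2 + j)) = 0"
    by (intro sum.neutral ballI) (simp only: lessThan_iff A2)
  finally show ?thesis by (simp only: A0 A1 add_0_right)
qed

text \<open>The identity behind this: contracting \<open>\<beta> \<and> \<omega>\<^sup>n = 0\<close> with \<open>x\<close> gives
  \<open>\<beta> \<and> (x \<lrcorner> \<omega>) \<and> \<omega>\<^sup>n\<^sup>-\<^sup>1 = \<beta>(x) \<omega>\<^sup>n / n\<close>.\<close>

lemma alternation_contraction:
  assumes k: "k = 2 * Suc m"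
  shows "of_nat k * alternation k
      (\<lambda>u. \<beta> (u 0) * (\<Sum>a<k. x a * b a (u 1)) * pair_prod m b (\<lambda>i. u (2 + i))) (\<lambda>i. i) =
    (\<Sum>a<k. x a * \<beta> a) * alternation k (pair_prod (Suc m) b) (\<lambda>i. i)"
proof -
  have "alternation k
      (\<lambda>u. \<beta> (u 0) * (\<Sum>a<k. x a * b a (u 1)) * pair_prod m b (\<lambda>i. u (2 + i))) (\<lambda>i. i) =
    alternation k (\<lambda>u. \<Sum>a<k. x a * (\<beta> (u 0) * b a (u 1) * pair_prod m b (\<lambda>i. u (2 + i)))) (\<lambda>i. i)"
    by (intro alternation_cong) (simp add: sum_distrib_left sum_distrib_right mult_ac)
  also have "\<dots> = (\<Sum>a<k. x a * (\<beta> a * pfaffian_at (Suc m) a 0))"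
    unfolding alternation_sum alternation_cmult unfolding k
    by (intro sum.cong refl) (simp only: lessThan_iff alternation_row_contraction)
  also have "of_nat k * \<dots> = (\<Sum>a<k. x a * \<beta> a * (of_nat k * pfaffian_at (Suc m) a 0))"
    by (simp add: sum_distrib_left mult_ac)
  also have "\<dots> = (\<Sum>a<k. x a * \<beta> a * alternation k (pair_prod (Suc m) b) (\<lambda>i. i))"
    unfolding k by (intro sum.cong refl) (simp only: lessThan_iff pfaffian_at_0)
  finally show ?thesis by (simp add: sum_distrib_right)
qed

text \<open>Put the label \<open>0\<close> into slot \<open>0\<close>; the factor
  \<open>2 * Suc n\<close> counts the slots it could have occupied. As row \<open>0\<close> has its
  only nonzero entry in column \<open>1\<close>, the surviving permutations also fix
  \<open>1\<close>, and they are the shifted permutations of the remaining \<open>2 * n\<close>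
  labels.\<close>

lemma pfaffian_recursion:
  assumes b0: "\<And>j. j < 2 * Suc n \<Longrightarrow> j \<noteq> 1 \<Longrightarrow> b 0 j = 0"
  shows "alternation (2 * Suc n) (pair_prod (Suc n) b) (\<lambda>i. i) =
    of_nat (2 * Suc n) * b 0 1 * alternation (2 * n) (pair_prod n b) (\<lambda>i. 2 + i)"
proof -
  let ?P = "{\<sigma>. \<sigma> permutes {..<2 + 2 * n}}"
  let ?f = "\<lambda>\<sigma>. of_int (sign \<sigma>) * (of_bool (\<sigma> 0 = 0) * pair_prod (Suc n) b \<sigma>) :: complex"
  have "pfaffian_at (Suc n) 0 0 = (\<Sum>\<sigma>\<in>?P. ?f \<sigma>)"
    by (simp add: pfaffian_at_def alternation_def)
  also have "\<dots> = (\<Sum>\<sigma>\<in>{\<sigma>\<in>?P. \<sigma> 0 = 0 \<and> \<sigma> 1 = 1}. ?f \<sigma>)"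
  proof (rule sum.mono_neutral_right)
    show "\<forall>\<sigma>\<in>?P - {\<sigma>\<in>?P. \<sigma> 0 = 0 \<and> \<sigma> 1 = 1}. ?f \<sigma> = 0"
    proof
      fix \<sigma> assume \<sigma>: "\<sigma> \<in> ?P - {\<sigma>\<in>?P. \<sigma> 0 = 0 \<and> \<sigma> 1 = 1}"
      then have "\<sigma> 1 < 2 * Suc n"
        using permutes_in_image[of \<sigma> "{..<2 + 2 * n}" 1] by simp
      then show "?f \<sigma> = 0"
        using b0[of "\<sigma> 1"] \<sigma> by (auto simp: pair_prod_Suc)
    qed
  qed (auto simp: finite_permutations)
  also have "{\<sigma>\<in>?P. \<sigma> 0 = 0 \<and> \<sigma> 1 = 1} = {\<sigma>. \<sigma> permutes {2..<2 + 2 * n}}"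
  proof (intro equalityI subsetI)
    fix \<sigma> :: "nat \<Rightarrow> nat" assume \<sigma>: "\<sigma> \<in> {\<sigma>\<in>?P. \<sigma> 0 = 0 \<and> \<sigma> 1 = 1}"
    have "\<sigma> x = x" if "x \<in> {..<2 + 2 * n} - {2..<2 + 2 * n}" for x
    proof -
      have "x = 0 \<or> x = 1" using that by auto
      then show ?thesis using \<sigma> by auto
    qed
    then have "\<sigma> permutes {2..<2 + 2 * n}"
      using \<sigma> permutes_superset[of \<sigma> "{..<2 + 2 * n}"] by blast
    then show "\<sigma> \<in> {\<sigma>. \<sigma> permutes {2..<2 + 2 * n}}" by simp
  next
    fix \<sigma> :: "nat \<Rightarrow> nat" assume "\<sigma> \<in> {\<sigma>. \<sigma> permutes {2..<2 + 2 * n}}"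
    then show "\<sigma> \<in> {\<sigma>\<in>?P. \<sigma> 0 = 0 \<and> \<sigma> 1 = 1}"
      by (auto simp: permutes_not_in intro: permutes_subset)
  qed
  also have "(\<Sum>\<sigma> | \<sigma> permutes {2..<2 + 2 * n}. ?f \<sigma>) = (\<Sum>\<tau> | \<tau> permutes {..<2 * n}. ?f (shift_permutation 2 (2 * n) \<tau>))"
  proof -
    have "bij_betw (shift_permutation 2 (2 * n)) {\<tau>. \<tau> permutes {..<2 * n}} {\<sigma>. \<sigma> permutes {2..<2 + 2 * n}}"
      using bij_betw_permutations[OF bij_betw_shift[of 2 "2 * n"]]
      by (rule bij_betw_cong[THEN iffD1, rotated])
         (rule ext, simp only: map_permutation_def restrict_id_def o_apply bij_betw_imp_surj_on[OF bij_betw_shift])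
    from sum.reindex_bij_betw[OF this, symmetric] show ?thesis .
  qed
  also have "\<dots> = (\<Sum>\<tau> | \<tau> permutes {..<2 * n}. b 0 1 * (of_int (sign \<tau>) * pair_prod n b (\<lambda>i. 2 + \<tau> i)))"
  proof (rule sum.cong[OF refl])
    fix \<tau> assume "\<tau> \<in> {\<tau>. \<tau> permutes {..<2 * n}}"
    then have \<tau>: "\<tau> permutes {..<2 * n}" by simp
    have s: "shift_permutation 2 (2 * n) \<tau> 0 = 0" "shift_permutation 2 (2 * n) \<tau> 1 = 1"
      by (rule shift_permutation_less[OF \<tau>], simp)+
    show "?f (shift_permutation 2 (2 * n) \<tau>) = b 0 1 * (of_int (sign \<tau>) * pair_prod n b (\<lambda>i. 2 + \<tau> i))"
      unfolding pair_prod_Suc shift_permutation_add[OF \<tau>] sign_shift_permutation[OF \<tau>] s by simp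
  qed
  also have "\<dots> = b 0 1 * alternation (2 * n) (pair_prod n b) (\<lambda>i. 2 + i)"
    unfolding alternation_def sum_distrib_left ..
  finally have "pfaffian_at (Suc n) 0 0 = b 0 1 * alternation (2 * n) (pair_prod n b) (\<lambda>i. 2 + i)" .
  moreover have "0 < 2 * Suc n" by simp
  ultimately show ?thesis
    by (simp only: pfaffian_at_0 mult.assoc)
qed

end

section \<open>Determinants and the pullback of top-degree forms\<close>

text \<open>The classical characterisation of the determinant: expand the rows one after the other
  into axis vectors. Choices with two equal rows drop out because exchanging these rows changes the
  sign, and the remaining choices are permutations of the rows of the unit matrix.\<close>

lemma alternating_multilinear_eq_det:
  fixes \<phi> :: "real^'k^'k \<Rightarrow> complex"
  assumes row: "\<And>A t x. \<phi> (\<chi> i. if i = t then x else A $ i) =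
      (\<Sum>q\<in>UNIV. of_real (x $ q) * \<phi> (\<chi> i. if i = t then axis q 1 else A $ i))"
    and perm: "\<And>A p. p permutes UNIV \<Longrightarrow> \<phi> (\<chi> i. A $ p i) = of_int (sign p) * \<phi> A"
  shows "\<phi> A = of_real (det A) * \<phi> (mat 1)"
proof -
  \<comment> \<open>The choices of a column for each row in \<open>T\<close>. Being the identity off
    \<open>T\<close> makes \<open>f(t := q)\<close> determine both \<open>f\<close> and
    \<open>q\<close> when the row \<open>t\<close> is added.\<close>
  define F :: "'k set \<Rightarrow> ('k \<Rightarrow> 'k) set" where "F T = {f. \<forall>i. i \<notin> T \<longrightarrow> f i = i}" for T
  have expand: "\<phi> A = (\<Sum>f\<in>F T. of_real (\<Prod>i\<in>T. A $ i $ f i) * \<phi> (\<chi> i. if i \<in> T then axis (f i) 1 else A $ i))" for T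
    using finite[of T]
  proof (induction T)
    case empty
    have "F {} = {\<lambda>i. i}" by (auto simp: F_def)
    then show ?case by (simp add: vec_nth_inverse)
  next
    case (insert t T)
    let ?B = "\<lambda>f. (\<chi> i. if i \<in> T then axis (f i) 1 else A $ i) :: real^'k^'k"
    let ?C = "\<lambda>f. (\<chi> i. if i \<in> insert t T then axis (f i) 1 else A $ i) :: real^'k^'k"
    have "\<phi> (?B f) = (\<Sum>q\<in>UNIV. of_real (A $ t $ q) * \<phi> (?C (f(t := q))))" for f
    proof -
      have "(\<chi> i. if i = t then A $ t else ?B f $ i) = ?B f"
        using insert.hyps by (auto simp: vec_eq_iff)
      moreover have "(\<chi> i. if i = t then axis q 1 else ?B f $ i) = ?C (f(t := q))" for q
        by (auto simp: vec_eq_iff)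
      ultimately show ?thesis using row[of t "A $ t" "?B f"] by simp
    qed
    then have "\<phi> A = (\<Sum>f\<in>F T. \<Sum>q\<in>UNIV. of_real ((\<Prod>i\<in>T. A $ i $ f i) * A $ t $ q) * \<phi> (?C (f(t := q))))"
      using insert.IH by (simp add: sum_distrib_left mult.assoc)
    also have "\<dots> = (\<Sum>(f, q)\<in>F T \<times> UNIV. of_real ((\<Prod>i\<in>T. A $ i $ f i) * A $ t $ q) * \<phi> (?C (f(t := q))))"
      by (rule sum.cartesian_product)
    also have "\<dots> = (\<Sum>f\<in>F (insert t T). of_real (\<Prod>i\<in>insert t T. A $ i $ f i) * \<phi> (?C f))"
    proof (rule sum.reindex_bij_witness[where i = "\<lambda>g. (g(t := t), g t)" and j = "\<lambda>(f, q). f(t := q)"])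
      fix fq assume "fq \<in> F T \<times> (UNIV :: 'k set)"
      then obtain f q where fq: "fq = (f, q)" "f \<in> F T" by auto
      have "(\<Prod>i\<in>T. A $ i $ (f(t := q)) i) = (\<Prod>i\<in>T. A $ i $ f i)"
        using insert.hyps by (intro prod.cong) auto
      then show "of_real (\<Prod>i\<in>insert t T. A $ i $ (case fq of (f, q) \<Rightarrow> f(t := q)) i) * \<phi> (?C (case fq of (f, q) \<Rightarrow> f(t := q))) =
          (case fq of (f, q) \<Rightarrow> of_real ((\<Prod>i\<in>T. A $ i $ f i) * A $ t $ q) * \<phi> (?C (f(t := q))))"
        unfolding fq(1) prod.case using insert.hyps by (simp add: mult.commute)
    qed (use insert.hyps in \<open>auto simp: F_def fun_eq_iff\<close>)
    finally show ?case .
  qed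
  have degenerate: "\<phi> (\<chi> i. axis (f i) 1) = 0" if f: "\<not> f permutes UNIV" for f :: "'k \<Rightarrow> 'k"
  proof -
    have "\<not> inj f"
      using f finite_UNIV_inj_surj[of f] by (auto simp: permutes_univ inj_def bij_def surj_def) metis
    then obtain s t where st: "s \<noteq> t" "f s = f t" by (auto simp: inj_def)
    let ?A = "(\<chi> i. axis (f i) 1) :: real^'k^'k"
    have "(\<chi> i. ?A $ Transposition.transpose s t i) = ?A"
      using st(2) by (auto simp: vec_eq_iff Transposition.transpose_def)
    then have "\<phi> ?A = - \<phi> ?A"
      using perm[of "Transposition.transpose s t" ?A] st(1) by (simp add: permutes_swap_id sign_swap_id)
    then show ?thesis by simp
  qed
  have "F UNIV = UNIV" by (auto simp: F_def)
  then have "\<phi> A = (\<Sum>f\<in>UNIV. of_real (\<Prod>i\<in>UNIV. A $ i $ f i) * \<phi> (\<chi> i. axis (f i) 1))"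
    using expand[of UNIV] by simp
  also have "\<dots> = (\<Sum>f | f permutes UNIV. of_real (\<Prod>i\<in>UNIV. A $ i $ f i) * \<phi> (\<chi> i. axis (f i) 1))"
    by (rule sum.mono_neutral_right) (auto simp: degenerate)
  also have "\<dots> = (\<Sum>f | f permutes UNIV. of_real (of_int (sign f) * (\<Prod>i\<in>UNIV. A $ i $ f i)) * \<phi> (mat 1))"
  proof (rule sum.cong[OF refl])
    fix f :: "'k \<Rightarrow> 'k" assume "f \<in> {f. f permutes UNIV}"
    then have "\<phi> (\<chi> i. mat 1 $ f i) = of_int (sign f) * \<phi> (mat 1)" using perm by simp
    moreover have "(\<chi> i. mat 1 $ f i) = ((\<chi> i. axis (f i) 1) :: real^'k^'k)"
      by (auto simp: vec_eq_iff mat_def axis_def)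
    ultimately show "of_real (\<Prod>i\<in>UNIV. A $ i $ f i) * \<phi> (\<chi> i. axis (f i) 1) =
        of_real (of_int (sign f) * (\<Prod>i\<in>UNIV. A $ i $ f i)) * \<phi> (mat 1)" by simp
  qed
  also have "\<dots> = of_real (det A) * \<phi> (mat 1)"
    by (simp add: det_def sum_distrib_right)
  finally show ?thesis .
qed

lemma pair_prod_cong:
  "(\<And>i. i < 2 * m \<Longrightarrow> u i = u' i) \<Longrightarrow> pair_prod m b u = pair_prod m b u'"
  unfolding pair_prod_def by (intro prod.cong) auto

lemma pair_prod_slot:
  fixes b :: "'v::real_vector \<Rightarrow> 'v \<Rightarrow> complex"
  assumes b: "bilinear b" and j: "j < 2 * m"
  shows "pair_prod m b (u(j := (\<Sum>q\<in>I. c q *\<^sub>R w q))) = (\<Sum>q\<in>I. of_real (c q) * pair_prod m b (u(j := w q)))"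
proof -
  define i where "i = j div 2"
  have i: "i \<in> {..<m}" using j by (auto simp: i_def)
  have lin: "linear (\<lambda>x. b x y)" "linear (b x)" for x y
    using b by (auto simp: bilinear_def)
  define R where "R = (\<Prod>l\<in>{..<m} - {i}. b (u (2 * l)) (u (2 * l + 1)))"
  have PP: "pair_prod m b (u(j := x)) = b ((u(j := x)) (2 * i)) ((u(j := x)) (2 * i + 1)) * R" for x
  proof -
    have "(\<Prod>l\<in>{..<m} - {i}. b ((u(j := x)) (2 * l)) ((u(j := x)) (2 * l + 1))) = R"
      unfolding R_def
    proof (rule prod.cong[OF refl])
      fix l assume "l \<in> {..<m} - {i}"
      then have "2 * l \<noteq> j" "2 * l + 1 \<noteq> j" by (auto simp: i_def)
      then show "b ((u(j := x)) (2 * l)) ((u(j := x)) (2 * l + 1)) = b (u (2 * l)) (u (2 * l + 1))" by simp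
    qed
    then show ?thesis
      unfolding pair_prod_def using i by (subst prod.remove[of _ i]) auto
  qed
  show ?thesis
  proof (cases "even j")
    case True
    then have "2 * i = j" "2 * i + 1 \<noteq> j" by (auto simp: i_def)
    then show ?thesis
      by (simp add: PP linear_sum[OF lin(1)] linear_scale[OF lin(1)] sum_distrib_right scaleR_conv_of_real mult.assoc)
  next
    case False
    then have "2 * i \<noteq> j" "2 * i + 1 = j" unfolding i_def by presburger+
    then show ?thesis
      by (simp add: PP linear_sum[OF lin(2)] linear_scale[OF lin(2)] sum_distrib_right scaleR_conv_of_real mult.assoc)
  qed
qed

lemma alternation_permute_arguments:
  assumes "\<tau> permutes {..<k}"
  shows "alternation k T (\<lambda>i. v (\<tau> i)) = of_int (sign \<tau>) * alternation k T v"
proof -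
  have "alternation k T v = (\<Sum>\<sigma> | \<sigma> permutes {..<k}. of_int (sign (\<tau> \<circ> \<sigma>)) * T (\<lambda>i. v ((\<tau> \<circ> \<sigma>) i)))"
    unfolding alternation_def by (rule setum_permutations_compose_left[OF assms])
  also have "\<dots> = (\<Sum>\<sigma> | \<sigma> permutes {..<k}. of_int (sign \<tau>) * (of_int (sign \<sigma>) * T (\<lambda>i. v (\<tau> (\<sigma> i)))))"
    using assms by (intro sum.cong) (auto simp: sign_compose permutation_if_permutes_lessThan)
  also have "\<dots> = of_int (sign \<tau>) * alternation k T (\<lambda>i. v (\<tau> i))"
    by (simp add: alternation_def sum_distrib_left)
  finally show ?thesis
    by (simp add: mult.assoc[symmetric] of_int_mult[symmetric] del: of_int_mult)
qed

lemma real_frame_bij_betw: "bij_betw real_frame {..<2 * CARD('n)} (Basis :: (complex^'n::finite) set)"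
proof -
  let ?e = "from_nat_into (UNIV :: 'n set)"
  have e: "bij_betw ?e {..<CARD('n)} UNIV"
    by (rule bij_betw_from_nat_into_finite) simp
  have inj: "inj_on (real_frame :: nat \<Rightarrow> complex^'n) {..<2 * CARD('n)}"
  proof (rule inj_onI)
    fix a b assume ab: "a \<in> {..<2 * CARD('n)}" "b \<in> {..<2 * CARD('n)}"
      and eq: "real_frame a = (real_frame b :: complex^'n)"
    have "?e (a div 2) = ?e (b div 2) \<and> even a = even b"
      using eq unfolding real_frame_def by (auto simp: axis_eq_axis split: if_splits)
    then have "a div 2 = b div 2" "even a = even b"
      using ab bij_betw_imp_inj_on[OF e] by (auto simp: inj_on_def)
    then show "a = b"
      by (metis dvd_mult_div_cancel odd_two_times_div_two_succ)
  qed
  moreover have "real_frame ` {..<2 * CARD('n)} \<subseteq> (Basis :: (complex^'n) set)"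
    by (auto simp: real_frame_def Basis_vec_def Basis_complex_def)
  moreover have "card (real_frame ` {..<2 * CARD('n)} :: (complex^'n) set) = card (Basis :: (complex^'n) set)"
    using inj by (simp add: card_image mult.commute DIM_cart)
  ultimately show ?thesis
    unfolding bij_betw_def using card_subset_eq[OF finite_Basis] by blast
qed

abbreviation bit0_enum :: "nat \<Rightarrow> 'n::finite bit0" where
  "bit0_enum \<equiv> from_nat_into UNIV"

lemma bit0_enum_bij_betw: "bij_betw bit0_enum {..<2 * CARD('n)} (UNIV :: 'n::finite bit0 set)"
  using bij_betw_from_nat_into_finite[of "UNIV :: 'n bit0 set"] by simp

text \<open>Change of variables in the library is for \<open>real^'k\<close> with a well-ordered index type, here
  \<open>'k = 'n bit0\<close>, which has twice as many elements as \<open>'n\<close>.\<close>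

definition complexify :: "real^('n bit0) \<Rightarrow> complex^'n::finite" where
  "complexify y = (\<Sum>a<2 * CARD('n). y $ bit0_enum a *\<^sub>R real_frame a)"

definition realify :: "complex^'n::finite \<Rightarrow> real^('n bit0)" where
  "realify x = (\<chi> q. x \<bullet> real_frame (inv_into {..<2 * CARD('n)} bit0_enum q))"

lemma inv_bit0_enum: "a < 2 * CARD('n) \<Longrightarrow> inv_into {..<2 * CARD('n)} (bit0_enum :: _ \<Rightarrow> 'n::finite bit0) a' = a \<longleftrightarrow> a' = bit0_enum a"
  using bit0_enum_bij_betw[where 'n = 'n]
  by (metis bij_betw_imp_inj_on bij_betw_imp_surj_on f_inv_into_f inv_into_f_f iso_tuple_UNIV_I lessThan_iff)

lemma linear_complexify: "linear complexify"
  unfolding complexify_def by (rule linearI) (simp_all add: scaleR_add_left sum.distrib scaleR_sum_right)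

lemma linear_realify: "linear realify"
  unfolding realify_def by (rule linearI) (simp_all add: vec_eq_iff inner_add_left)

lemma realify_nth: "a < 2 * CARD('n) \<Longrightarrow> realify (x :: complex^'n::finite) $ bit0_enum a = x \<bullet> real_frame a"
  by (simp add: realify_def inv_bit0_enum[THEN iffD2])

lemma complexify_realify [simp]: "complexify (realify x) = x"
proof -
  have "complexify (realify x) = (\<Sum>a<2 * CARD('a). (x \<bullet> real_frame a) *\<^sub>R real_frame a)"
    unfolding complexify_def by (intro sum.cong) (auto simp: realify_nth)
  also have "\<dots> = (\<Sum>b\<in>Basis. (x \<bullet> b) *\<^sub>R b)"
    by (rule sum.reindex_bij_betw[OF real_frame_bij_betw])
  finally show ?thesis by (simp add: euclidean_representation)
qed

lemma real_frame_inner: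
  assumes "a < 2 * CARD('n)" "b < 2 * CARD('n)"
  shows "real_frame a \<bullet> (real_frame b :: complex^'n::finite) = (if a = b then 1 else 0)"
proof -
  have "real_frame a \<in> (Basis :: (complex^'n) set)" "real_frame b \<in> (Basis :: (complex^'n) set)"
    using real_frame_bij_betw[where 'n = 'n] assms by (auto simp: bij_betw_def)
  moreover have "real_frame a = (real_frame b :: complex^'n) \<longleftrightarrow> a = b"
    using real_frame_bij_betw[where 'n = 'n] assms by (auto simp: bij_betw_def inj_on_def)
  ultimately show ?thesis by (simp add: inner_Basis)
qed

lemma realify_complexify [simp]: "realify (complexify y) = (y :: real^('n::finite bit0))"
proof -
  have "realify (complexify y) $ bit0_enum a = y $ bit0_enum a" if "a < 2 * CARD('n)" for a
    using that by (simp add: realify_nth complexify_def inner_sum_left real_frame_inner if_distrib cong: if_cong)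
  moreover have "\<exists>a<2 * CARD('n). q = bit0_enum a" for q :: "'n bit0"
    using bit0_enum_bij_betw[where 'n = 'n] by (metis UNIV_I bij_betw_imp_surj_on imageE lessThan_iff)
  ultimately show ?thesis unfolding vec_eq_iff by metis
qed

lemma complexify_axis: "a < 2 * CARD('n) \<Longrightarrow> complexify (axis (bit0_enum a) 1) = (real_frame a :: complex^'n::finite)"
proof -
  assume a: "a < 2 * CARD('n)"
  have "realify (real_frame a :: complex^'n) $ bit0_enum c = (axis (bit0_enum a) 1 :: real^('n bit0)) $ bit0_enum c" if "c < 2 * CARD('n)" for c
    using a that inj_on_eq_iff[OF bij_betw_imp_inj_on[OF bit0_enum_bij_betw[where 'n = 'n]], of c a]
    by (auto simp: realify_nth real_frame_inner axis_def)
  moreover have "\<exists>c<2 * CARD('n). q = bit0_enum c" for q :: "'n bit0"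
    using bit0_enum_bij_betw[where 'n = 'n] by (metis UNIV_I bij_betw_imp_surj_on imageE lessThan_iff)
  ultimately have "realify (real_frame a :: complex^'n) = axis (bit0_enum a) 1"
    unfolding vec_eq_iff by metis
  then show ?thesis by (metis complexify_realify)
qed

text \<open>The determinant of \<open>L\<close> as an endomorphism of the underlying real space, in
  the orthonormal basis \<open>real_frame\<close>.\<close>

definition real_det :: "(complex^'n \<Rightarrow> complex^'n) \<Rightarrow> real" where
  "real_det L = det (matrix (realify \<circ> L \<circ> complexify :: real^('n::finite bit0) \<Rightarrow> _))"

text \<open>As a function of the matrix whose rows hold the real coordinates of the arguments, the
  left-hand side is multilinear and alternating, hence a multiple of the determinant; the unit
  matrix corresponds to \<open>real_frame\<close>.\<close>

lemma alternation_linear_image: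
  fixes L :: "complex^'n::finite \<Rightarrow> complex^'n"
  assumes b: "bilinear b" and L: "linear L"
  shows "alternation (2 * CARD('n)) (pair_prod CARD('n) b) (\<lambda>a. L (real_frame a)) =
    of_real (real_det L) * alternation (2 * CARD('n)) (pair_prod CARD('n) b) real_frame"
proof -
  define N where "N = 2 * CARD('n)"
  define \<phi> where "\<phi> A = alternation N (pair_prod CARD('n) b) (\<lambda>a. complexify (A $ bit0_enum a))"
    for A :: "real^('n bit0)^('n bit0)"
  have bij: "bij_betw bit0_enum {..<N} (UNIV :: 'n bit0 set)"
    unfolding N_def by (rule bit0_enum_bij_betw)
  have \<phi>: "\<phi> A = of_real (det A) * \<phi> (mat 1)" for A
  proof (rule alternating_multilinear_eq_det)
    fix A :: "real^('n bit0)^('n bit0)" and t and x :: "real^('n bit0)"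
    \<comment> \<open>For a fixed \<open>\<sigma>\<close> the row \<open>t\<close> is read by
      exactly one slot, the preimage under \<open>\<sigma>\<close> of the number of
      \<open>t\<close>; so linearity in the row becomes linearity in that slot.\<close>
    have slot: "pair_prod CARD('n) b (\<lambda>i. complexify ((\<chi> i. if i = t then y else A $ i) $ bit0_enum (\<sigma> i))) =
      pair_prod CARD('n) b ((\<lambda>i. complexify (A $ bit0_enum (\<sigma> i)))(inv \<sigma> (inv_into {..<N} bit0_enum t) := complexify y))"
      if \<sigma>: "\<sigma> permutes {..<N}" for \<sigma> and y :: "real^('n bit0)"
    proof (rule pair_prod_cong)
      fix i assume "i < 2 * CARD('n)"
      then have "\<sigma> i < N" using permutes_in_image[OF \<sigma>, of i] by (simp add: N_def)
      then have "bit0_enum (\<sigma> i) = t \<longleftrightarrow> \<sigma> i = inv_into {..<N} bit0_enum t"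
        using inv_bit0_enum[of "\<sigma> i" t] unfolding N_def by metis
      then have "bit0_enum (\<sigma> i) = t \<longleftrightarrow> i = inv \<sigma> (inv_into {..<N} bit0_enum t)"
        using \<sigma> by (metis permutes_inverses)
      then show "complexify ((\<chi> i. if i = t then y else A $ i) $ bit0_enum (\<sigma> i)) =
        ((\<lambda>i. complexify (A $ bit0_enum (\<sigma> i)))(inv \<sigma> (inv_into {..<N} bit0_enum t) := complexify y)) i"
        by simp
    qed
    have less: "inv \<sigma> (inv_into {..<N} bit0_enum t) < 2 * CARD('n)" if \<sigma>: "\<sigma> permutes {..<N}" for \<sigma>
    proof -
      have "inv_into {..<N} bit0_enum t \<in> {..<N}"
        using bij by (intro inv_into_into) (simp add: bij_betw_def)
      then show ?thesis using permutes_in_image[OF permutes_inv[OF \<sigma>]] by (simp add: N_def)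
    qed
    have x: "(complexify x :: complex^'n) = (\<Sum>q\<in>UNIV. x $ q *\<^sub>R complexify (axis q 1))"
    proof -
      have "x = (\<Sum>q\<in>UNIV. x $ q *\<^sub>R axis q 1)"
        by (simp add: vec_eq_iff axis_def if_distrib cong: if_cong)
      then show ?thesis
        using linear_sum[OF linear_complexify] linear_scale[OF linear_complexify] by (metis (no_types, lifting) sum.cong)
    qed
    have "\<phi> (\<chi> i. if i = t then x else A $ i) =
      alternation N (\<lambda>u. pair_prod CARD('n) b u) (\<lambda>a. complexify ((\<chi> i. if i = t then x else A $ i) $ bit0_enum a))"
      by (simp add: \<phi>_def)
    also have "\<dots> = (\<Sum>\<sigma> | \<sigma> permutes {..<N}. of_int (sign \<sigma>) * (\<Sum>q\<in>UNIV. of_real (x $ q) *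
        pair_prod CARD('n) b (\<lambda>i. complexify ((\<chi> i. if i = t then axis q 1 else A $ i) $ bit0_enum (\<sigma> i)))))"
      unfolding alternation_def
      by (rule sum.cong[OF refl]) (simp only: slot mem_Collect_eq x pair_prod_slot[OF b less])
    also have "\<dots> = (\<Sum>q\<in>UNIV. of_real (x $ q) * \<phi> (\<chi> i. if i = t then axis q 1 else A $ i))"
      unfolding \<phi>_def alternation_def sum_distrib_left by (subst sum.swap) (simp add: mult_ac)
    finally show "\<phi> (\<chi> i. if i = t then x else A $ i) =
      (\<Sum>q\<in>UNIV. of_real (x $ q) * \<phi> (\<chi> i. if i = t then axis q 1 else A $ i))" .
  next
    fix A :: "real^('n bit0)^('n bit0)" and \<pi> :: "'n bit0 \<Rightarrow> 'n bit0"
    assume \<pi>: "\<pi> permutes UNIV"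
    define g where "g = inv_into {..<N} (bit0_enum :: nat \<Rightarrow> 'n bit0)"
    have g: "bij_betw g UNIV {..<N}"
      unfolding g_def by (rule bij_betw_inv_into[OF bij])
    define \<tau> where "\<tau> = map_permutation UNIV g \<pi>"
    have \<tau>: "\<tau> permutes {..<N}"
      unfolding \<tau>_def by (rule map_permutation_permutes[OF g \<pi>])
    have "sign \<tau> = sign \<pi>"
      unfolding \<tau>_def by (rule sign_map_permutation[OF _ \<pi>]) (use g in \<open>auto simp: bij_betw_def\<close>)
    have \<tau>_eq: "bit0_enum (\<tau> a) = \<pi> (bit0_enum a)" if "a < N" for a
    proof -
      have "g (bit0_enum a) = a"
        using that bij by (simp add: g_def bij_betw_def)
      then have "\<tau> a = g (\<pi> (bit0_enum a))"
        using map_permutation_apply[of g UNIV "bit0_enum a" \<pi>] g by (simp add: \<tau>_def bij_betw_def)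
      then show ?thesis
        using bij unfolding g_def by (simp add: bij_betw_def f_inv_into_f)
    qed
    have "\<phi> (\<chi> i. A $ \<pi> i) = alternation N (pair_prod CARD('n) b) (\<lambda>a. complexify (A $ bit0_enum (\<tau> a)))"
      unfolding \<phi>_def
    proof (rule alternation_cong, rule pair_prod_cong)
      fix \<sigma> i assume "\<sigma> permutes {..<N}" "i < 2 * CARD('n)"
      then have "\<sigma> i < N" using permutes_in_image[of \<sigma> "{..<N}" i] by (simp add: N_def)
      then show "complexify ((\<chi> i. A $ \<pi> i) $ bit0_enum (\<sigma> i)) = complexify (A $ bit0_enum (\<tau> (\<sigma> i)))"
        by (simp add: \<tau>_eq)
    qed
    also have "\<dots> = of_int (sign \<pi>) * \<phi> A"
      using alternation_permute_arguments[OF \<tau>, of "pair_prod CARD('n) b" "\<lambda>a. complexify (A $ bit0_enum a)"] \<open>sign \<tau> = sign \<pi>\<close>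
      by (simp add: \<phi>_def)
    finally show "\<phi> (\<chi> i. A $ \<pi> i) = of_int (sign \<pi>) * \<phi> A" .
  qed
  let ?M = "matrix (realify \<circ> L \<circ> complexify :: real^('n bit0) \<Rightarrow> _)"
  have ext: "alternation N (pair_prod CARD('n) b) v = alternation N (pair_prod CARD('n) b) v'"
    if "\<And>a. a < N \<Longrightarrow> v a = v' a" for v v'
  proof (rule alternation_cong, rule pair_prod_cong)
    fix \<sigma> i assume "\<sigma> permutes {..<N}" "i < 2 * CARD('n)"
    then have "\<sigma> i < N" using permutes_in_image[of \<sigma> "{..<N}" i] by (simp add: N_def)
    then show "v (\<sigma> i) = v' (\<sigma> i)" by (rule that)
  qed
  \<comment> \<open>The images of the frame vectors are the columns of \<open>?M\<close>, while
    \<open>\<phi>\<close> reads rows; hence the transpose, which has the same determinant.\<close>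
  have "\<phi> (Finite_Cartesian_Product.transpose ?M) = alternation N (pair_prod CARD('n) b) (\<lambda>a. L (real_frame a))"
    unfolding \<phi>_def
  proof (rule ext)
    fix a assume a: "a < N"
    have "Finite_Cartesian_Product.transpose ?M $ bit0_enum a = realify (L (complexify (axis (bit0_enum a) 1)))"
      by (simp add: vec_eq_iff Finite_Cartesian_Product.transpose_def matrix_def)
    then show "complexify (Finite_Cartesian_Product.transpose ?M $ bit0_enum a) = L (real_frame a)"
      using a by (simp add: complexify_axis N_def)
  qed
  moreover have "\<phi> (mat 1) = alternation N (pair_prod CARD('n) b) real_frame"
    unfolding \<phi>_def
  proof (rule ext)
    fix a assume a: "a < N"
    have "mat 1 $ bit0_enum a = (axis (bit0_enum a) 1 :: real^('n bit0))"
      by (simp add: vec_eq_iff mat_def axis_def)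
    then show "complexify (mat 1 $ bit0_enum a) = (real_frame a :: complex^'n)"
      using a by (simp add: complexify_axis N_def)
  qed
  ultimately show ?thesis
    using \<phi>[of "Finite_Cartesian_Product.transpose ?M"] by (simp add: N_def real_det_def)
qed

section \<open>The volume form of a Hermitian matrix\<close>

text \<open>The fundamental form as a bilinear function of two vectors; for Hermitian
  \<open>G\<close> it is \<open>- 2\<close> times the imaginary part of
  \<open>sesq G\<close>.\<close>

definition kaehler :: "complex^'n^'n \<Rightarrow> complex^'n::finite \<Rightarrow> complex^'n \<Rightarrow> complex" where
  "kaehler G u w = \<i> * (sesq G u w - sesq G w u)"

definition hermitian_pos :: "complex^'n^'n::finite \<Rightarrow> bool" where
  "hermitian_pos G \<longleftrightarrow> (\<forall>i j. G $ j $ i = cnj (G $ i $ j)) \<and> (\<forall>v. v \<noteq> 0 \<longrightarrow> 0 < Re (sesq G v v))"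

lemma sesq_add_left: "sesq G (u + u') w = sesq G u w + sesq G u' w"
  by (simp add: sesq_def sum.distrib algebra_simps)

lemma sesq_add_right: "sesq G u (w + w') = sesq G u w + sesq G u w'"
  by (simp add: sesq_def sum.distrib algebra_simps)

lemma sesq_scaleR_left: "sesq G (r *\<^sub>R u) w = r *\<^sub>R sesq G u w"
  by (simp add: sesq_def scaleR_sum_right)

lemma sesq_scaleR_right: "sesq G u (r *\<^sub>R w) = r *\<^sub>R sesq G u w"
  by (simp add: sesq_def scaleR_sum_right)

lemma sesq_smult_left: "sesq G (c *s u) w = c * sesq G u w"
  by (simp add: sesq_def sum_distrib_left mult_ac)

lemma sesq_smult_right: "sesq G u (c *s w) = cnj c * sesq G u w"
  by (simp add: sesq_def sum_distrib_left mult_ac)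

lemma sesq_scaleR_matrix: "sesq (r *\<^sub>R G) u w = r *\<^sub>R sesq G u w"
  by (simp add: sesq_def scaleR_sum_right)

lemma sesq_add_matrix: "sesq (G + G') u w = sesq G u w + sesq G' u w"
  by (simp add: sesq_def sum.distrib algebra_simps)

lemma sesq_cnj:
  assumes "hermitian_pos G"
  shows "cnj (sesq G u w) = sesq G w u"
proof -
  have "cnj (G $ i $ j) = G $ j $ i" for i j
    using assms unfolding hermitian_pos_def by metis
  then have "cnj (sesq G u w) = (\<Sum>i\<in>UNIV. \<Sum>j\<in>UNIV. G $ j $ i * cnj (u $ i) * w $ j)"
    by (simp add: sesq_def)
  also have "\<dots> = sesq G w u"
    unfolding sesq_def by (subst sum.swap) (simp add: mult_ac)
  finally show ?thesis .
qed

lemma sesq_self_real: "hermitian_pos G \<Longrightarrow> sesq G u u = of_real (Re (sesq G u u))"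
  using sesq_cnj[of G u u] by (auto simp: complex_eq_iff)

lemma bilinear_kaehler: "bilinear (kaehler G)"
  unfolding bilinear_def
  by (auto intro!: linearI simp: kaehler_def sesq_add_left sesq_add_right sesq_scaleR_left sesq_scaleR_right
      algebra_simps)

lemma kaehler_antisym: "kaehler G u w = - kaehler G w u"
  by (simp add: kaehler_def algebra_simps)

lemma kaehler_real: "hermitian_pos G \<Longrightarrow> kaehler G u w = of_real (- 2 * Im (sesq G u w))"
  using sesq_cnj[of G u w] by (auto simp: kaehler_def complex_eq_iff)

text \<open>Recovers the Hermitian product from the two-form and the complex structure. It serves to
  write an antiholomorphic covector as a combination of contractions of the two-form.\<close>

lemma sesq_eq_kaehler: "sesq G u w = (kaehler G u w - \<i> * kaehler G (\<i> *s u) w) / (2 * \<i>)"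
  by (simp add: kaehler_def sesq_smult_left sesq_smult_right field_simps)

lemma wedge_1_1: "wedge 1 1 \<alpha> \<beta> v = \<alpha> v * \<beta> (\<lambda>i. v (1 + i)) - \<alpha> (\<lambda>i. v (Transposition.transpose 0 1 i)) * \<beta> (\<lambda>i. v (Transposition.transpose 0 1 (1 + i)))"
proof -
  have "{..<2::nat} = {0, 1}" by auto
  then have "{\<sigma>. \<sigma> permutes {..<2::nat}} = {id, Transposition.transpose 0 1}"
    using permutes_doubleton_iff[of _ "0::nat" 1] by auto
  moreover have "id \<noteq> Transposition.transpose (0::nat) 1"
    by (metis id_apply transpose_apply_first zero_neq_one)
  ultimately show ?thesis
    by (simp add: wedge_def sign_swap_id numeral_2_eq_2)
qed

lemma fundamental_form_eq_kaehler: "fundamental_form G v = kaehler G (v 0) (v 1)"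
proof -
  have "fundamental_form G v = \<i> * (\<Sum>i\<in>UNIV. \<Sum>j\<in>UNIV. G $ i $ j * (v 0 $ i * cnj (v 1 $ j) - v 1 $ i * cnj (v 0 $ j)))"
    unfolding fundamental_form_def wedge_1_1 by (simp add: dz_def dzbar_def)
  then show ?thesis
    by (simp add: kaehler_def sesq_def sum_subtractf algebra_simps)
qed

text \<open>This is \<open>2 ^ n\<close> times the value of \<open>\<omega>\<^sup>n\<close> on the
  oriented frame, kept complex and unnormalised for the algebra below.\<close>

definition top_form :: "complex^'n^'n::finite \<Rightarrow> complex" where
  "top_form G = alternation (2 * CARD('n)) (pair_prod CARD('n) (kaehler G)) real_frame"

lemma volume_density_eq_top_form:
  "volume_density (G :: complex^'n^'n::finite) = Re (top_form G) / (2 ^ CARD('n) * fact CARD('n))"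
proof -
  have "wedge_power (fundamental_form G) CARD('n) real_frame = top_form G / 2 ^ CARD('n)"
    unfolding top_form_def by (rule wedge_power_eq_alternation) (rule fundamental_form_eq_kaehler)
  then have "volume_density G = Re (top_form G / of_real (2 ^ CARD('n) * fact CARD('n)))"
    by (simp add: volume_density_def)
  then show ?thesis by (simp only: Re_divide_of_real)
qed

lemma antisymmetric_matrix_kaehler: "antisymmetric_matrix (\<lambda>a c. kaehler G (v a) (v c))"
  by unfold_locales (rule kaehler_antisym)

lemma top_form_linear_image:
  fixes L :: "complex^'n::finite \<Rightarrow> complex^'n"
  assumes "linear L" "\<And>u w. sesq G u w = sesq G' (L u) (L w)"
  shows "top_form G = of_real (real_det L) * top_form G'"
proof -
  have "top_form G = alternation (2 * CARD('n)) (pair_prod CARD('n) (kaehler G')) (\<lambda>a. L (real_frame a))"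
    unfolding top_form_def
    by (rule alternation_cong) (simp add: pair_prod_def kaehler_def assms(2))
  then show ?thesis
    using alternation_linear_image[OF bilinear_kaehler assms(1)] by (simp add: top_form_def)
qed

lemma top_form_real: "hermitian_pos G \<Longrightarrow> top_form G \<in> \<real>"
  unfolding top_form_def alternation_def pair_prod_def
  by (intro sum_in_Reals Reals_mult Reals_of_int prod_in_Reals) (simp only: kaehler_real Reals_of_real)

section \<open>Positivity of the volume density\<close>

text \<open>Row \<open>0\<close> has the single nonzero entry \<open>c 0\<close>, so the expansion
  along it splits off a positive factor, and the matrix with the first two labels deleted satisfies
  the same hypotheses.\<close>

lemma symplectic_pfaffian_pos:
  assumes "antisymmetric_matrix b"
    and "\<And>i. i < n \<Longrightarrow> b (2 * i) (2 * i + 1) = of_real (c i) \<and> c i > 0"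
    and "\<And>i j. i < n \<Longrightarrow> j < 2 * n \<Longrightarrow> j \<noteq> 2 * i + 1 \<Longrightarrow> b (2 * i) j = 0"
  shows "\<exists>r>0. alternation (2 * n) (pair_prod n b) (\<lambda>i. i) = of_real r"
  using assms
proof (induction n arbitrary: b c)
  case 0
  then show ?case by (auto simp: alternation_def pair_prod_def intro!: exI[of _ 1])
next
  case (Suc n)
  interpret antisymmetric_matrix b by fact
  let ?b = "\<lambda>i j. b (2 + i) (2 + j)"
  have "\<exists>r>0. alternation (2 * n) (pair_prod n ?b) (\<lambda>i. i) = of_real r"
  proof (rule Suc.IH[where c = "\<lambda>i. c (Suc i)"])
    show "antisymmetric_matrix ?b" by unfold_locales (rule antisym)
    show "?b (2 * i) (2 * i + 1) = of_real (c (Suc i)) \<and> c (Suc i) > 0" if "i < n" for i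
      using Suc.prems(2)[of "Suc i"] that by simp
    show "?b (2 * i) j = 0" if "i < n" "j < 2 * n" "j \<noteq> 2 * i + 1" for i j
      using Suc.prems(3)[of "Suc i" "2 + j"] that by simp
  qed
  then obtain r where "r > 0" and r: "alternation (2 * n) (pair_prod n ?b) (\<lambda>i. i) = of_real r" by blast
  have "alternation (2 * n) (pair_prod n ?b) (\<lambda>i. i) = alternation (2 * n) (pair_prod n b) (\<lambda>i. 2 + i)"
    by (rule alternation_cong) (simp add: pair_prod_def)
  moreover have "alternation (2 * Suc n) (pair_prod (Suc n) b) (\<lambda>i. i) =
    of_nat (2 * Suc n) * b 0 1 * alternation (2 * n) (pair_prod n b) (\<lambda>i. 2 + i)"
    by (rule pfaffian_recursion) (use Suc.prems(3)[of 0] in auto)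
  moreover have "b 0 1 = of_real (c 0)" "c 0 > 0"
    using Suc.prems(2)[of 0] by auto
  ultimately have "alternation (2 * Suc n) (pair_prod (Suc n) b) (\<lambda>i. i) = of_real (real (2 * Suc n) * c 0 * r)"
    using r by (simp only: of_real_mult of_real_of_nat_eq)
  moreover have "real (2 * Suc n) * c 0 * r > 0"
    using \<open>c 0 > 0\<close> \<open>r > 0\<close> by (intro mult_pos_pos) auto
  ultimately show ?case by blast
qed

text \<open>For orthogonal vectors \<open>v a\<close>, the sequence of the \<open>v a\<close> and
  \<open>\<i> *s v a\<close> is a symplectic frame: \<open>kaehler\<close> pairs \<open>v a\<close>
  with \<open>\<i> *s v a\<close> to twice its squared length, and with every other member of the
  sequence to zero.\<close>

lemma alternation_symplectic_frame:
  fixes G :: "complex^'n^'n::finite" and v :: "nat \<Rightarrow> complex^'n"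
  assumes G: "hermitian_pos G"
    and v: "\<And>a. a < m \<Longrightarrow> v a \<noteq> 0" "\<And>a c. a < m \<Longrightarrow> c < m \<Longrightarrow> a \<noteq> c \<Longrightarrow> sesq G (v a) (v c) = 0"
    and w: "\<And>a. a < m \<Longrightarrow> w (2 * a) = v a" "\<And>a. a < m \<Longrightarrow> w (2 * a + 1) = \<i> *s v a"
  shows "\<exists>r>0. alternation (2 * m) (pair_prod m (kaehler G)) w = of_real r"
proof -
  have "\<exists>r>0. alternation (2 * m) (pair_prod m (\<lambda>a c. kaehler G (w a) (w c))) (\<lambda>i. i) = of_real r"
  proof (rule symplectic_pfaffian_pos[OF antisymmetric_matrix_kaehler, where c = "\<lambda>a. 2 * Re (sesq G (v a) (v a))"])
    fix a assume a: "a < m"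
    have "kaehler G (v a) (\<i> *s v a) = 2 * sesq G (v a) (v a)"
      by (simp add: kaehler_def sesq_smult_left sesq_smult_right algebra_simps)
    also have "\<dots> = of_real (2 * Re (sesq G (v a) (v a)))"
      by (subst sesq_self_real[OF G]) simp
    finally show "kaehler G (w (2 * a)) (w (2 * a + 1)) = of_real (2 * Re (sesq G (v a) (v a))) \<and> 2 * Re (sesq G (v a) (v a)) > 0"
      using a w v(1) G by (auto simp: hermitian_pos_def)
  next
    fix a j assume a: "a < m" and j: "j < 2 * m" "j \<noteq> 2 * a + 1"
    show "kaehler G (w (2 * a)) (w j) = 0"
    proof (cases "even j")
      case True
      then obtain c where "j = 2 * c" by blast
      then show ?thesis using a j w v(2)[of a c] v(2)[of c a] by (cases "a = c") (auto simp: kaehler_def)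
    next
      case False
      then obtain c where "j = 2 * c + 1" by (auto elim: oddE)
      then show ?thesis using a j w v(2)[of a c] v(2)[of c a]
        by (auto simp: kaehler_def sesq_smult_left sesq_smult_right)
    qed
  qed
  then show ?thesis
    by (subst alternation_labels) (simp add: pair_prod_def[abs_def])
qed

text \<open>A count of real dimensions: the real and imaginary parts of the condition for
  \<open>v a\<close> are orthogonality to \<open>y a\<close> and to \<open>- \<i> *s y a\<close>,
  and these at most \<open>2 * m\<close> vectors cannot span a space of real dimension
  \<open>2 * CARD('n)\<close>.\<close>

lemma sesq_orthogonal_exists:
  fixes G :: "complex^'n^'n::finite" and v :: "nat \<Rightarrow> complex^'n"
  assumes "m < CARD('n)"
  shows "\<exists>x. x \<noteq> 0 \<and> (\<forall>a<m. sesq G (v a) x = 0)"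
proof -
  define y where "y a = (\<chi> j. \<Sum>i\<in>UNIV. G $ i $ j * v a $ i)" for a
  have s: "sesq G (v a) x = (\<Sum>j\<in>UNIV. y a $ j * cnj (x $ j))" for a x
    unfolding sesq_def y_def by (subst sum.swap) (simp add: sum_distrib_right)
  let ?S = "(y ` {..<m}) \<union> ((\<lambda>a. - \<i> *s y a) ` {..<m})"
  have "dim (span ?S) \<le> card ?S"
    by (simp add: dim_le_card')
  also have "card ?S \<le> card (y ` {..<m}) + card ((\<lambda>a. - \<i> *s y a) ` {..<m})"
    by (rule card_Un_le)
  also have "\<dots> \<le> m + m"
    by (intro add_mono card_image_le[THEN order_trans]) auto
  also have "\<dots> < DIM(complex^'n)"
    using assms by (simp add: DIM_cart)
  finally obtain x where x: "x \<noteq> 0" "\<And>z. z \<in> span (span ?S) \<Longrightarrow> orthogonal x z"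
    using orthogonal_to_subspace_exists by metis
  have "sesq G (v a) x = 0" if "a < m" for a
  proof (rule complex_eqI)
    have "orthogonal x (y a)" "orthogonal x (- \<i> *s y a)"
      using that by (auto intro!: x(2) span_base)
    moreover have "Re (sesq G (v a) x) = x \<bullet> y a"
      unfolding s by (simp add: inner_vec_def inner_complex_def mult_ac)
    moreover have "Im (sesq G (v a) x) = x \<bullet> (- \<i> *s y a)"
      unfolding s by (simp add: inner_vec_def inner_complex_def algebra_simps)
    ultimately show "Re (sesq G (v a) x) = Re 0" "Im (sesq G (v a) x) = Im 0"
      by (simp_all add: orthogonal_def)
  qed
  then show ?thesis using x(1) by blast
qed

lemma sesq_orthogonal_basis:
  fixes G :: "complex^'n^'n::finite"
  assumes G: "hermitian_pos G" and "m \<le> CARD('n)"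
  shows "\<exists>v :: nat \<Rightarrow> complex^'n. (\<forall>a<m. v a \<noteq> 0) \<and> (\<forall>a<m. \<forall>c<m. a \<noteq> c \<longrightarrow> sesq G (v a) (v c) = 0)"
  using assms(2)
proof (induction m)
  case (Suc m)
  then obtain v :: "nat \<Rightarrow> complex^'n" where v: "\<And>a. a < m \<Longrightarrow> v a \<noteq> 0"
    "\<And>a c. a < m \<Longrightarrow> c < m \<Longrightarrow> a \<noteq> c \<Longrightarrow> sesq G (v a) (v c) = 0" by auto
  obtain x where x: "x \<noteq> 0" "\<And>a. a < m \<Longrightarrow> sesq G (v a) x = 0"
    using sesq_orthogonal_exists[of m G v] Suc.prems by auto
  have "sesq G x (v a) = 0" if "a < m" for a
    using sesq_cnj[OF G, of "v a" x] x(2)[OF that] by simp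
  then show ?case
    using v x by (intro exI[of _ "v(m := x)"]) (auto simp: less_Suc_eq)
qed simp

text \<open>Let \<open>L\<close> carry \<open>real_frame\<close> to a symplectic frame built from an
  orthogonal basis. On that frame the alternation is positive, and it equals
  \<open>real_det L\<close> times \<open>top_form G\<close>, so neither factor vanishes. The sign of
  \<open>real_det L\<close> is unknown here, whence the deformation argument for positivity.\<close>

lemma top_form_neq_0:
  fixes G :: "complex^'n^'n::finite"
  assumes G: "hermitian_pos G"
  shows "top_form G \<noteq> 0"
proof -
  obtain v :: "nat \<Rightarrow> complex^'n" where v: "\<And>a. a < CARD('n) \<Longrightarrow> v a \<noteq> 0"
    "\<And>a c. a < CARD('n) \<Longrightarrow> c < CARD('n) \<Longrightarrow> a \<noteq> c \<Longrightarrow> sesq G (v a) (v c) = 0"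
    using sesq_orthogonal_basis[OF G order.refl] by auto
  define w where "w a = (if even a then v (a div 2) else \<i> *s v (a div 2))" for a
  define L where "L x = (\<Sum>a<2 * CARD('n). (x \<bullet> real_frame a) *\<^sub>R w a)" for x :: "complex^'n"
  have "linear L"
    unfolding L_def by (rule linearI) (simp_all add: inner_add_left scaleR_add_left sum.distrib scaleR_sum_right)
  have "L (real_frame a) = w a" if "a < 2 * CARD('n)" for a
    using that by (simp add: L_def real_frame_inner if_distrib[of "\<lambda>r. r *\<^sub>R _"] cong: if_cong)
  then have "alternation (2 * CARD('n)) (pair_prod CARD('n) (kaehler G)) (\<lambda>a. L (real_frame a)) =
    alternation (2 * CARD('n)) (pair_prod CARD('n) (kaehler G)) w"
    by (intro alternation_cong pair_prod_cong) (metis lessThan_iff permutes_in_image)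
  then have "alternation (2 * CARD('n)) (pair_prod CARD('n) (kaehler G)) w = of_real (real_det L) * top_form G"
    using alternation_linear_image[OF bilinear_kaehler \<open>linear L\<close>] by (simp add: top_form_def)
  moreover have "\<exists>r>0. alternation (2 * CARD('n)) (pair_prod CARD('n) (kaehler G)) w = of_real r"
    by (rule alternation_symplectic_frame[OF G v]) (auto simp: w_def)
  ultimately show ?thesis by auto
qed

lemma sesq_mat_1: "sesq (mat 1) u w = (\<Sum>i\<in>UNIV. u $ i * cnj (w $ i))"
  by (simp add: sesq_def mat_def if_distrib[of "\<lambda>y. y * _"] cong: if_cong)

lemma hermitian_pos_mat_1: "hermitian_pos (mat 1 :: complex^'n^'n::finite)"
  unfolding hermitian_pos_def
proof (intro conjI allI impI)
  fix v :: "complex^'n" assume "v \<noteq> 0"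
  then have "0 < v \<bullet> v" by simp
  also have "v \<bullet> v = Re (sesq (mat 1) v v)"
    by (simp add: sesq_mat_1 inner_vec_def inner_complex_def)
  finally show "0 < Re (sesq (mat 1) v v)" .
qed (simp add: mat_def)

lemma Re_top_form_mat_1: "0 < Re (top_form (mat 1 :: complex^'n^'n::finite))"
proof -
  let ?e = "from_nat_into (UNIV :: 'n set)"
  have e: "inj_on ?e {..<CARD('n)}"
    using bij_betw_from_nat_into_finite[of "UNIV :: 'n set"] by (simp add: bij_betw_def)
  have "\<exists>r>0. alternation (2 * CARD('n)) (pair_prod CARD('n) (kaehler (mat 1 :: complex^'n^'n))) real_frame = of_real r"
  proof (rule alternation_symplectic_frame[OF hermitian_pos_mat_1, where v = "\<lambda>a. axis (?e a) 1"])
    show "sesq (mat 1) (axis (?e a) 1) (axis (?e c) 1) = 0" if "a < CARD('n)" "c < CARD('n)" "a \<noteq> c" for a c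
    proof -
      have "?e a \<noteq> ?e c" using inj_onD[OF e] that by auto
      then show ?thesis by (auto simp: sesq_mat_1 axis_def intro!: sum.neutral)
    qed
  next
    show "axis (?e a) 1 \<noteq> (0 :: complex^'n)" for a
      by (simp add: axis_eq_0_iff)
    show "real_frame (2 * a) = (axis (?e a) 1 :: complex^'n)" for a
      by (simp add: real_frame_def)
    show "real_frame (2 * a + 1) = (\<i> *s axis (?e a) 1 :: complex^'n)" for a
      by (simp add: real_frame_def vec_eq_iff axis_def)
  qed
  then show ?thesis by (auto simp: top_form_def)
qed

lemma hermitian_pos_convex:
  assumes "hermitian_pos G" "hermitian_pos G'" "0 \<le> s" "s \<le> 1"
  shows "hermitian_pos ((1 - s) *\<^sub>R G + s *\<^sub>R G')"
  unfolding hermitian_pos_def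
proof (intro conjI allI impI)
  show "((1 - s) *\<^sub>R G + s *\<^sub>R G') $ j $ i = cnj (((1 - s) *\<^sub>R G + s *\<^sub>R G') $ i $ j)" for i j
  proof -
    have "G $ j $ i = cnj (G $ i $ j)" "G' $ j $ i = cnj (G' $ i $ j)"
      using assms unfolding hermitian_pos_def by blast+
    then show ?thesis by (simp add: complex_cnj_scaleR)
  qed
  fix v :: "complex^'a" assume "v \<noteq> 0"
  then have "0 < Re (sesq G v v)" "0 < Re (sesq G' v v)"
    using assms unfolding hermitian_pos_def by auto
  moreover have "Re (sesq ((1 - s) *\<^sub>R G + s *\<^sub>R G') v v) = (1 - s) * Re (sesq G v v) + s * Re (sesq G' v v)"
    by (simp add: sesq_add_matrix sesq_scaleR_matrix)
  ultimately show "0 < Re (sesq ((1 - s) *\<^sub>R G + s *\<^sub>R G') v v)"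
    using assms(3,4) by (cases "s = 0") (auto intro!: add_nonneg_pos)
qed

text \<open>The segment to the standard metric stays in the region where \<open>top_form\<close> does not vanish.\<close>

lemma volume_density_pos:
  fixes G :: "complex^'n^'n::finite"
  assumes G: "hermitian_pos G"
  shows "0 < volume_density G"
proof -
  define h where "h s = Re (top_form ((1 - s) *\<^sub>R G + s *\<^sub>R mat 1))" for s
  have nz: "h s \<noteq> 0" if "0 \<le> s" "s \<le> 1" for s
  proof -
    have "hermitian_pos ((1 - s) *\<^sub>R G + s *\<^sub>R mat 1)"
      using hermitian_pos_convex[OF G hermitian_pos_mat_1 that] .
    from top_form_neq_0[OF this] top_form_real[OF this] show ?thesis
      by (auto simp: h_def complex_eq_iff complex_is_Real_iff)
  qed
  have "continuous_on {0..1} h"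
    unfolding h_def top_form_def alternation_def pair_prod_def kaehler_def sesq_add_matrix sesq_scaleR_matrix
    by (intro continuous_intros)
  moreover have "h 1 > 0" using Re_top_form_mat_1[where 'n = 'n] by (simp add: h_def)
  ultimately have "h 0 > 0"
    using IVT'[of h 0 0 1] nz by (metis less_eq_real_def linorder_not_less zero_le_one)
  then show ?thesis by (simp add: h_def volume_density_eq_top_form)
qed

lemma volume_density_scaleR:
  "volume_density (r *\<^sub>R G :: complex^'n^'n::finite) = r ^ CARD('n) * volume_density G"
proof -
  have pp: "pair_prod CARD('n) (kaehler (r *\<^sub>R G)) u = of_real (r ^ CARD('n)) * pair_prod CARD('n) (kaehler G) u" for u
  proof -
    have "kaehler (r *\<^sub>R G) x y = r *\<^sub>R kaehler G x y" for x y
      by (simp add: kaehler_def sesq_scaleR_matrix scaleR_diff_right right_diff_distrib)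
    then have "kaehler (r *\<^sub>R G) x y = of_real r * kaehler G x y" for x y
      by (simp add: scaleR_conv_of_real[where 'a = complex])
    then show ?thesis by (simp add: pair_prod_def prod.distrib)
  qed
  have "top_form (r *\<^sub>R G) = of_real (r ^ CARD('n)) * top_form G"
    unfolding top_form_def alternation_cmult[symmetric] by (rule alternation_cong, rule pp)
  then show ?thesis
    by (simp add: volume_density_eq_top_form del: of_real_power)
qed

text \<open>Both densities are positive, which forces the determinant to be positive; the absolute
  value is the form that the change of variables requires.\<close>

lemma volume_density_linear_image:
  assumes G: "hermitian_pos G" "hermitian_pos G'" and L: "linear L"
    and "\<And>u w. sesq G u w = sesq G' (L u) (L w)"
  shows "volume_density G = \<bar>real_det L\<bar> * volume_density G'"
proof -
  have "volume_density G = real_det L * volume_density G'"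
    using top_form_linear_image[OF L assms(4)] by (simp add: volume_density_eq_top_form)
  moreover from this have "real_det L > 0"
    using volume_density_pos[OF G(1)] volume_density_pos[OF G(2)] by (simp add: zero_less_mult_iff)
  ultimately show ?thesis by simp
qed

section \<open>The inverse metric as a cofactor\<close>

lemma hermitian_pos_invertible:
  fixes G :: "complex^'n^'n::finite"
  assumes G: "hermitian_pos G"
  shows "invertible G"
proof -
  have "x = 0" if "G *v x = 0" for x
  proof (rule ccontr)
    assume "x \<noteq> 0"
    \<comment> \<open>\<open>sesq\<close> conjugates its second argument, so a kernel vector
      \<open>x\<close> enters through its conjugate.\<close>
    define v :: "complex^'n" where "v = (\<chi> i. cnj (x $ i))"
    have "v \<noteq> 0" using \<open>x \<noteq> 0\<close> by (simp add: v_def vec_eq_iff)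
    have "sesq G v v = (\<Sum>i\<in>UNIV. v $ i * (G *v x) $ i)"
      by (simp add: sesq_def v_def matrix_vector_mult_def sum_distrib_left mult_ac)
    then have "sesq G v v = 0" using that by simp
    then show False using G \<open>v \<noteq> 0\<close> unfolding hermitian_pos_def by fastforce
  qed
  then have "\<exists>B. B ** G = mat 1" by (simp add: matrix_left_invertible_ker)
  then show ?thesis by (simp add: invertible_left_inverse)
qed

lemma
  fixes G :: "complex^'n^'n::finite"
  assumes G: "hermitian_pos G"
  shows inv_metric_left: "(\<Sum>i\<in>UNIV. inv_metric G i j * G $ i $ l) = (if j = l then 1 else 0)"
    and inv_metric_right: "(\<Sum>l\<in>UNIV. inv_metric G k l * G $ q $ l) = (if k = q then 1 else 0)"
proof -
  have inv: "G ** matrix_inv G = mat 1 \<and> matrix_inv G ** G = mat 1"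
    using someI_ex[of "\<lambda>B. G ** B = mat 1 \<and> B ** G = mat 1"] hermitian_pos_invertible[OF G]
    unfolding invertible_def matrix_inv_def by blast
  then have "(matrix_inv G ** G) $ j $ l = mat 1 $ j $ l" "(G ** matrix_inv G) $ q $ k = mat 1 $ q $ k"
    by simp_all
  then show "(\<Sum>i\<in>UNIV. inv_metric G i j * G $ i $ l) = (if j = l then 1 else 0)"
    "(\<Sum>l\<in>UNIV. inv_metric G k l * G $ q $ l) = (if k = q then 1 else 0)"
    by (auto simp: matrix_matrix_mult_def mat_def inv_metric_def mult.commute)
qed

text \<open>Up to a constant, the value of
  \<open>dz i \<and> dzbar j \<and> \<omega>\<^sup>n\<^sup>-\<^sup>1\<close> on the oriented frame.
  It is polynomial in the entries of \<open>G\<close>.\<close>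

definition cofactor :: "complex^'n^'n \<Rightarrow> 'n::finite \<Rightarrow> 'n \<Rightarrow> complex" where
  "cofactor G i j = alternation (2 * CARD('n))
     (\<lambda>u. u 0 $ i * cnj (u 1 $ j) * pair_prod (CARD('n) - 1) (kaehler G) (\<lambda>l. u (2 + l))) real_frame"

text \<open>The vector \<open>u\<close> with the components \<open>inv_metric G l j\<close>
  represents the covector \<open>dzbar j\<close>: one has \<open>sesq G u w = cnj (w $ j)\<close>.
  By \<open>sesq_eq_kaehler\<close>, that covector is a combination of the contractions of the
  two-form with \<open>u\<close> and with \<open>\<i> *s u\<close>, and
  \<open>alternation_contraction\<close> evaluates each of them to a multiple of
  \<open>u $ i * top_form G\<close>.\<close>

lemma cofactor_eq_inv_metric:
  fixes G :: "complex^'n^'n::finite"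
  assumes G: "hermitian_pos G"
  shows "2 * \<i> * of_nat CARD('n) * cofactor G i j = inv_metric G i j * top_form G"
proof -
  define k m where "k = 2 * CARD('n)" and "m = CARD('n) - 1"
  have n: "CARD('n) = Suc m" by (simp add: m_def)
  have km: "k = 2 * Suc m" by (simp add: k_def n)
  let ?f = "real_frame :: nat \<Rightarrow> complex^'n"
  interpret antisymmetric_matrix "\<lambda>a c. kaehler G (?f a) (?f c)"
    by (rule antisymmetric_matrix_kaehler)
  have T: "alternation k (pair_prod (Suc m) (\<lambda>a c. kaehler G (?f a) (?f c))) (\<lambda>i. i) = top_form G"
    unfolding top_form_def n[symmetric] k_def[symmetric]
    by (subst (2) alternation_labels) (simp add: pair_prod_def[abs_def])
  define N where "N u = alternation k (\<lambda>l. ?f (l 0) $ i * kaehler G u (?f (l 1)) *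
      pair_prod m (\<lambda>a c. kaehler G (?f a) (?f c)) (\<lambda>i. l (2 + i))) (\<lambda>i. i)" for u
  have rep: "u = (\<Sum>a<k. (u \<bullet> ?f a) *\<^sub>R ?f a)" for u
    unfolding k_def using sum.reindex_bij_betw[OF real_frame_bij_betw[where 'n = 'n], of "\<lambda>b. (u \<bullet> b) *\<^sub>R b"]
    by (simp add: euclidean_representation)
  have N: "of_nat k * N u = u $ i * top_form G" for u
  proof -
    have lin: "linear (\<lambda>x. kaehler G x y)" for y
      using bilinear_kaehler by (auto simp: bilinear_def)
    have "kaehler G u y = kaehler G (\<Sum>a<k. (u \<bullet> ?f a) *\<^sub>R ?f a) y" for y
      by (rule arg_cong[OF rep])
    then have 1: "(\<Sum>a<k. of_real (u \<bullet> ?f a) * kaehler G (?f a) y) = kaehler G u y" for y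
      by (simp add: linear_sum[OF lin] linear_scale[OF lin] scaleR_conv_of_real[where 'a = complex])
    have "u $ i = (\<Sum>a<k. (u \<bullet> ?f a) *\<^sub>R ?f a) $ i"
      by (rule arg_cong[OF rep])
    then have 2: "(\<Sum>a<k. of_real (u \<bullet> ?f a) * ?f a $ i) = u $ i"
      by (simp add: scaleR_conv_of_real[where 'a = complex])
    show ?thesis
      using alternation_contraction[OF km, of "\<lambda>a. ?f a $ i" "\<lambda>a. of_real (u \<bullet> ?f a)"]
      by (simp only: N_def 1 2 T)
  qed
  define u :: "complex^'n" where "u = (\<chi> l. inv_metric G l j)"
  have "sesq G u w = cnj (w $ j)" for w
  proof -
    have "sesq G u w = (\<Sum>l\<in>UNIV. (\<Sum>q\<in>UNIV. inv_metric G q j * G $ q $ l) * cnj (w $ l))"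
      unfolding sesq_def u_def by (subst sum.swap) (simp add: sum_distrib_left mult_ac)
    also have "\<dots> = cnj (w $ j)"
      by (simp add: inv_metric_left[OF G] if_distrib[of "\<lambda>y. y * _"] cong: if_cong)
    finally show ?thesis .
  qed
  note u = this
  have cnj_eq: "cnj (w $ j) = 1 / (2 * \<i>) * kaehler G u w + (- 1 / 2) * kaehler G (\<i> *s u) w" if "sesq G u w = cnj (w $ j)" for w
  proof -
    have "(x - \<i> * y) / (2 * \<i>) = 1 / (2 * \<i>) * x + (- 1 / 2) * y" for x y
      by (simp add: diff_divide_distrib right_diff_distrib)
    then show ?thesis using sesq_eq_kaehler[of G u w] that by simp
  qed
  have "cofactor G i j = alternation k (\<lambda>l. ?f (l 0) $ i * cnj (?f (l 1) $ j) *
      pair_prod m (\<lambda>a c. kaehler G (?f a) (?f c)) (\<lambda>i. l (2 + i))) (\<lambda>i. i)"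
    unfolding cofactor_def k_def[symmetric] m_def[symmetric]
    by (subst alternation_labels) (simp add: pair_prod_def)
  also have "\<dots> = 1 / (2 * \<i>) * N u + (- 1 / 2) * N (\<i> *s u)"
  proof -
    let ?P = "\<lambda>l. pair_prod m (\<lambda>a c. kaehler G (?f a) (?f c)) (\<lambda>i. l (2 + i))"
    have "?f (l 0) $ i * cnj (?f (l 1) $ j) * ?P l =
        1 / (2 * \<i>) * (?f (l 0) $ i * kaehler G u (?f (l 1)) * ?P l) +
        (- 1 / 2) * (?f (l 0) $ i * kaehler G (\<i> *s u) (?f (l 1)) * ?P l)" for l
      unfolding cnj_eq[OF u] by (simp add: algebra_simps)
    then show ?thesis
      by (simp only: N_def alternation_add alternation_cmult)
  qed
  finally have E: "cofactor G i j = 1 / (2 * \<i>) * N u + (- 1 / 2) * N (\<i> *s u)" .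
  have "of_nat k * cofactor G i j = 1 / (2 * \<i>) * (of_nat k * N u) + (- 1 / 2) * (of_nat k * N (\<i> *s u))"
    unfolding E by (simp only: distrib_left mult_ac)
  \<comment> \<open>The two contributions \<open>1 / (2 * \<i>)\<close> and
    \<open>- \<i> / 2\<close> are equal and add up to \<open>1 / \<i>\<close>.\<close>
  also have "\<dots> = 1 / \<i> * (u $ i * top_form G)"
    unfolding N by (simp add: field_simps)
  finally have "\<i> * of_nat k * cofactor G i j = u $ i * top_form G"
    by (simp add: field_simps)
  then show ?thesis by (simp add: k_def u_def mult_ac)
qed

section \<open>Change of variables and integration by parts\<close>

lemma inner_real_frame_complexify:
  assumes "a < 2 * CARD('n)"
  shows "(complexify y :: complex^'n::finite) \<bullet> real_frame a = y $ bit0_enum a"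
  using realify_nth[OF assms, of "complexify y"] by simp

lemma borel_measurable_complexify [measurable]: "complexify \<in> borel_measurable borel"
  by (intro borel_measurable_continuous_onI linear_continuous_on linear_conv_bounded_linear[THEN iffD1] linear_complexify)

text \<open>An orthonormal basis goes to an orthonormal basis, so that preimages of boxes are boxes
  with the same side lengths, and boxes determine Lebesgue measure.\<close>

lemma distr_complexify: "distr lborel borel complexify = (lborel :: (complex^'n::finite) measure)"
proof (rule lborel_eqI[symmetric])
  fix l u :: "complex^'n" assume lu: "\<And>b. b \<in> Basis \<Longrightarrow> l \<bullet> b \<le> u \<bullet> b"
  have C: "(\<Prod>b\<in>Basis. f b) = (\<Prod>a<2 * CARD('n). f (real_frame a))" for f :: "complex^'n \<Rightarrow> real"
    by (rule prod.reindex_bij_betw[OF real_frame_bij_betw, symmetric])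
  have "bij_betw (\<lambda>q. axis q 1) (UNIV :: 'n bit0 set) (Basis :: (real^('n bit0)) set)"
    by (auto simp: bij_betw_def inj_on_def axis_eq_axis Basis_vec_def)
  then have bR: "bij_betw (\<lambda>a. axis (bit0_enum a) 1) {..<2 * CARD('n)} (Basis :: (real^('n bit0)) set)"
    using bij_betw_trans[OF bit0_enum_bij_betw] by (simp add: o_def)
  have R: "(\<Prod>b\<in>Basis. f b) = (\<Prod>a<2 * CARD('n). f (axis (bit0_enum a) 1))" for f :: "real^('n bit0) \<Rightarrow> real"
    by (rule prod.reindex_bij_betw[OF bR, symmetric])
  have real_frame_Basis: "real_frame ` {..<2 * CARD('n)} = (Basis :: (complex^'n) set)"
    using real_frame_bij_betw by (rule bij_betw_imp_surj_on)
  have axis_Basis: "(\<lambda>a. axis (bit0_enum a) 1) ` {..<2 * CARD('n)} = (Basis :: (real^('n bit0)) set)"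
    using bR by (rule bij_betw_imp_surj_on)
  have box: "complexify -` box l u = box (realify l) (realify u :: real^('n bit0))"
    unfolding box_def real_frame_Basis[symmetric] axis_Basis[symmetric]
    by (auto simp: inner_real_frame_complexify realify_nth inner_axis)
  have le: "realify l \<bullet> b \<le> realify u \<bullet> b" if "b \<in> Basis" for b :: "real^('n bit0)"
  proof -
    obtain a where "a < 2 * CARD('n)" "b = axis (bit0_enum a) 1"
      using \<open>b \<in> Basis\<close> unfolding axis_Basis[symmetric] by auto
    moreover have "real_frame a \<in> (Basis :: (complex^'n) set)"
      using calculation(1) unfolding real_frame_Basis[symmetric] by auto
    ultimately show ?thesis using lu by (simp add: inner_axis realify_nth)
  qed
  have "emeasure (distr lborel borel complexify) (box l u) = emeasure lborel (box (realify l) (realify u :: real^('n bit0)))"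
    by (subst emeasure_distr) (auto simp: box)
  also have "\<dots> = ennreal (\<Prod>b\<in>Basis. (realify u - realify l) \<bullet> b)"
    by (rule emeasure_lborel_box[OF le])
  also have "(\<Prod>b\<in>Basis. (realify u - realify l) \<bullet> b) = (\<Prod>b\<in>Basis. (u - l) \<bullet> b)"
    unfolding R C by (intro prod.cong) (auto simp: inner_diff_left inner_axis realify_nth)
  finally show "emeasure (distr lborel borel complexify) (box l u) = ennreal (\<Prod>b\<in>Basis. (u - l) \<bullet> b)" .
qed simp

lemma nn_integral_complexify:
  fixes F :: "complex^'n::finite \<Rightarrow> ennreal"
  assumes [measurable]: "F \<in> borel_measurable borel"
  shows "(\<integral>\<^sup>+y. F (complexify y) \<partial>lborel) = (\<integral>\<^sup>+x. F x \<partial>lborel)"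
proof -
  have "(\<integral>\<^sup>+x. F x \<partial>lborel) = (\<integral>\<^sup>+x. F x \<partial>distr lborel borel complexify)"
    by (simp only: distr_complexify)
  then show ?thesis by (simp add: nn_integral_distr)
qed

text \<open>The formula on \<open>real^('n bit0)\<close>, transported by \<open>complexify\<close>
  and \<open>realify\<close>. Finiteness of the right-hand side makes the integrand absolutely
  integrable there; the passage through \<open>real^1\<close> adapts scalar functions to a statement
  about vector-valued ones.\<close>

lemma nn_integral_change_of_variables:
  fixes T :: "complex^'n::finite \<Rightarrow> complex^'n" and f :: "complex^'n \<Rightarrow> real"
  assumes S: "S \<in> sets borel"
    and T: "\<And>x. x \<in> S \<Longrightarrow> (T has_derivative T' x) (at x)"
    and inj: "inj_on T S"
    and f: "\<And>x. x \<in> S \<Longrightarrow> 0 \<le> f (T x)"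
    and mf [measurable]: "(\<lambda>y. f y * indicator (T ` S) y) \<in> borel_measurable borel"
    and mg [measurable]: "(\<lambda>x. \<bar>real_det (T' x)\<bar> * f (T x) * indicator S x) \<in> borel_measurable borel"
    and fin: "(\<integral>\<^sup>+x. ennreal (\<bar>real_det (T' x)\<bar> * f (T x) * indicator S x) \<partial>lborel) < \<infinity>"
  shows "(\<integral>\<^sup>+y. ennreal (f y * indicator (T ` S) y) \<partial>lborel) =
    (\<integral>\<^sup>+x. ennreal (\<bar>real_det (T' x)\<bar> * f (T x) * indicator S x) \<partial>lborel)"
proof -
  define g where "g x = \<bar>real_det (T' x)\<bar> * f (T x)" for x
  define S' :: "(real^('n bit0)) set" where "S' = complexify -` S"
  define T1 :: "real^('n bit0) \<Rightarrow> real^('n bit0)" where "T1 = (\<lambda>y. realify (T (complexify y)))"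
  define T1' :: "real^('n bit0) \<Rightarrow> real^('n bit0) \<Rightarrow> real^('n bit0)"
    where "T1' y = realify \<circ> T' (complexify y) \<circ> complexify" for y
  have bl: "bounded_linear (complexify :: real^('n bit0) \<Rightarrow> complex^'n)" "bounded_linear (realify :: complex^'n \<Rightarrow> real^('n bit0))"
    using linear_complexify linear_realify by (simp_all add: linear_conv_bounded_linear)
  have S': "S' \<in> sets lebesgue"
    unfolding S'_def using measurable_sets[OF borel_measurable_complexify S] by auto
  have der: "(T1 has_derivative T1' y) (at y within S')" if "y \<in> S'" for y
  proof (rule has_derivative_at_withinI)
    have "((\<lambda>y. T (complexify y)) has_derivative (\<lambda>h. T' (complexify y) (complexify h))) (at y)"
      using that T[of "complexify y"] bounded_linear_imp_has_derivative[OF bl(1)]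
      by (intro has_derivative_compose[where f = complexify and g = T]) (auto simp: S'_def)
    from bounded_linear.has_derivative[OF bl(2) this] show "(T1 has_derivative T1' y) (at y)"
      by (simp add: T1_def T1'_def o_def)
  qed
  have inj': "inj_on T1 S'"
  proof (rule inj_onI)
    fix x y assume "x \<in> S'" "y \<in> S'" "T1 x = T1 y"
    then have "T (complexify x) = T (complexify y)" by (metis T1_def complexify_realify)
    then have "(complexify x :: complex^'n) = complexify y"
      using inj \<open>x \<in> S'\<close> \<open>y \<in> S'\<close> by (auto simp: S'_def inj_on_def)
    then show "x = y" by (metis realify_complexify)
  qed
  have img: "T1 ` S' = complexify -` (T ` S)"
  proof (intro equalityI subsetI)
    fix y assume "y \<in> complexify -` (T ` S)"
    then obtain x where "x \<in> S" "complexify y = T x" by auto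
    then have "realify x \<in> S'" by (simp add: S'_def)
    have "y = realify (complexify y :: complex^'n)" by simp
    also have "\<dots> = T1 (realify x)"
      unfolding \<open>complexify y = T x\<close> T1_def by simp
    finally have "y = T1 (realify x)" .
    with \<open>realify x \<in> S'\<close> show "y \<in> T1 ` S'" by blast
  qed (auto simp: T1_def S'_def)
  define r where "r = enn2real (\<integral>\<^sup>+x. ennreal (g x * indicator S x) \<partial>lborel)"
  have r: "(\<integral>\<^sup>+x. ennreal (g x * indicator S x) \<partial>lborel) = ennreal r"
    using fin unfolding r_def g_def by (simp add: ennreal_enn2real less_top)
  have g0: "0 \<le> g x * indicator S x" for x
    using f by (auto simp: g_def indicator_def)
  let ?c = "complexify :: real^('n bit0) \<Rightarrow> complex^'n"
  have hm: "(\<lambda>y. g (?c y) * indicator S (?c y)) \<in> borel_measurable borel"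
    using measurable_compose[OF borel_measurable_complexify mg] unfolding g_def by simp
  have "((\<lambda>y. g (?c y) * indicator S (?c y)) has_integral r) UNIV"
  proof (rule nn_integral_has_integral[OF hm g0])
    show "(\<integral>\<^sup>+y. ennreal (g (?c y) * indicator S (?c y)) \<partial>lborel) = ennreal r"
      unfolding r[symmetric] by (rule nn_integral_complexify) (use mg in \<open>simp add: g_def\<close>)
  qed (simp add: r_def)
  moreover have "(\<lambda>y. g (?c y) * indicator S (?c y)) = (\<lambda>y. if y \<in> S' then g (complexify y) else 0)"
    by (auto simp: S'_def)
  ultimately have I: "((\<lambda>y. g (complexify y)) has_integral r) S'"
    by (simp add: has_integral_restrict_UNIV)
  have "(\<lambda>y. g (complexify y)) absolutely_integrable_on S'"
    by (rule nonnegative_absolutely_integrable_1)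
      (use I f in \<open>auto simp: S'_def g_def\<close>)
  moreover have gT: "g (complexify y) = \<bar>det (matrix (T1' y))\<bar> * f (complexify (T1 y))" for y
    by (simp add: g_def T1_def T1'_def real_det_def)
  ultimately have "(\<lambda>y. \<bar>det (matrix (T1' y))\<bar> *\<^sub>R vec (f (complexify (T1 y))) :: real^1) absolutely_integrable_on S' \<and>
      integral S' (\<lambda>y. \<bar>det (matrix (T1' y))\<bar> *\<^sub>R vec (f (complexify (T1 y))) :: real^1) = vec r"
    using integral_unique[OF I] by (simp add: absolutely_integrable_on_1_iff integral_on_1_eq)
  then have "(\<lambda>y. vec (f (complexify y)) :: real^1) absolutely_integrable_on T1 ` S' \<and>
      integral (T1 ` S') (\<lambda>y. vec (f (complexify y)) :: real^1) = vec r"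
    using has_absolute_integral_change_of_variables[OF S' der inj', where f = "\<lambda>y. vec (f (complexify y)) :: real^1" and b = "vec r"]
    by blast
  then have "(\<lambda>y. f (complexify y)) absolutely_integrable_on T1 ` S' \<and> integral (T1 ` S') (\<lambda>y. f (complexify y)) = r"
    by (simp add: absolutely_integrable_on_1_iff integral_on_1_eq)
  then have "((\<lambda>y. f (complexify y)) has_integral r) (T1 ` S')"
    by (auto simp: absolutely_integrable_on_def has_integral_iff)
  then have "(\<integral>\<^sup>+y. ennreal (indicator (T1 ` S') y * f (complexify y)) \<partial>lborel) = ennreal r"
    by (rule nn_integral_has_integral_lebesgue[rotated]) (use f in \<open>auto simp: T1_def S'_def\<close>)
  moreover have "(\<integral>\<^sup>+y. ennreal (indicator (T1 ` S') y * f (complexify y)) \<partial>lborel) =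
      (\<integral>\<^sup>+y. ennreal (f (?c y) * indicator (T ` S) (?c y)) \<partial>lborel)"
    unfolding img by (intro nn_integral_cong) (auto simp: indicator_def)
  moreover have "\<dots> = (\<integral>\<^sup>+y. ennreal (f y * indicator (T ` S) y) \<partial>lborel)"
    by (rule nn_integral_complexify) measurable
  ultimately show ?thesis using r by (simp add: g_def)
qed

section \<open>Integrals of derivatives of compactly supported functions\<close>

lemma integrable_continuous_bounded_support:
  fixes G :: "'a::euclidean_space \<Rightarrow> 'b::{banach, second_countable_topology}"
  assumes "continuous_on UNIV G" "bounded K" "\<And>x. x \<notin> K \<Longrightarrow> G x = 0"
  shows "integrable lborel G"
proof -
  obtain R where R: "K \<subseteq> cball 0 R" using assms(2) unfolding bounded_iff by (auto simp: subset_iff)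
  have "indicator (cball 0 R) x *\<^sub>R G x = G x" for x
  proof (cases "x \<in> cball 0 R")
    case False
    then have "G x = 0" using R assms(3) by blast
    then show ?thesis by simp
  qed simp
  moreover have "integrable lborel (\<lambda>x. indicator (cball 0 R) x *\<^sub>R G x)"
    using assms(1) by (intro borel_integrable_compact) (auto intro: continuous_on_subset)
  ultimately show ?thesis by simp
qed

text \<open>Translation invariance of Lebesgue measure, differentiated.\<close>

lemma integral_frechet_derivative_eq_0:
  fixes G :: "'a::euclidean_space \<Rightarrow> complex"
  assumes G: "times_differentiable_on 1 UNIV G" and K: "bounded K" "\<And>x. x \<notin> K \<Longrightarrow> G x = 0"
  shows "(\<integral>x. frechet_derivative G (at x) v \<partial>lborel) = 0"
proof -
  have dG: "G differentiable (at x)" for x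
    using G by simp
  have cD: "continuous_on UNIV (\<lambda>x. frechet_derivative G (at x) v)"
    using G by simp
  have cG: "continuous_on UNIV G"
    using times_differentiable_on_imp_continuous_on[OF G] .
  obtain R where R: "K \<subseteq> cball 0 R"
    using K(1) unfolding bounded_iff by (auto simp: subset_iff)
  \<comment> \<open>The difference quotients \<open>q k\<close> below vanish outside the ball of
    radius \<open>R + norm v\<close>, and the intermediate points of the mean value estimate lie at
    most \<open>norm v\<close> further out.\<close>
  have "bounded ((\<lambda>x. frechet_derivative G (at x) v) ` cball 0 (R + 2 * norm v))"
    using cD by (intro compact_imp_bounded compact_continuous_image) (auto intro: continuous_on_subset)
  then obtain B where "\<forall>y\<in>(\<lambda>x. frechet_derivative G (at x) v) ` cball 0 (R + 2 * norm v). norm y \<le> B"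
    unfolding bounded_iff by blast
  then have B: "norm (frechet_derivative G (at x) v) \<le> B" if "x \<in> cball 0 (R + 2 * norm v)" for x
    using that by blast
  have line: "((\<lambda>s. G (x + s *\<^sub>R v)) has_derivative (\<lambda>h. h *\<^sub>R frechet_derivative G (at (x + s *\<^sub>R v)) v)) (at s)" for x s
  proof -
    have "((\<lambda>s. G (x + s *\<^sub>R v)) has_derivative (\<lambda>h. frechet_derivative G (at (x + s *\<^sub>R v)) (h *\<^sub>R v))) (at s)"
      by (rule has_derivative_compose[where f = "\<lambda>s. x + s *\<^sub>R v" and g = G])
        (auto intro!: derivative_eq_intros simp: frechet_derivative_works[symmetric] dG)
    moreover have "(\<lambda>h. frechet_derivative G (at (x + s *\<^sub>R v)) (h *\<^sub>R v)) = (\<lambda>h. h *\<^sub>R frechet_derivative G (at (x + s *\<^sub>R v)) v)"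
      using linear_scale[OF linear_frechet_derivative[OF dG]] by (intro ext)
    ultimately show ?thesis by simp
  qed
  define s where "s k = inverse (real (Suc k))" for k
  have s: "0 < s k" "s k \<le> 1" for k by (auto simp: s_def field_simps)
  have s0: "s \<longlonglongrightarrow> 0" unfolding s_def by (rule LIMSEQ_inverse_real_of_nat)
  define q where "q k x = (1 / s k) *\<^sub>R (G (x + s k *\<^sub>R v) - G x)" for k x
  have shift: "(\<integral>x. G (x + a) \<partial>lborel) = (\<integral>x. G x \<partial>lborel) \<and> integrable lborel (\<lambda>x. G (x + a))" for a
  proof -
    have "integrable lborel G" by (rule integrable_continuous_bounded_support[OF cG K])
    then have "integrable (distr lborel borel ((+) a)) G" "(\<integral>x. G x \<partial>distr lborel borel ((+) a)) = (\<integral>x. G x \<partial>lborel)"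
      by (simp_all add: lborel_distr_plus)
    moreover have "G \<in> borel_measurable borel"
      using cG by (rule borel_measurable_continuous_onI)
    ultimately show ?thesis
      by (simp add: integrable_distr_eq integral_distr add.commute)
  qed
  have "(\<integral>x. q k x \<partial>lborel) = 0" for k
    using shift[of "s k *\<^sub>R v"] shift[of 0] by (simp add: q_def)
  moreover have "(\<lambda>k. \<integral>x. q k x \<partial>lborel) \<longlonglongrightarrow> (\<integral>x. frechet_derivative G (at x) v \<partial>lborel)"
  proof (rule integral_dominated_convergence)
    show "(\<lambda>x. frechet_derivative G (at x) v) \<in> borel_measurable lborel"
      using borel_measurable_continuous_onI[OF cD] by simp
    have "continuous_on UNIV (q k)" for k
      unfolding q_def using cG by (intro continuous_intros continuous_on_compose2[OF cG]) auto
    then show "q k \<in> borel_measurable lborel" for k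
      using borel_measurable_continuous_onI by auto
    show "integrable lborel (\<lambda>x. B * indicator (cball 0 (R + norm v)) x)"
      using emeasure_bounded_finite[OF bounded_cball] by (intro integrable_mult_right integrable_real_indicator) simp_all
    have "(\<lambda>k. q k x) \<longlonglongrightarrow> frechet_derivative G (at x) v" for x
    proof -
      have "(\<lambda>h. norm (G (x + h *\<^sub>R v) - G x - h *\<^sub>R frechet_derivative G (at x) v) / norm h) \<midarrow>0\<rightarrow> 0"
        using line[of x 0] by (simp add: has_derivative_at)
      moreover have "filterlim s (at 0) sequentially"
        using s0 s(1) by (auto simp: filterlim_at intro!: always_eventually less_imp_neq[symmetric])
      ultimately have "(\<lambda>k. norm (G (x + s k *\<^sub>R v) - G x - s k *\<^sub>R frechet_derivative G (at x) v) / norm (s k)) \<longlonglongrightarrow> 0"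
        by (rule filterlim_compose)
      moreover have "norm (G (x + s k *\<^sub>R v) - G x - s k *\<^sub>R frechet_derivative G (at x) v) / norm (s k) =
          norm (q k x - frechet_derivative G (at x) v)" for k
      proof -
        have "q k x - frechet_derivative G (at x) v = (1 / s k) *\<^sub>R (G (x + s k *\<^sub>R v) - G x - s k *\<^sub>R frechet_derivative G (at x) v)"
          using s(1)[of k] by (simp add: q_def scaleR_diff_right)
        then show ?thesis using s(1)[of k] by simp
      qed
      ultimately show ?thesis
        by (simp add: LIM_zero_iff tendsto_norm_zero_iff)
    qed
    then show "AE x in lborel. (\<lambda>k. q k x) \<longlonglongrightarrow> frechet_derivative G (at x) v" by simp
    have "norm (q k x) \<le> B * indicator (cball 0 (R + norm v)) x" for k x
    proof (cases "x \<in> cball 0 (R + norm v)")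
      case True
      have "norm (G (x + s k *\<^sub>R v) - G (x + 0 *\<^sub>R v)) \<le> B * norm (s k - 0)"
      proof (rule differentiable_bound[where S = "{0..s k}" and f = "\<lambda>s. G (x + s *\<^sub>R v)"])
        fix t assume t: "t \<in> {0..s k}"
        show "((\<lambda>s. G (x + s *\<^sub>R v)) has_derivative (\<lambda>h. h *\<^sub>R frechet_derivative G (at (x + t *\<^sub>R v)) v)) (at t within {0..s k})"
          by (rule has_derivative_at_withinI[OF line])
        have "norm (x + t *\<^sub>R v) \<le> norm x + t * norm v"
          using t norm_triangle_ineq[of x "t *\<^sub>R v"] by simp
        also have "\<dots> \<le> (R + norm v) + 1 * norm v"
          using True t s(2)[of k] by (intro add_mono mult_right_mono) auto
        finally have "norm (frechet_derivative G (at (x + t *\<^sub>R v)) v) \<le> B"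
          by (intro B) simp
        then show "onorm (\<lambda>h. h *\<^sub>R frechet_derivative G (at (x + t *\<^sub>R v)) v) \<le> B"
          by (intro onorm_le) (simp add: mult.commute[of B] mult_left_mono)
      qed (use s(1)[of k] in auto)
      then have "norm (G (x + s k *\<^sub>R v) - G x) \<le> B * s k"
        using s(1)[of k] by simp
      then show ?thesis
        using True s(1)[of k] unfolding q_def norm_scaleR by (simp add: field_simps del: scaleR_diff_right)
    next
      case False
      have "norm x \<le> norm (x + s k *\<^sub>R v) + s k * norm v"
        using norm_triangle_ineq4[of "x + s k *\<^sub>R v" "s k *\<^sub>R v"] s(1)[of k] by simp
      also have "s k * norm v \<le> 1 * norm v"
        using s(2)[of k] by (intro mult_right_mono) auto
      finally have "x + s k *\<^sub>R v \<notin> cball 0 R" "x \<notin> cball 0 R"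
        using False by (simp_all add: not_le) (use norm_ge_zero[of v] in linarith)+
      then have "G (x + s k *\<^sub>R v) = 0" "G x = 0"
        using R K(2) by blast+
      then show ?thesis using False by (simp add: q_def)
    qed
    then show "AE x in lborel. norm (q k x) \<le> B * indicator (cball 0 (R + norm v)) x" for k by simp
  qed
  ultimately show ?thesis
    by (simp add: LIMSEQ_const_iff)
qed

section \<open>Charts and the volume measure\<close>

lemma homeomorphism_image_borel:
  assumes h: "homeomorphism S T f g" and "open T" and B: "B \<in> sets borel" "B \<subseteq> S"
  shows "f ` B \<in> sets borel"
proof -
  have "f ` B = g -` B \<inter> T"
    using h B(2) unfolding homeomorphism_def by (auto simp: image_iff subset_iff)
  moreover have "g \<in> borel_measurable (restrict_space borel T)"
    using h by (intro borel_measurable_continuous_on_restrict) (simp add: homeomorphism_def)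
  then have "g -` B \<inter> T \<in> sets (restrict_space borel T)"
    using measurable_sets[of g "restrict_space borel T" borel B] B(1) by (simp add: space_restrict_space)
  ultimately show ?thesis
    using \<open>open T\<close> by (simp add: sets_restrict_space_iff)
qed

lemma ennreal_times_indicator: "ennreal (r * indicator S x) = ennreal r * indicator S x"
  by (simp add: indicator_def)

lemma disjoint_family_on_Int: "disjoint_family_on U I \<Longrightarrow> disjoint_family_on (\<lambda>k. B \<inter> U k) I"
  unfolding disjoint_family_on_def by blast

locale complex_manifold =
  fixes A :: "('m::t2_space, 'n::finite) chart set"
  assumes atlas: "complex_atlas A" and compact_UNIV: "compact (UNIV :: 'm set)"
begin

lemma
  assumes "c \<in> A"
  shows open_dom: "open (chart_dom c)" and open_img: "open (chart_img c)"
    and chart_homeomorphism: "homeomorphism (chart_dom c) (chart_img c) (chart_map c) (chart_inv c)"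
  using atlas assms unfolding complex_atlas_def by auto

lemma
  assumes "c \<in> A"
  shows chart_inv_map: "x \<in> chart_dom c \<Longrightarrow> chart_inv c (chart_map c x) = x"
    and chart_map_inv: "z \<in> chart_img c \<Longrightarrow> chart_map c (chart_inv c z) = z"
    and chart_inv_dom: "z \<in> chart_img c \<Longrightarrow> chart_inv c z \<in> chart_dom c"
    and continuous_chart_map: "continuous_on (chart_dom c) (chart_map c)"
    and continuous_chart_inv: "continuous_on (chart_img c) (chart_inv c)"
  using chart_homeomorphism[OF assms] unfolding homeomorphism_def by auto

lemma chart_exists: "\<exists>c\<in>A. x \<in> chart_dom c"
  using atlas unfolding complex_atlas_def by auto

abbreviation overlap :: "('m, 'n) chart \<Rightarrow> ('m, 'n) chart \<Rightarrow> (complex^'n) set" where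
  "overlap c d \<equiv> chart_map c ` (chart_dom c \<inter> chart_dom d)"

lemma open_chart_map_image:
  assumes "c \<in> A" "open U" "U \<subseteq> chart_dom c"
  shows "open (chart_map c ` U)"
proof -
  have "chart_map c ` U = chart_inv c -` U \<inter> chart_img c"
    using assms(3) chart_inv_map[OF assms(1)] chart_map_inv[OF assms(1)] by (auto simp: image_iff subset_iff)
  then show ?thesis
    using continuous_on_open_vimage[OF open_img[OF assms(1)], of "chart_inv c"] continuous_chart_inv[OF assms(1)] assms(2)
    by simp
qed

lemma open_overlap: "c \<in> A \<Longrightarrow> d \<in> A \<Longrightarrow> open (overlap c d)"
  by (intro open_chart_map_image open_Int open_dom) auto

lemma
  assumes "c \<in> A" "d \<in> A"
  shows transition_holomorphic: "holomorphic_map_on (overlap c d) (transition c d)"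
    and transition_smooth: "times_differentiable_on k (overlap c d) (transition c d)"
  using atlas assms unfolding complex_atlas_def holomorphic_map_on_def smooth_on_def by auto

lemma
  assumes "c \<in> A" "d \<in> A" "z \<in> overlap c d"
  shows chart_inv_transition: "chart_inv d (transition c d z) = chart_inv c z"
    and transition_img: "transition c d z \<in> chart_img d"
  using assms by (auto simp: transition_def chart_inv_map)

lemma transition_linear:
  assumes "c \<in> A" "d \<in> A" "z \<in> overlap c d"
  shows "(transition c d has_derivative frechet_derivative (transition c d) (at z)) (at z)"
  using times_differentiable_onD[OF transition_smooth[OF assms(1,2), of 1] _ assms(3)]
  by (simp add: frechet_derivative_works)

section \<open>Finite covers by coordinate balls\<close>

text \<open>That even the closed ball lies in the image of the chart gives compactness twice:
  bounded density, hence finite volume, and cut-off functions with compact support inside one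
  chart.\<close>

definition coordinate_ball :: "('m, 'n) chart \<times> (complex^'n) \<times> real \<Rightarrow> bool" where
  "coordinate_ball = (\<lambda>(c, z, r). c \<in> A \<and> r > 0 \<and> cball z r \<subseteq> chart_img c)"

definition ball_nhd :: "('m, 'n) chart \<times> (complex^'n) \<times> real \<Rightarrow> 'm set" where
  "ball_nhd = (\<lambda>(c, z, r). chart_map c -` ball z r \<inter> chart_dom c)"

lemma open_ball_nhd:
  assumes "coordinate_ball a"
  shows "open (ball_nhd a)"
proof -
  obtain c z r where a: "a = (c, z, r)" by (cases a)
  then have "c \<in> A" using assms by (simp add: coordinate_ball_def)
  from continuous_on_open_vimage[OF open_dom[OF this], of "chart_map c"] continuous_chart_map[OF this]
  show ?thesis by (simp add: a ball_nhd_def)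
qed

lemma coordinate_ball_exists: "\<exists>a. coordinate_ball a \<and> x \<in> ball_nhd a"
proof -
  obtain c where c: "c \<in> A" "x \<in> chart_dom c" using chart_exists by blast
  then obtain r where "r > 0" "cball (chart_map c x) r \<subseteq> chart_img c"
    using open_img[OF c(1)] open_contains_cball by blast
  then have "coordinate_ball (c, chart_map c x, r) \<and> x \<in> ball_nhd (c, chart_map c x, r)"
    using c by (auto simp: coordinate_ball_def ball_nhd_def)
  then show ?thesis by blast
qed

lemma finite_cover: "\<exists>I. finite I \<and> (\<forall>a\<in>I. coordinate_ball a) \<and> (\<Union>a\<in>I. ball_nhd a) = UNIV"
proof -
  have "UNIV \<subseteq> (\<Union>a\<in>Collect coordinate_ball. ball_nhd a)"
    using coordinate_ball_exists by blast
  then obtain I where "I \<subseteq> Collect coordinate_ball" "finite I" "UNIV \<subseteq> (\<Union>a\<in>I. ball_nhd a)"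
    using compactE_image[OF compact_UNIV, of "Collect coordinate_ball" ball_nhd] open_ball_nhd by auto
  then show ?thesis by (intro exI[of _ I]) auto
qed

text \<open>Each piece lies in a single chart, so that a measure on the manifold can be both
  determined and constructed piece by piece.\<close>

lemma finite_borel_partition:
  obtains N :: nat and c U where "\<And>k. k < N \<Longrightarrow> c k \<in> A" "\<And>k. k < N \<Longrightarrow> U k \<in> sets borel"
    "\<And>k. k < N \<Longrightarrow> U k \<subseteq> chart_dom (c k)" "disjoint_family_on U {..<N}" "(\<Union>k<N. U k) = UNIV"
proof -
  obtain I where I: "finite I" "\<forall>a\<in>I. coordinate_ball a" "(\<Union>a\<in>I. ball_nhd a) = UNIV"
    using finite_cover by blast
  obtain xs where xs: "set xs = I" using finite_list[OF I(1)] by blast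
  define U where "U k = ball_nhd (xs ! k) - (\<Union>j<k. ball_nhd (xs ! j))" for k
  have cb: "coordinate_ball (xs ! k)" if "k < length xs" for k
    using I(2) xs that by auto
  have "(\<forall>k<length xs. fst (xs ! k) \<in> A \<and> U k \<in> sets borel \<and> U k \<subseteq> chart_dom (fst (xs ! k)))"
  proof (intro allI impI conjI)
    fix k assume k: "k < length xs"
    show "fst (xs ! k) \<in> A" using cb[OF k] by (auto simp: coordinate_ball_def)
    show "U k \<subseteq> chart_dom (fst (xs ! k))" by (auto simp: U_def ball_nhd_def split: prod.splits)
    have "open (ball_nhd (xs ! j))" if "j \<le> k" for j
      using that k by (intro open_ball_nhd cb) auto
    then show "U k \<in> sets borel"
      unfolding U_def by (intro sets.Diff sets.finite_UN borel_open) auto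
  qed
  moreover have "disjoint_family_on U {..<length xs}"
    unfolding disjoint_family_on_def
  proof (intro ballI impI)
    fix i j :: nat assume "i \<noteq> j"
    then have "i < j \<or> j < i" by auto
    then show "U i \<inter> U j = {}" unfolding U_def by blast
  qed
  moreover have "(\<Union>k<length xs. U k) = UNIV"
  proof -
    have "\<exists>k<length xs. x \<in> U k" for x
    proof -
      have ex: "\<exists>k. k < length xs \<and> x \<in> ball_nhd (xs ! k)"
      proof -
        obtain a where "a \<in> set xs" "x \<in> ball_nhd a" using I(3) xs by blast
        then show ?thesis by (metis in_set_conv_nth)
      qed
      define k where "k = (LEAST k. k < length xs \<and> x \<in> ball_nhd (xs ! k))"
      have k: "k < length xs \<and> x \<in> ball_nhd (xs ! k)"
        unfolding k_def by (rule LeastI_ex[OF ex])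
      moreover have "x \<notin> ball_nhd (xs ! j)" if "j < k" for j
        using not_less_Least[of j "\<lambda>k. k < length xs \<and> x \<in> ball_nhd (xs ! k)"] that k
        unfolding k_def by auto
      ultimately show ?thesis unfolding U_def by blast
    qed
    then show ?thesis by auto
  qed
  ultimately show ?thesis
    by (intro that[of "length xs" "\<lambda>k. fst (xs ! k)" U]) auto
qed

section \<open>The volume measure: uniqueness\<close>

text \<open>The predicate under the definite description in \<open>volume_measure\<close>.\<close>

definition volume_measure_for :: "('m, 'n) metric \<Rightarrow> 'm measure \<Rightarrow> bool" where
  "volume_measure_for g \<mu> \<longleftrightarrow> sets \<mu> = sets borel \<and>
     (\<forall>c\<in>A. \<forall>B\<in>sets borel. B \<subseteq> chart_dom c \<longrightarrow>
        emeasure \<mu> B = (\<integral>\<^sup>+ z. ennreal (volume_density (local_metric g c z)) * indicator (chart_map c ` B) z \<partial>lborel))"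

lemma volume_measure_for_unique:
  assumes "volume_measure_for g \<mu>" "volume_measure_for g \<mu>'"
  shows "\<mu> = \<mu>'"
proof (rule measure_eqI)
  show "sets \<mu> = sets \<mu>'" using assms by (simp add: volume_measure_for_def)
  fix B assume "B \<in> sets \<mu>"
  then have B: "B \<in> sets borel" using assms by (simp add: volume_measure_for_def)
  obtain N :: nat and c U where U: "\<And>k. k < N \<Longrightarrow> c k \<in> A" "\<And>k. k < N \<Longrightarrow> U k \<in> sets borel"
    "\<And>k. k < N \<Longrightarrow> U k \<subseteq> chart_dom (c k)" "disjoint_family_on U {..<N}" "(\<Union>k<N. U k) = UNIV"
    by (rule finite_borel_partition) (rule that)
  have split: "emeasure M B = (\<Sum>k<N. emeasure M (B \<inter> U k))" if "volume_measure_for g M" for M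
  proof -
    have "(\<Sum>k<N. emeasure M (B \<inter> U k)) = emeasure M (\<Union>k<N. B \<inter> U k)"
      using that B U(2) unfolding volume_measure_for_def
      by (intro sum_emeasure disjoint_family_on_Int U(4)) auto
    also have "(\<Union>k<N. B \<inter> U k) = B" using U(5) by auto
    finally show ?thesis by simp
  qed
  have "emeasure \<mu> (B \<inter> U k) = emeasure \<mu>' (B \<inter> U k)" if "k < N" for k
  proof -
    have "B \<inter> U k \<in> sets borel" "B \<inter> U k \<subseteq> chart_dom (c k)"
      using B U(2,3)[OF that] by auto
    then show ?thesis
      using assms U(1)[OF that] unfolding volume_measure_for_def by simp
  qed
  then show "emeasure \<mu> B = emeasure \<mu>' B"
    using split assms by simp
qed

lemma volume_measure_eqI: "volume_measure_for g \<mu> \<Longrightarrow> volume_measure A g = \<mu>"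
  unfolding volume_measure_def volume_measure_for_def[symmetric]
  by (rule the_equality) (auto intro: volume_measure_for_unique)

end

locale hermitian_manifold = complex_manifold A for A :: "('m::t2_space, 'n::finite) chart set" +
  fixes g :: "('m, 'n) metric"
  assumes metric: "hermitian_metric A g"
begin

abbreviation density_at :: "('m, 'n) chart \<Rightarrow> complex^'n \<Rightarrow> real" where
  "density_at c z \<equiv> volume_density (local_metric g c z)"

lemma hermitian_pos_local:
  assumes "c \<in> A" "z \<in> chart_img c"
  shows "hermitian_pos (local_metric g c z)"
  using metric assms chart_inv_dom[OF assms]
  unfolding hermitian_metric_def hermitian_pos_def local_metric_def by blast

lemma smooth_local_metric: "c \<in> A \<Longrightarrow> times_differentiable_on k (chart_img c) (\<lambda>z. local_metric g c z $ i $ j)"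
  using metric unfolding hermitian_metric_def smooth_on_def local_metric_def by blast

lemma sesq_transition:
  assumes "c \<in> A" "d \<in> A" "z \<in> overlap c d"
  shows "sesq (local_metric g c z) u w = sesq (local_metric g d (transition c d z))
    (frechet_derivative (transition c d) (at z) u) (frechet_derivative (transition c d) (at z) w)"
proof -
  obtain x where x: "x \<in> chart_dom c \<inter> chart_dom d" "z = chart_map c x" using assms(3) by auto
  then have "chart_inv c z = x" "chart_inv d (transition c d z) = x"
    using assms by (auto simp: chart_inv_map transition_def)
  then show ?thesis
    using metric assms(1,2) x unfolding hermitian_metric_def local_metric_def by metis
qed

lemma density_at_transition:
  assumes "c \<in> A" "d \<in> A" "z \<in> overlap c d"
  shows "density_at c z = \<bar>real_det (frechet_derivative (transition c d) (at z))\<bar> * density_at d (transition c d z)"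
proof (rule volume_density_linear_image)
  show "hermitian_pos (local_metric g c z)" "hermitian_pos (local_metric g d (transition c d z))"
    using assms transition_img[OF assms] by (auto intro: hermitian_pos_local)
  show "linear (frechet_derivative (transition c d) (at z))"
    using transition_linear[OF assms] by (rule has_derivative_linear)
qed (rule sesq_transition[OF assms])

lemma density_at_pos: "c \<in> A \<Longrightarrow> z \<in> chart_img c \<Longrightarrow> 0 < density_at c z"
  by (intro volume_density_pos hermitian_pos_local)

lemma smooth_kaehler: "c \<in> A \<Longrightarrow> times_differentiable_on k (chart_img c) (\<lambda>z. kaehler (local_metric g c z) u w)"
  unfolding kaehler_def sesq_def
  by (intro times_differentiable_on_mult times_differentiable_on_diff times_differentiable_on_sum
      times_differentiable_on_const smooth_local_metric open_img)

lemma smooth_pair_prod: "c \<in> A \<Longrightarrow> times_differentiable_on k (chart_img c) (\<lambda>z. pair_prod m (kaehler (local_metric g c z)) u)"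
  unfolding pair_prod_def by (intro times_differentiable_on_prod smooth_kaehler open_img)

lemma smooth_top_form: "c \<in> A \<Longrightarrow> times_differentiable_on k (chart_img c) (\<lambda>z. top_form (local_metric g c z))"
  unfolding top_form_def alternation_def
  by (intro times_differentiable_on_sum times_differentiable_on_mult times_differentiable_on_const smooth_pair_prod open_img)

lemma smooth_cofactor: "c \<in> A \<Longrightarrow> times_differentiable_on k (chart_img c) (\<lambda>z. cofactor (local_metric g c z) i j)"
  unfolding cofactor_def alternation_def
  by (intro times_differentiable_on_sum times_differentiable_on_mult times_differentiable_on_const smooth_pair_prod open_img)

text \<open>In the manner of Cramer's rule, \<open>cofactor_eq_inv_metric\<close> makes the inverse
  metric a quotient of polynomials in the coefficients, with a denominator that does not
  vanish.\<close>

lemma smooth_inv_metric: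
  assumes "c \<in> A"
  shows "times_differentiable_on k (chart_img c) (\<lambda>z. inv_metric (local_metric g c z) i j)"
proof -
  have "inv_metric (local_metric g c z) i j =
    2 * \<i> * of_nat CARD('n) * cofactor (local_metric g c z) i j / top_form (local_metric g c z)"
    if "z \<in> chart_img c" for z
    using cofactor_eq_inv_metric[OF hermitian_pos_local[OF assms that]] top_form_neq_0[OF hermitian_pos_local[OF assms that]]
    by (simp add: field_simps)
  moreover have "times_differentiable_on k (chart_img c)
    (\<lambda>z. 2 * \<i> * of_nat CARD('n) * cofactor (local_metric g c z) i j / top_form (local_metric g c z))"
    using assms by (intro times_differentiable_on_divide times_differentiable_on_mult times_differentiable_on_const
        smooth_cofactor smooth_top_form open_img top_form_neq_0 hermitian_pos_local)
  ultimately show ?thesis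
    by (subst times_differentiable_on_cong[OF open_img[OF assms]])
qed

lemma continuous_density_at: "c \<in> A \<Longrightarrow> continuous_on (chart_img c) (density_at c)"
  unfolding volume_density_eq_top_form
  by (intro continuous_intros times_differentiable_on_imp_continuous_on[OF smooth_top_form[of _ 0]]) auto

lemma borel_measurable_density_at:
  assumes "c \<in> A" "B \<in> sets borel" "B \<subseteq> chart_img c"
  shows "(\<lambda>z. density_at c z * indicator B z) \<in> borel_measurable borel"
proof -
  have "(\<lambda>z. indicator B z *\<^sub>R density_at c z) \<in> borel_measurable borel"
    using assms continuous_on_subset[OF continuous_density_at]
    by (intro borel_measurable_continuous_on_indicator) auto
  then show ?thesis by (simp add: mult.commute)
qed

section \<open>The volume measure: existence\<close>

text \<open>The map is given a constant value off the image, so that it is Borel measurable on the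
  whole coordinate space; the density is zero there, so no mass comes from those points.\<close>

definition chart_measure :: "('m, 'n) chart \<Rightarrow> 'm measure" where
  "chart_measure c = distr (density lborel (\<lambda>z. ennreal (density_at c z * indicator (chart_img c) z))) borel
     (\<lambda>z. if z \<in> chart_img c then chart_inv c z else undefined)"

lemma measurable_chart_inv:
  assumes "c \<in> A"
  shows "(\<lambda>z. if z \<in> chart_img c then chart_inv c z else undefined) \<in> borel_measurable borel"
proof (rule measurable_If_restrict_space_iff[THEN iffD2])
  show "chart_inv c \<in> borel_measurable (restrict_space borel {z. z \<in> chart_img c}) \<and>
    (\<lambda>z. undefined) \<in> borel_measurable (restrict_space borel {z. z \<notin> chart_img c})"
    using continuous_chart_inv[OF assms] by (auto intro: borel_measurable_continuous_on_restrict)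
qed (use open_img[OF assms] in auto)

lemma sets_chart_measure [simp]: "sets (chart_measure c) = sets borel"
  by (simp add: chart_measure_def)

lemma nn_integral_chart_measure:
  assumes c: "c \<in> A" and F: "F \<in> borel_measurable borel"
  shows "(\<integral>\<^sup>+x. F x \<partial>chart_measure c) =
    (\<integral>\<^sup>+z. ennreal (density_at c z * indicator (chart_img c) z) * F (chart_inv c z) \<partial>lborel)"
proof -
  let ?i = "\<lambda>z. if z \<in> chart_img c then chart_inv c z else undefined"
  have [measurable]: "?i \<in> borel_measurable borel" by (rule measurable_chart_inv[OF c])
  have [measurable]: "(\<lambda>z. density_at c z * indicator (chart_img c) z) \<in> borel_measurable borel"
    using open_img[OF c] by (intro borel_measurable_density_at[OF c]) auto
  have [measurable]: "(\<lambda>z. F (?i z)) \<in> borel_measurable borel"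
    using F by (rule measurable_compose[rotated]) measurable
  have "(\<integral>\<^sup>+x. F x \<partial>chart_measure c) = (\<integral>\<^sup>+z. F (?i z) \<partial>density lborel (\<lambda>z. ennreal (density_at c z * indicator (chart_img c) z)))"
    unfolding chart_measure_def using F by (intro nn_integral_distr) (auto simp: measurable_chart_inv[OF c])
  also have "\<dots> = (\<integral>\<^sup>+z. ennreal (density_at c z * indicator (chart_img c) z) * F (?i z) \<partial>lborel)"
    by (intro nn_integral_density) measurable
  also have "\<dots> = (\<integral>\<^sup>+z. ennreal (density_at c z * indicator (chart_img c) z) * F (chart_inv c z) \<partial>lborel)"
    by (intro nn_integral_cong) (auto simp: indicator_def)
  finally show ?thesis .
qed

lemma chart_map_image_eq:
  assumes c: "c \<in> A" and B: "B \<subseteq> chart_dom c"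
  shows "z \<in> chart_map c ` B \<longleftrightarrow> z \<in> chart_img c \<and> chart_inv c z \<in> B"
proof
  assume "z \<in> chart_map c ` B"
  then obtain x where "x \<in> B" "z = chart_map c x" by blast
  then show "z \<in> chart_img c \<and> chart_inv c z \<in> B"
    using B chart_inv_map[OF c, of x] by auto
next
  assume "z \<in> chart_img c \<and> chart_inv c z \<in> B"
  then show "z \<in> chart_map c ` B"
    using chart_map_inv[OF c, of z] image_eqI[of z "chart_map c" "chart_inv c z" B] by simp
qed

lemma emeasure_chart_measure:
  assumes c: "c \<in> A" and B: "B \<in> sets borel" "B \<subseteq> chart_dom c"
  shows "emeasure (chart_measure c) B = (\<integral>\<^sup>+ z. ennreal (density_at c z) * indicator (chart_map c ` B) z \<partial>lborel)"
proof -
  have "emeasure (chart_measure c) B = (\<integral>\<^sup>+x. indicator B x \<partial>chart_measure c)"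
    using B by simp
  also have "\<dots> = (\<integral>\<^sup>+z. ennreal (density_at c z * indicator (chart_img c) z) * indicator B (chart_inv c z) \<partial>lborel)"
    using B by (intro nn_integral_chart_measure[OF c]) auto
  also have "\<dots> = (\<integral>\<^sup>+ z. ennreal (density_at c z) * indicator (chart_map c ` B) z \<partial>lborel)"
    by (intro nn_integral_cong) (auto simp: indicator_def chart_map_image_eq[OF c B(2)])
  finally show ?thesis .
qed

text \<open>Change of variables is available for finite integrals only, hence the exhaustion of \<open>B\<close> by sets on
  which the density is bounded.\<close>

lemma chart_measure_compatible:
  assumes c: "c \<in> A" and d: "d \<in> A" and B: "B \<in> sets borel" "B \<subseteq> chart_dom c \<inter> chart_dom d"
  shows "emeasure (chart_measure c) B = emeasure (chart_measure d) B"
proof -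
  \<comment> \<open>The bound on \<open>norm z\<close> keeps the Lebesgue measure of
    \<open>S k\<close> finite, the other bound keeps the integrand below \<open>k\<close>.\<close>
  define S where "S k = {z \<in> chart_map c ` B. norm z \<le> real k \<and> density_at c z \<le> real k}" for k
  define C where "C k = chart_inv c ` S k" for k
  have mB: "chart_map c ` B \<in> sets borel"
    using B by (intro homeomorphism_image_borel[OF chart_homeomorphism[OF c] open_img[OF c]]) auto
  have Simg: "S k \<subseteq> chart_map c ` B" "S k \<subseteq> chart_img c" "S k \<subseteq> overlap c d" for k
    using B(2) by (auto simp: S_def)
  have "C k \<subseteq> B" for k
    using B(2) chart_map_image_eq[OF c, of B] by (auto simp: C_def S_def)
  then have CB: "C k \<subseteq> B" "C k \<subseteq> chart_dom c" "C k \<subseteq> chart_dom d" for k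
    using B(2) by blast+
  have S [measurable]: "S k \<in> sets borel" for k
  proof -
    have "(\<lambda>z. density_at c z * indicator (chart_map c ` B) z) \<in> borel_measurable borel"
      using B(2) by (intro borel_measurable_density_at[OF c mB]) auto
    then have "{z. density_at c z * indicator (chart_map c ` B) z \<le> real k} \<in> sets borel"
      by measurable
    moreover have "S k = chart_map c ` B \<inter> cball 0 (real k) \<inter> {z. density_at c z * indicator (chart_map c ` B) z \<le> real k}"
      by (auto simp: S_def)
    ultimately show ?thesis using mB by auto
  qed
  have C: "C k \<in> sets borel" for k
    unfolding C_def using Simg(2)
    by (intro homeomorphism_image_borel[OF homeomorphism_symD[OF chart_homeomorphism[OF c]] open_dom[OF c] S])
  have "chart_map c ` chart_inv c ` S k = (\<lambda>z. z) ` S k" for k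
    unfolding image_image by (rule image_cong[OF refl]) (use Simg(2) chart_map_inv[OF c] in blast)
  then have mapC: "chart_map c ` C k = S k" "chart_map d ` C k = transition c d ` S k" for k
    unfolding C_def transition_def by (simp_all add: image_comp)
  have eq: "emeasure (chart_measure c) (C k) = emeasure (chart_measure d) (C k)" for k
  proof -
    let ?T = "transition c d" and ?T' = "\<lambda>z. frechet_derivative (transition c d) (at z)"
    \<comment> \<open>On \<open>S k\<close> the pulled back integrand is exactly the density in the
      chart \<open>c\<close>; measurability and finiteness of its integral are read off from
      there.\<close>
    have g: "\<bar>real_det (?T' z)\<bar> * density_at d (?T z) * indicator (S k) z = density_at c z * indicator (S k) z" for z
      using density_at_transition[OF c d, of z] Simg(3)[of k] by (auto simp: indicator_def)
    have mS: "(\<lambda>z. density_at c z * indicator (S k) z) \<in> borel_measurable borel"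
      using Simg(2) by (intro borel_measurable_density_at[OF c S])
    have inj: "inj_on ?T (S k)"
    proof (rule inj_onI)
      fix z w assume zw: "z \<in> S k" "w \<in> S k" "?T z = ?T w"
      have ov: "z \<in> overlap c d" "w \<in> overlap c d" "z \<in> chart_img c" "w \<in> chart_img c"
        using zw Simg[of k] by blast+
      have "chart_inv c z = chart_inv c w"
        using chart_inv_transition[OF c d ov(1)] chart_inv_transition[OF c d ov(2)] zw(3) by simp
      from arg_cong[OF this, of "chart_map c"] show "z = w"
        unfolding chart_map_inv[OF c ov(3)] chart_map_inv[OF c ov(4)] .
    qed
    have "(\<integral>\<^sup>+y. ennreal (density_at d y * indicator (?T ` S k) y) \<partial>lborel) =
      (\<integral>\<^sup>+z. ennreal (\<bar>real_det (?T' z)\<bar> * density_at d (?T z) * indicator (S k) z) \<partial>lborel)"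
    proof (rule nn_integral_change_of_variables[OF S _ inj])
      show "(?T has_derivative ?T' z) (at z)" if "z \<in> S k" for z
        using that Simg(3) by (intro transition_linear[OF c d]) auto
      show "0 \<le> density_at d (?T z)" if "z \<in> S k" for z
      proof -
        have "0 < density_at d (?T z)"
          using Simg(3) that by (intro density_at_pos[OF d transition_img[OF c d]]) blast
        then show ?thesis by simp
      qed
      show "(\<lambda>y. density_at d y * indicator (?T ` S k) y) \<in> borel_measurable borel"
        unfolding mapC(2)[symmetric] using CB(3)[of k]
        by (intro borel_measurable_density_at[OF d homeomorphism_image_borel[OF chart_homeomorphism[OF d] open_img[OF d] C]]) auto
      show "(\<lambda>z. \<bar>real_det (?T' z)\<bar> * density_at d (?T z) * indicator (S k) z) \<in> borel_measurable borel"
        unfolding g by (rule mS)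
      have "(\<integral>\<^sup>+z. ennreal (density_at c z * indicator (S k) z) \<partial>lborel) \<le>
        (\<integral>\<^sup>+z. ennreal (real k) * indicator (cball (0 :: complex^'n) (real k)) z \<partial>lborel)"
        by (intro nn_integral_mono) (auto simp: S_def indicator_def intro!: ennreal_leI)
      also have "\<dots> = ennreal (real k) * emeasure lborel (cball (0 :: complex^'n) (real k))"
        by (subst nn_integral_cmult_indicator) auto
      also have "\<dots> < \<infinity>"
        using emeasure_bounded_finite[OF bounded_cball, of "0 :: complex^'n" "real k"] by (simp add: ennreal_mult_less_top)
      finally show "(\<integral>\<^sup>+z. ennreal (\<bar>real_det (?T' z)\<bar> * density_at d (?T z) * indicator (S k) z) \<partial>lborel) < \<infinity>"
        unfolding g .
    qed
    then have "(\<integral>\<^sup>+y. ennreal (density_at d y) * indicator (chart_map d ` C k) y \<partial>lborel) =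
      (\<integral>\<^sup>+z. ennreal (density_at c z) * indicator (chart_map c ` C k) z \<partial>lborel)"
      unfolding g mapC ennreal_times_indicator .
    then show ?thesis
      using CB C by (simp add: emeasure_chart_measure c d)
  qed
  have "incseq C"
    unfolding C_def S_def by (rule monoI, rule image_mono) (auto intro: order_trans)
  moreover have "(\<Union>k. C k) = B"
  proof
    show "B \<subseteq> (\<Union>k. C k)"
    proof
      fix x assume x: "x \<in> B"
      obtain k :: nat where "max (norm (chart_map c x)) (density_at c (chart_map c x)) \<le> real k"
        using real_arch_simple by blast
      then have "chart_map c x \<in> S k" using x by (auto simp: S_def)
      moreover have "x = chart_inv c (chart_map c x)"
        using x B(2) chart_inv_map[OF c, of x] by auto
      ultimately have "x \<in> C k" unfolding C_def by (rule image_eqI[rotated])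
      then show "x \<in> (\<Union>k. C k)" by blast
    qed
  qed (use CB in blast)
  moreover have "range C \<subseteq> sets borel" using C by auto
  ultimately have "(\<lambda>k. emeasure (chart_measure e) (C k)) \<longlonglongrightarrow> emeasure (chart_measure e) B" for e
    using Lim_emeasure_incseq[of C "chart_measure e"] by simp
  from LIMSEQ_unique[OF this[of c]] this[of d] eq show ?thesis by simp
qed

text \<open>\<open>m\<close> measures every piece of the partition in a chart of its own. For a set
  inside the domain of \<open>d\<close>, compatibility allows all pieces to be measured in
  \<open>d\<close> instead, and there they add up to the prescribed value.\<close>

lemma volume_measure_for_exists: "\<exists>\<mu>. volume_measure_for g \<mu>"
proof -
  obtain N :: nat and c U where U: "\<And>k. k < N \<Longrightarrow> c k \<in> A" "\<And>k. k < N \<Longrightarrow> U k \<in> sets borel"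
    "\<And>k. k < N \<Longrightarrow> U k \<subseteq> chart_dom (c k)" "disjoint_family_on U {..<N}" "(\<Union>k<N. U k) = UNIV"
    by (rule finite_borel_partition) (rule that)
  define m where "m B = (\<Sum>k<N. emeasure (chart_measure (c k)) (B \<inter> U k))" for B
  define \<mu> where "\<mu> = measure_of UNIV (sets borel) m"
  have "positive (sets borel) m" by (simp add: positive_def m_def)
  moreover have "countably_additive (sets borel) m"
  proof (rule countably_additiveI)
    fix F :: "nat \<Rightarrow> 'm set"
    assume F: "range F \<subseteq> sets borel" "disjoint_family F"
    have "(\<Sum>i. m (F i)) = (\<Sum>k<N. \<Sum>i. emeasure (chart_measure (c k)) (F i \<inter> U k))"
      unfolding m_def by (rule suminf_sum) auto
    also have "\<dots> = (\<Sum>k<N. emeasure (chart_measure (c k)) (\<Union>i. F i \<inter> U k))"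
      using F U(2) by (intro sum.cong refl suminf_emeasure) (auto simp: disjoint_family_on_def)
    also have "\<dots> = m (\<Union>i. F i)"
      unfolding m_def by (intro sum.cong refl arg_cong2[where f = emeasure]) auto
    finally show "(\<Sum>i. m (F i)) = m (\<Union>i. F i)" .
  qed
  moreover have sb: "sigma_algebra UNIV (sets (borel :: 'm measure))"
    using sets.sigma_algebra_axioms[of "borel :: 'm measure"] by simp
  ultimately have em: "emeasure \<mu> B = m B" if "B \<in> sets borel" for B
    unfolding \<mu>_def using that by (intro emeasure_measure_of_sigma)
  have sets: "sets \<mu> = sets borel"
    unfolding \<mu>_def using sigma_algebra.sets_measure_of_eq[OF sb] by simp
  have "emeasure \<mu> B = (\<integral>\<^sup>+ z. ennreal (density_at d z) * indicator (chart_map d ` B) z \<partial>lborel)"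
    if d: "d \<in> A" and B: "B \<in> sets borel" "B \<subseteq> chart_dom d" for d B
  proof -
    have "emeasure \<mu> B = (\<Sum>k<N. emeasure (chart_measure d) (B \<inter> U k))"
      unfolding em[OF B(1)] m_def
      using U(1-3) B by (intro sum.cong refl chart_measure_compatible d) auto
    also have "\<dots> = emeasure (chart_measure d) (\<Union>k<N. B \<inter> U k)"
      using B U(2) by (intro sum_emeasure disjoint_family_on_Int U(4)) auto
    also have "(\<Union>k<N. B \<inter> U k) = B" using U(5) by auto
    finally show ?thesis using emeasure_chart_measure[OF d B] by simp
  qed
  then show ?thesis
    unfolding volume_measure_for_def using sets by blast
qed

abbreviation vol :: "'m measure" where "vol \<equiv> volume_measure A g"

lemma volume_measure_for_vol: "volume_measure_for g vol"
  using volume_measure_for_exists volume_measure_eqI by metis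

lemma sets_vol [simp, measurable_cong]: "sets vol = sets borel"
  using volume_measure_for_vol by (simp add: volume_measure_for_def)

lemma space_vol [simp]: "space vol = UNIV"
  using sets_eq_imp_space_eq[OF sets_vol] by simp

lemma emeasure_vol: "c \<in> A \<Longrightarrow> B \<in> sets borel \<Longrightarrow> B \<subseteq> chart_dom c \<Longrightarrow> emeasure vol B = emeasure (chart_measure c) B"
  using volume_measure_for_vol by (simp add: volume_measure_for_def emeasure_chart_measure)

text \<open>Stated for restricted measures, so that integrals of functions supported in the domain
  of \<open>c\<close> may be moved from \<open>vol\<close> to
  \<open>chart_measure c\<close>.\<close>

lemma density_vol_eq:
  assumes c: "c \<in> A"
  shows "density vol (indicator (chart_dom c)) = density (chart_measure c) (indicator (chart_dom c))"
proof (rule measure_eqI)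
  fix B assume "B \<in> sets (density vol (indicator (chart_dom c)))"
  then have B: "B \<in> sets borel" by simp
  have dom: "chart_dom c \<in> sets borel" using open_dom[OF c] by simp
  have "emeasure (density M (indicator (chart_dom c))) B = emeasure M (chart_dom c \<inter> B)" if "sets M = sets borel" for M
    using B dom that by (intro emeasure_restricted) auto
  then show "emeasure (density vol (indicator (chart_dom c))) B = emeasure (density (chart_measure c) (indicator (chart_dom c))) B"
    using emeasure_vol[OF c, of "chart_dom c \<inter> B"] B dom by simp
qed simp

end

section \<open>The Chern scalar curvature of a conformal metric\<close>

lemma matrix_inv_eqI:
  fixes B :: "complex^'n^'n::finite"
  assumes "B ** G = mat 1"
  shows "matrix_inv G = B"
proof -
  have "G ** B = mat 1" using assms by (simp add: matrix_left_right_inverse)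
  then have "G ** matrix_inv G = mat 1 \<and> matrix_inv G ** G = mat 1"
    unfolding matrix_inv_def using assms by (intro someI[of "\<lambda>C. G ** C = mat 1 \<and> C ** G = mat 1" B]) simp
  then have "matrix_inv G = (B ** G) ** matrix_inv G" using assms by simp
  also have "\<dots> = B" using \<open>G ** matrix_inv G = mat 1 \<and> _\<close> by (simp add: matrix_mul_assoc[symmetric])
  finally show ?thesis .
qed

lemma inv_metric_scaleR:
  fixes G :: "complex^'n^'n::finite"
  assumes G: "hermitian_pos G" and r: "r \<noteq> 0"
  shows "inv_metric (r *\<^sub>R G) i j = inv_metric G i j / of_real r"
proof -
  have "((1 / r) *\<^sub>R matrix_inv G) ** (r *\<^sub>R G) = mat 1"
  proof -
    have "(((1 / r) *\<^sub>R matrix_inv G) ** (r *\<^sub>R G)) $ a $ b = mat 1 $ a $ b" for a b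
    proof -
      have "(((1 / r) *\<^sub>R matrix_inv G) ** (r *\<^sub>R G)) $ a $ b = (\<Sum>k\<in>UNIV. matrix_inv G $ a $ k * G $ k $ b)"
        using r by (simp add: matrix_matrix_mult_def)
      also have "\<dots> = mat 1 $ a $ b"
        using inv_metric_left[OF G, of a b] by (simp add: inv_metric_def mat_def)
      finally show ?thesis .
    qed
    then show ?thesis by (simp add: vec_eq_iff)
  qed
  from matrix_inv_eqI[OF this] show ?thesis
    by (simp add: inv_metric_def scaleR_conv_of_real[where 'a = complex])
qed

section \<open>Conformal change of connection, curvature and scalar curvature in coordinates\<close>

definition complex_laplacian :: "complex^'n^'n \<Rightarrow> (complex^'n \<Rightarrow> complex) \<Rightarrow> complex^'n::finite \<Rightarrow> complex" where
  "complex_laplacian G v z = (\<Sum>i\<in>UNIV. \<Sum>j\<in>UNIV. inv_metric G i j * del_zbar j (del_z i v) z)"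

lemma has_derivative_exp_compose:
  fixes v :: "'a::real_normed_vector \<Rightarrow> complex"
  assumes "v differentiable (at z)"
  shows "((\<lambda>w. exp (v w)) has_derivative (\<lambda>h. exp (v z) * frechet_derivative v (at z) h)) (at z)"
  using assms has_field_derivative_imp_has_derivative[OF DERIV_exp]
  by (intro has_derivative_compose[where f = v and g = exp]) (simp_all add: frechet_derivative_works[symmetric])

lemma del_z_exp:
  assumes "v differentiable (at z)"
  shows "del_z i (\<lambda>w. exp (v w)) z = exp (v z) * del_z i v z"
  unfolding del_z_eq_wirtinger
  by (simp only: wirtinger_has_derivative[OF has_derivative_exp_compose[OF assms]])
    (simp add: wirtinger_def algebra_simps)

context
  fixes U :: "(complex^'n::finite) set" and H :: "complex^'n \<Rightarrow> complex^'n^'n" and u :: "complex^'n \<Rightarrow> real"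
  assumes U: "open U"
    and H: "\<And>w. w \<in> U \<Longrightarrow> hermitian_pos (H w)"
    and dH: "\<And>i j. times_differentiable_on 2 U (\<lambda>w. H w $ i $ j)"
    and dinv: "\<And>i j. times_differentiable_on 1 U (\<lambda>w. inv_metric (H w) i j)"
    and du: "times_differentiable_on 2 U (\<lambda>w. complex_of_real (u w))"
begin

abbreviation (input) conformal_local :: "complex^'n \<Rightarrow> complex^'n^'n" where
  "conformal_local \<equiv> \<lambda>w. exp (u w) *\<^sub>R H w"

abbreviation (input) cu :: "complex^'n \<Rightarrow> complex" where
  "cu \<equiv> \<lambda>w. complex_of_real (u w)"

text \<open>The factor \<open>exp u\<close> cancels against the inverse metric; where the derivative
  hits it, the inverse metric contracts with the metric to a Kronecker delta.\<close>

lemma chern_connection_conformal: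
  assumes w: "w \<in> U"
  shows "chern_connection conformal_local i k p w = chern_connection H i k p w + (if p = k then 1 else 0) * del_z i cu w"
proof -
  have d: "cu differentiable (at w)" "(\<lambda>w. H w $ k $ q) differentiable (at w)" "(\<lambda>w. exp (cu w)) differentiable (at w)" for q
  proof -
    show 1: "cu differentiable (at w)" "(\<lambda>w. H w $ k $ q) differentiable (at w)"
      using times_differentiable_onD[OF du _ w] times_differentiable_onD[OF dH _ w] by auto
    show "(\<lambda>w. exp (cu w)) differentiable (at w)"
      using has_derivative_exp_compose[OF 1(1)] unfolding differentiable_def by blast
  qed
  have "inv_metric (conformal_local w) p q * del_z i (\<lambda>w. conformal_local w $ k $ q) w =
    inv_metric (H w) p q * del_z i (\<lambda>w. H w $ k $ q) w + inv_metric (H w) p q * H w $ k $ q * del_z i cu w" for q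
  proof -
    have "del_z i (\<lambda>w. conformal_local w $ k $ q) w = del_z i (\<lambda>w. exp (cu w) * H w $ k $ q) w"
      by (simp add: scaleR_conv_of_real[where 'a = complex] exp_of_real)
    also have "\<dots> = exp (cu w) * del_z i (\<lambda>w. H w $ k $ q) w + exp (cu w) * del_z i cu w * H w $ k $ q"
      using wirtinger_mult[OF d(3) d(2)] del_z_exp[OF d(1)] unfolding del_z_eq_wirtinger by simp
    finally have D: "del_z i (\<lambda>w. conformal_local w $ k $ q) w =
        exp (cu w) * del_z i (\<lambda>w. H w $ k $ q) w + exp (cu w) * del_z i cu w * H w $ k $ q" .
    have I: "inv_metric (conformal_local w) p q = inv_metric (H w) p q / exp (cu w)"
      using inv_metric_scaleR[OF H[OF w], of "exp (u w)" p q] by (simp add: exp_of_real)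
    have "a / E * (E * x + E * y * h) = a * x + a * h * y" if "E \<noteq> 0" for a E x y h :: complex
      using that by (simp add: field_simps)
    then show ?thesis unfolding D I by simp
  qed
  then have "chern_connection conformal_local i k p w = chern_connection H i k p w +
      (\<Sum>q\<in>UNIV. inv_metric (H w) p q * H w $ k $ q) * del_z i cu w"
    by (simp add: chern_connection_def sum.distrib sum_distrib_right)
  then show ?thesis by (simp add: inv_metric_right[OF H[OF w]])
qed

text \<open>Only the added term \<open>del_z i cu\<close> of the symbols with \<open>p = k\<close>
  produces something new under \<open>del_zbar j\<close>; the factor in front comes from lowering
  the index with the conformal metric.\<close>

lemma chern_curvature_conformal:
  assumes z: "z \<in> U"
  shows "chern_curvature conformal_local i j k l z =
    of_real (exp (u z)) * (chern_curvature H i j k l z - H z $ k $ l * del_zbar j (del_z i cu) z)"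
proof -
  have dcu: "del_z i cu differentiable (at z)"
    using times_differentiable_onD[OF times_differentiable_on_wirtinger[OF U, of 1 cu]] du z
    unfolding del_z_eq_wirtinger by (auto simp: numeral_2_eq_2)
  have tdc: "times_differentiable_on 1 U (chern_connection H i k p)" for p
  proof -
    have "times_differentiable_on 1 U (\<lambda>w. \<Sum>q\<in>UNIV. inv_metric (H w) p q * wirtinger (- \<i>) i (\<lambda>w. H w $ k $ q) w)"
      by (intro times_differentiable_on_sum times_differentiable_on_mult U dinv times_differentiable_on_wirtinger)
        (use dH in \<open>simp only: Suc_1 One_nat_def numeral_2_eq_2\<close>)
    then show ?thesis by (simp add: chern_connection_def[abs_def] del_z_eq_wirtinger)
  qed
  have dc: "chern_connection H i k p differentiable (at z)" for p
    using times_differentiable_onD[OF tdc _ z] by simp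
  have "del_zbar j (chern_connection conformal_local i k p) z =
    del_zbar j (chern_connection H i k p) z + (if p = k then 1 else 0) * del_zbar j (del_z i cu) z" for p
  proof -
    have "del_zbar j (chern_connection conformal_local i k p) z =
      del_zbar j (\<lambda>w. chern_connection H i k p w + (if p = k then 1 else 0) * del_z i cu w) z"
      unfolding del_zbar_eq_wirtinger by (rule wirtinger_cong[OF U z chern_connection_conformal])
    also have "\<dots> = del_zbar j (chern_connection H i k p) z + (if p = k then 1 else 0) * del_zbar j (del_z i cu) z"
      unfolding del_zbar_eq_wirtinger
      by (subst wirtinger_add) (use dc dcu in \<open>auto simp: wirtinger_cmult\<close>)
    finally show ?thesis .
  qed
  then have "chern_curvature conformal_local i j k l z = (\<Sum>p\<in>UNIV. of_real (exp (u z)) *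
      (H z $ p $ l * - del_zbar j (chern_connection H i k p) z - (if p = k then H z $ p $ l * del_zbar j (del_z i cu) z else 0)))"
    unfolding chern_curvature_def
    by (intro sum.cong) (auto simp: scaleR_conv_of_real[where 'a = complex] algebra_simps)
  then show ?thesis
    by (simp add: sum_distrib_left[symmetric] sum_subtractf chern_curvature_def)
qed

text \<open>The two inverse metrics contribute \<open>exp (- 2 * u)\<close> and the curvature
  \<open>exp u\<close>. The trace of the metric over \<open>k\<close> and \<open>l\<close> is the
  dimension, which is the origin of the factor \<open>CARD('n)\<close>.\<close>

lemma local_chern_scalar_conformal:
  assumes z: "z \<in> U"
  shows "local_chern_scalar conformal_local z =
    of_real (exp (- u z)) * (local_chern_scalar H z - of_nat CARD('n) * complex_laplacian (H z) cu z)"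
proof -
  let ?I = "inv_metric (H z)" and ?E = "complex_of_real (exp (u z))"
  have "?E \<noteq> 0" by simp
  have I: "inv_metric (conformal_local z) i j = ?I i j / ?E" for i j
    using inv_metric_scaleR[OF H[OF z], of "exp (u z)"] by simp
  have tr: "(\<Sum>k\<in>UNIV. \<Sum>l\<in>UNIV. ?I k l * H z $ k $ l) = of_nat CARD('n)"
    by (simp add: inv_metric_right[OF H[OF z]])
  have "local_chern_scalar conformal_local z = (\<Sum>i\<in>UNIV. \<Sum>j\<in>UNIV. \<Sum>k\<in>UNIV. \<Sum>l\<in>UNIV.
      inverse ?E * (?I i j * ?I k l * chern_curvature H i j k l z - (?I i j * del_zbar j (del_z i cu) z) * (?I k l * H z $ k $ l)))"
    unfolding local_chern_scalar_def I chern_curvature_conformal[OF z]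
    by (intro sum.cong refl) (simp add: field_simps)
  also have "\<dots> = inverse ?E * (local_chern_scalar H z -
      (\<Sum>i\<in>UNIV. \<Sum>j\<in>UNIV. (?I i j * del_zbar j (del_z i cu) z) * (\<Sum>k\<in>UNIV. \<Sum>l\<in>UNIV. ?I k l * H z $ k $ l)))"
    by (simp only: local_chern_scalar_def sum_distrib_left[symmetric] sum_subtractf)
  also have "\<dots> = inverse ?E * (local_chern_scalar H z - of_nat CARD('n) * complex_laplacian (H z) cu z)"
    unfolding tr complex_laplacian_def by (simp add: sum_distrib_left mult_ac)
  finally show ?thesis by (simp add: exp_minus)
qed

end

section \<open>The Laplacian as a function on the manifold\<close>

lemma sum_smult_axis: "(\<Sum>j\<in>UNIV. axis i c $ j * x j) = c * (x i :: complex)"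
  by (simp add: axis_def if_distrib[of "\<lambda>y. y * _"] cong: if_cong)

text \<open>In matrices, \<open>G\<close> is the product of the transpose of \<open>J\<close>, of
  \<open>N\<close> and of the conjugate of \<open>J\<close>. Since one-sided inverses of square
  matrices are two-sided, the outer factors of \<open>G ** matrix_inv G = mat 1\<close> can be moved
  around cyclically until \<open>N\<close> stands alone; invertibility of \<open>J\<close> and
  \<open>N\<close> is never assumed but results from that of \<open>G\<close>.\<close>

lemma inv_metric_pullback:
  fixes G N J :: "complex^'n^'n::finite"
  assumes G: "hermitian_pos G"
    and GN: "\<And>i j. G $ i $ j = (\<Sum>a\<in>UNIV. \<Sum>b\<in>UNIV. N $ a $ b * J $ a $ i * cnj (J $ b $ j))"
  shows "inv_metric N a b = (\<Sum>i\<in>UNIV. \<Sum>j\<in>UNIV. inv_metric G i j * J $ a $ i * cnj (J $ b $ j))"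
proof -
  let ?K = "(\<chi> b j. cnj (J $ b $ j)) :: complex^'n^'n"
  let ?Jt = "Finite_Cartesian_Product.transpose J"
  have "G = ?Jt ** N ** ?K"
    unfolding vec_eq_iff
  proof (intro allI)
    fix i j
    have "(?Jt ** N ** ?K) $ i $ j = (\<Sum>b\<in>UNIV. \<Sum>a\<in>UNIV. N $ a $ b * J $ a $ i * cnj (J $ b $ j))"
      by (simp add: matrix_matrix_mult_def Finite_Cartesian_Product.transpose_def sum_distrib_left sum_distrib_right mult_ac)
    also have "\<dots> = G $ i $ j" unfolding GN by (rule sum.swap)
    finally show "G $ i $ j = (?Jt ** N ** ?K) $ i $ j" ..
  qed
  moreover have "G ** matrix_inv G = mat 1"
  proof -
    have "(matrix_inv G ** G) $ a $ b = mat 1 $ a $ b" for a b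
      using inv_metric_left[OF G, of a b] by (simp add: matrix_matrix_mult_def inv_metric_def mat_def)
    then have "matrix_inv G ** G = mat 1" by (simp add: vec_eq_iff)
    then show ?thesis by (simp add: matrix_left_right_inverse)
  qed
  ultimately have "?Jt ** (N ** ?K ** matrix_inv G) = mat 1"
    by (simp add: matrix_mul_assoc)
  then have "(N ** ?K ** matrix_inv G) ** ?Jt = mat 1"
    by (simp add: matrix_left_right_inverse)
  then have "N ** (?K ** matrix_inv G ** ?Jt) = mat 1"
    by (simp add: matrix_mul_assoc)
  then have "(?K ** matrix_inv G ** ?Jt) ** N = mat 1"
    by (simp add: matrix_left_right_inverse)
  from matrix_inv_eqI[OF this] have "inv_metric N a b = (?K ** matrix_inv G ** ?Jt) $ b $ a"
    by (simp add: inv_metric_def)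
  also have "\<dots> = (\<Sum>i\<in>UNIV. \<Sum>j\<in>UNIV. inv_metric G i j * J $ a $ i * cnj (J $ b $ j))"
    by (simp add: matrix_matrix_mult_def Finite_Cartesian_Product.transpose_def sum_distrib_left sum_distrib_right inv_metric_def mult_ac)
  finally show ?thesis .
qed

context hermitian_manifold
begin

text \<open>The regularity at which the Laplacian is still continuous. The class contains the test
  functions and the cut-offs \<open>bump\<close>, and it is closed under the operations used to
  localise.\<close>

definition C2 :: "('m \<Rightarrow> real) \<Rightarrow> bool" where
  "C2 f \<longleftrightarrow> (\<forall>c\<in>A. times_differentiable_on 2 (chart_img c) (\<lambda>z. complex_of_real (f (chart_inv c z))))"

lemma C2_if_smooth_function:
  assumes "smooth_function A f"
  shows "C2 f"
  unfolding C2_def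
proof
  fix c assume c: "c \<in> A"
  then have "times_differentiable_on 2 (chart_img c) (f \<circ> chart_inv c)"
    using assms by (simp add: smooth_function_def smooth_on_def)
  from times_differentiable_on_bounded_linear[OF open_img[OF c] bounded_linear_of_real this]
  show "times_differentiable_on 2 (chart_img c) (\<lambda>z. complex_of_real (f (chart_inv c z)))" by simp
qed

definition laplacian_in :: "('m, 'n) chart \<Rightarrow> ('m \<Rightarrow> real) \<Rightarrow> complex^'n \<Rightarrow> complex" where
  "laplacian_in c f z = complex_laplacian (local_metric g c z) (\<lambda>w. complex_of_real (f (chart_inv c w))) z"

text \<open>The Hessian in the chart \<open>c\<close> carries one Jacobian and one conjugate
  Jacobian; summed against the inverse metric of \<open>c\<close>, these produce the inverse metric
  of \<open>d\<close> by \<open>inv_metric_pullback\<close>. The rest is exchange of finite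
  sums.\<close>

lemma laplacian_in_transition:
  assumes c: "c \<in> A" and d: "d \<in> A" and z: "z \<in> overlap c d" and f: "C2 f"
  shows "laplacian_in c f z = laplacian_in d f (transition c d z)"
proof -
  let ?T = "transition c d" and ?O = "overlap c d"
  let ?h = "\<lambda>w. complex_of_real (f (chart_inv d w))"
  let ?J = "\<lambda>a i. del_z i (\<lambda>w. ?T w $ a) z"
  note O = open_overlap[OF c d] and T = transition_holomorphic[OF c d]
  have zc: "z \<in> chart_img c" using z by auto
  have h: "times_differentiable_on 2 (chart_img d) ?h" using f d by (simp add: C2_def)
  have TO: "?T ` ?O \<subseteq> chart_img d" using transition_img[OF c d] by blast
  have D: "del_zbar j (del_z i (\<lambda>w. complex_of_real (f (chart_inv c w)))) z =
    (\<Sum>a\<in>UNIV. \<Sum>b\<in>UNIV. del_zbar b (del_z a ?h) (?T z) * ?J a i * cnj (?J b j))" for i j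
  proof -
    have "del_z i (\<lambda>w. complex_of_real (f (chart_inv c w))) w = del_z i (\<lambda>w. ?h (?T w)) w" if "w \<in> ?O" for w
      unfolding del_z_eq_wirtinger
      by (rule wirtinger_cong[OF O that]) (simp add: chart_inv_transition[OF c d])
    then have "del_zbar j (del_z i (\<lambda>w. complex_of_real (f (chart_inv c w)))) z = del_zbar j (del_z i (\<lambda>w. ?h (?T w))) z"
      unfolding del_zbar_eq_wirtinger by (rule wirtinger_cong[OF O z])
    then show ?thesis
      using del_zbar_del_z_compose[OF O open_img[OF d] T TO h z] by simp
  qed
  have "local_metric g c z $ i $ j = (\<Sum>a\<in>UNIV. \<Sum>b\<in>UNIV. local_metric g d (?T z) $ a $ b * ?J a i * cnj (?J b j))" for i j
  proof -
    have "local_metric g c z $ i $ j = sesq (local_metric g c z) (axis i 1) (axis j 1)"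
    proof -
      have "sesq (local_metric g c z) (axis i 1) (axis j 1) =
        (\<Sum>a\<in>UNIV. axis i 1 $ a * (\<Sum>b\<in>UNIV. axis j 1 $ b * local_metric g c z $ a $ b))"
        unfolding sesq_def sum_distrib_left by (intro sum.cong refl) (simp add: axis_def)
      then show ?thesis by (simp only: sum_smult_axis mult_1)
    qed
    also have "\<dots> = sesq (local_metric g d (?T z)) (frechet_derivative ?T (at z) (axis i 1)) (frechet_derivative ?T (at z) (axis j 1))"
      by (rule sesq_transition[OF c d z])
    also have "\<dots> = (\<Sum>a\<in>UNIV. \<Sum>b\<in>UNIV. local_metric g d (?T z) $ a $ b * ?J a i * cnj (?J b j))"
      by (simp only: sesq_def holomorphic_map_frechet_derivative[OF O T z] sum_smult_axis mult_1)
    finally show ?thesis .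
  qed
  then have inv: "inv_metric (local_metric g d (?T z)) a b =
      (\<Sum>i\<in>UNIV. \<Sum>j\<in>UNIV. inv_metric (local_metric g c z) i j * ?J a i * cnj (?J b j))" for a b
    using inv_metric_pullback[OF hermitian_pos_local[OF c zc], of "local_metric g d (?T z)" "\<chi> a i. ?J a i" a b] by simp
  let ?I = "inv_metric (local_metric g c z)" and ?L = "\<lambda>a b. del_zbar b (del_z a ?h) (?T z)"
  have "laplacian_in c f z = (\<Sum>i\<in>UNIV. \<Sum>j\<in>UNIV. \<Sum>a\<in>UNIV. \<Sum>b\<in>UNIV. ?I i j * (?L a b * ?J a i * cnj (?J b j)))"
    unfolding laplacian_in_def complex_laplacian_def D by (simp only: sum_distrib_left)
  also have "\<dots> = (\<Sum>i\<in>UNIV. \<Sum>a\<in>UNIV. \<Sum>j\<in>UNIV. \<Sum>b\<in>UNIV. ?I i j * (?L a b * ?J a i * cnj (?J b j)))"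
    by (rule sum.cong[OF refl], rule sum.swap)
  also have "\<dots> = (\<Sum>a\<in>UNIV. \<Sum>i\<in>UNIV. \<Sum>j\<in>UNIV. \<Sum>b\<in>UNIV. ?I i j * (?L a b * ?J a i * cnj (?J b j)))"
    by (rule sum.swap)
  also have "\<dots> = (\<Sum>a\<in>UNIV. \<Sum>i\<in>UNIV. \<Sum>b\<in>UNIV. \<Sum>j\<in>UNIV. ?I i j * (?L a b * ?J a i * cnj (?J b j)))"
    by (rule sum.cong[OF refl], rule sum.cong[OF refl], rule sum.swap)
  also have "\<dots> = (\<Sum>a\<in>UNIV. \<Sum>b\<in>UNIV. \<Sum>i\<in>UNIV. \<Sum>j\<in>UNIV. ?I i j * (?L a b * ?J a i * cnj (?J b j)))"
    by (rule sum.cong[OF refl], rule sum.swap)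
  also have "\<dots> = (\<Sum>a\<in>UNIV. \<Sum>b\<in>UNIV. inv_metric (local_metric g d (?T z)) a b * ?L a b)"
    unfolding inv sum_distrib_right by (intro sum.cong refl) (simp only: mult_ac)
  also have "\<dots> = laplacian_in d f (?T z)"
    by (simp add: laplacian_in_def complex_laplacian_def)
  finally show ?thesis .
qed

text \<open>The chart is chosen exactly as in \<open>chern_scalar\<close>, so that both can be
  evaluated in the same coordinates.\<close>

definition laplacian :: "('m \<Rightarrow> real) \<Rightarrow> 'm \<Rightarrow> real" where
  "laplacian f x = (let c = (SOME c. c \<in> A \<and> x \<in> chart_dom c) in Re (laplacian_in c f (chart_map c x)))"

lemma some_chart:
  "(SOME c. c \<in> A \<and> x \<in> chart_dom c) \<in> A \<and> x \<in> chart_dom (SOME c. c \<in> A \<and> x \<in> chart_dom c)"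
  using someI_ex[of "\<lambda>c. c \<in> A \<and> x \<in> chart_dom c"] chart_exists[of x] by blast

lemma laplacian_eq:
  assumes "c \<in> A" "x \<in> chart_dom c" "C2 f"
  shows "laplacian f x = Re (laplacian_in c f (chart_map c x))"
proof -
  define d where "d = (SOME c. c \<in> A \<and> x \<in> chart_dom c)"
  have d: "d \<in> A" "x \<in> chart_dom d" using some_chart unfolding d_def by auto
  have "transition d c (chart_map d x) = chart_map c x"
    by (simp add: transition_def chart_inv_map[OF d])
  then show ?thesis
    using laplacian_in_transition[OF d(1) assms(1) _ assms(3), of "chart_map d x"] d assms(2)
    unfolding laplacian_def d_def[symmetric] Let_def by auto
qed

lemma continuous_laplacian_in:
  assumes c: "c \<in> A" and f: "C2 f"
  shows "continuous_on (chart_img c) (laplacian_in c f)"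
proof -
  have "times_differentiable_on 0 (chart_img c) (\<lambda>z. laplacian_in c f z)"
    unfolding laplacian_in_def complex_laplacian_def del_z_eq_wirtinger del_zbar_eq_wirtinger
    by (intro times_differentiable_on_sum times_differentiable_on_mult open_img[OF c] smooth_inv_metric[OF c]
        times_differentiable_on_wirtinger)
      (use f c in \<open>simp only: C2_def numeral_2_eq_2 One_nat_def\<close>)
  then show ?thesis by simp
qed

lemma continuous_if_charts:
  fixes F :: "'m \<Rightarrow> 'b::topological_space"
  assumes "\<And>c. c \<in> A \<Longrightarrow> continuous_on (chart_dom c) F"
  shows "continuous_on UNIV F"
proof -
  have "continuous_on (\<Union>(chart_dom ` A)) F"
    using assms open_dom by (intro continuous_on_open_Union) auto
  moreover have "\<Union>(chart_dom ` A) = UNIV" using chart_exists by auto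
  ultimately show ?thesis by simp
qed

lemma continuous_laplacian:
  assumes f: "C2 f"
  shows "continuous_on UNIV (laplacian f)"
proof (rule continuous_if_charts)
  fix c assume c: "c \<in> A"
  have "continuous_on (chart_dom c) (\<lambda>x. Re (laplacian_in c f (chart_map c x)))"
    by (intro continuous_intros continuous_on_compose2[OF continuous_laplacian_in[OF c f]] continuous_chart_map[OF c]) auto
  then show "continuous_on (chart_dom c) (laplacian f)"
    by (rule continuous_on_cong[THEN iffD1, rotated -1]) (auto simp: laplacian_eq[OF c _ f])
qed

lemma continuous_C2:
  assumes f: "C2 f"
  shows "continuous_on UNIV f"
proof (rule continuous_if_charts)
  fix c assume c: "c \<in> A"
  have "continuous_on (chart_img c) (\<lambda>z. Re (complex_of_real (f (chart_inv c z))))"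
    using f c times_differentiable_on_imp_continuous_on unfolding C2_def by (intro continuous_on_Re) blast
  then have "continuous_on (chart_dom c) (\<lambda>x. f (chart_inv c (chart_map c x)))"
    using continuous_on_compose2[OF _ continuous_chart_map[OF c], of "chart_img c" "\<lambda>z. f (chart_inv c z)"] by simp
  then show "continuous_on (chart_dom c) f"
    by (rule continuous_on_cong[THEN iffD1, rotated -1]) (auto simp: chart_inv_map[OF c])
qed

text \<open>The chart picked at \<open>x\<close> depends on \<open>A\<close> and \<open>x\<close>
  only, hence is the same for both metrics, and the local formula applies in it with
  \<open>u = t * f\<close>.\<close>

lemma chern_scalar_conformal:
  assumes f: "C2 f"
  shows "chern_scalar A (conformal (\<lambda>x. t * f x) g) x =
    exp (- (t * f x)) * (chern_scalar A g x - real CARD('n) * t * laplacian f x)"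
proof -
  define c where "c = (SOME c. c \<in> A \<and> x \<in> chart_dom c)"
  have c: "c \<in> A" "x \<in> chart_dom c" using some_chart unfolding c_def by auto
  let ?z = "chart_map c x" and ?v = "\<lambda>w. complex_of_real (f (chart_inv c w))"
  have z: "?z \<in> chart_img c" using c by auto
  have td: "times_differentiable_on 2 (chart_img c) ?v" using f c by (simp add: C2_def)
  have m1: "local_metric (conformal (\<lambda>x. t * f x) g) c = (\<lambda>w. exp (t * f (chart_inv c w)) *\<^sub>R local_metric g c w)"
    by (simp add: local_metric_def conformal_def fun_eq_iff)
  have m2: "local_chern_scalar (\<lambda>w. exp (t * f (chart_inv c w)) *\<^sub>R local_metric g c w) ?z =
    of_real (exp (- (t * f (chart_inv c ?z)))) * (local_chern_scalar (local_metric g c) ?z -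
      of_nat CARD('n) * complex_laplacian (local_metric g c ?z) (\<lambda>w. complex_of_real (t * f (chart_inv c w))) ?z)"
  proof (rule local_chern_scalar_conformal[OF open_img[OF c(1)] _ _ _ _ z])
    show "times_differentiable_on 2 (chart_img c) (\<lambda>w. complex_of_real (t * f (chart_inv c w)))"
      unfolding of_real_mult by (intro times_differentiable_on_mult times_differentiable_on_const open_img[OF c(1)] td)
  qed (rule hermitian_pos_local[OF c(1)] smooth_local_metric[OF c(1)] smooth_inv_metric[OF c(1)], assumption?)+
  have m3: "complex_laplacian (local_metric g c ?z) (\<lambda>w. complex_of_real (t * f (chart_inv c w))) ?z = of_real t * laplacian_in c f ?z"
  proof -
    have d1: "?v differentiable (at w)" if "w \<in> chart_img c" for w
      using times_differentiable_onD[OF td _ that] by simp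
    have d2: "del_z i ?v differentiable (at ?z)" for i
    proof -
      have "times_differentiable_on 1 (chart_img c) (wirtinger (- \<i>) i ?v)"
        by (rule times_differentiable_on_wirtinger[OF open_img[OF c(1)]]) (use td in \<open>simp only: numeral_2_eq_2 One_nat_def\<close>)
      from times_differentiable_onD[OF this _ z] show ?thesis by (simp add: del_z_eq_wirtinger)
    qed
    have "del_zbar j (del_z i (\<lambda>w. complex_of_real (t * f (chart_inv c w)))) ?z = of_real t * del_zbar j (del_z i ?v) ?z" for i j
    proof -
      have "del_zbar j (del_z i (\<lambda>w. complex_of_real (t * f (chart_inv c w)))) ?z = del_zbar j (\<lambda>w. of_real t * del_z i ?v w) ?z"
        unfolding del_zbar_eq_wirtinger of_real_mult
        by (rule wirtinger_cong[OF open_img[OF c(1)] z]) (simp add: del_z_eq_wirtinger wirtinger_cmult d1)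
      then show ?thesis
        using d2 by (simp add: del_zbar_eq_wirtinger wirtinger_cmult)
    qed
    then show ?thesis
      by (simp add: laplacian_in_def complex_laplacian_def sum_distrib_left mult_ac)
  qed
  have "chern_scalar A (conformal (\<lambda>x. t * f x) g) x =
    Re (of_real (exp (- (t * f x))) * (local_chern_scalar (local_metric g c) ?z - of_real (real CARD('n) * t) * laplacian_in c f ?z))"
    unfolding chern_scalar_def c_def[symmetric] Let_def m1 m2 m3 chart_inv_map[OF c] by (simp add: mult.assoc)
  moreover have "Re (local_chern_scalar (local_metric g c) ?z) = chern_scalar A g x"
    unfolding chern_scalar_def c_def[symmetric] Let_def ..
  ultimately show ?thesis
    by (simp add: laplacian_eq[OF c f] del: of_real_mult)
qed

end

section \<open>The integral of the Laplacian\<close>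

lemma wedge_1_alternation:
  assumes "\<And>u u'. u 0 = u' 0 \<Longrightarrow> \<alpha> u = \<alpha> u'"
  shows "wedge 1 k \<alpha> (alternation k T) v = alternation (1 + k) (\<lambda>u. \<alpha> u * T (\<lambda>i. u (1 + i))) v"
  unfolding wedge_eq_alternation by (subst alternation_absorb) (auto intro: assms)

lemma wirtinger_alternation:
  assumes "\<And>u. (\<lambda>w. T w u) differentiable (at z)"
  shows "wirtinger s i (\<lambda>w. alternation k (T w) v) z = alternation k (\<lambda>u. wirtinger s i (\<lambda>w. T w u) z) v"
  unfolding alternation_def using assms by (subst wirtinger_sum) (auto simp: wirtinger_cmult)

text \<open>The derivative acts on coefficients and so passes through the alternation to
  \<open>T\<close>. The covector \<open>dz i\<close> occupies a new slot \<open>0\<close>, the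
  arguments of \<open>T\<close> move up by one, and by absorption no numerical factor
  appears.\<close>

lemma del_form_alternation:
  assumes "open U" "z \<in> U" "\<And>w u. w \<in> U \<Longrightarrow> \<alpha> w u = alternation k (T w) u"
    and "\<And>u. (\<lambda>w. T w u) differentiable (at z)"
  shows "del_form k \<alpha> z v = alternation (1 + k) (\<lambda>u. \<Sum>i\<in>UNIV. u 0 $ i * del_z i (\<lambda>w. T w (\<lambda>l. u (1 + l))) z) v"
proof -
  have "(\<lambda>u. del_z i (\<lambda>w. \<alpha> w u) z) = alternation k (\<lambda>u. del_z i (\<lambda>w. T w u) z)" for i
  proof
    fix u
    have "del_z i (\<lambda>w. \<alpha> w u) z = del_z i (\<lambda>w. alternation k (T w) u) z"
      unfolding del_z_eq_wirtinger by (rule wirtinger_cong[OF assms(1,2)], rule assms(3))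
    then show "del_z i (\<lambda>w. \<alpha> w u) z = alternation k (\<lambda>u. del_z i (\<lambda>w. T w u) z) u"
      unfolding del_z_eq_wirtinger using wirtinger_alternation[OF assms(4)] by simp
  qed
  then have "del_form k \<alpha> z v = (\<Sum>i\<in>UNIV. wedge 1 k (dz i) (alternation k (\<lambda>u. del_z i (\<lambda>w. T w u) z)) v)"
    by (simp add: del_form_def)
  also have "\<dots> = (\<Sum>i\<in>UNIV. alternation (1 + k) (\<lambda>u. dz i u * del_z i (\<lambda>w. T w (\<lambda>l. u (1 + l))) z) v)"
    by (intro sum.cong refl wedge_1_alternation) (simp add: dz_def)
  finally show ?thesis by (simp only: alternation_sum dz_def)
qed

lemma delbar_form_alternation:
  assumes "open U" "z \<in> U" "\<And>w u. w \<in> U \<Longrightarrow> \<alpha> w u = alternation k (T w) u"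
    and "\<And>u. (\<lambda>w. T w u) differentiable (at z)"
  shows "delbar_form k \<alpha> z v = alternation (1 + k) (\<lambda>u. \<Sum>i\<in>UNIV. cnj (u 0 $ i) * del_zbar i (\<lambda>w. T w (\<lambda>l. u (1 + l))) z) v"
proof -
  have "(\<lambda>u. del_zbar i (\<lambda>w. \<alpha> w u) z) = alternation k (\<lambda>u. del_zbar i (\<lambda>w. T w u) z)" for i
  proof
    fix u
    have "del_zbar i (\<lambda>w. \<alpha> w u) z = del_zbar i (\<lambda>w. alternation k (T w) u) z"
      unfolding del_zbar_eq_wirtinger by (rule wirtinger_cong[OF assms(1,2)], rule assms(3))
    then show "del_zbar i (\<lambda>w. \<alpha> w u) z = alternation k (\<lambda>u. del_zbar i (\<lambda>w. T w u) z) u"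
      unfolding del_zbar_eq_wirtinger using wirtinger_alternation[OF assms(4)] by simp
  qed
  then have "delbar_form k \<alpha> z v = (\<Sum>i\<in>UNIV. wedge 1 k (dzbar i) (alternation k (\<lambda>u. del_zbar i (\<lambda>w. T w u) z)) v)"
    by (simp add: delbar_form_def)
  also have "\<dots> = (\<Sum>i\<in>UNIV. alternation (1 + k) (\<lambda>u. dzbar i u * del_zbar i (\<lambda>w. T w (\<lambda>l. u (1 + l))) z) v)"
    by (intro sum.cong refl wedge_1_alternation) (simp add: dzbar_def)
  finally show ?thesis by (simp only: alternation_sum dzbar_def)
qed

context hermitian_manifold
begin

text \<open>On \<open>real_frame\<close>, the form of the Gauduchon condition becomes a single
  alternation with \<open>dz i\<close> in slot \<open>0\<close>, \<open>dzbar j\<close> in slot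
  \<open>1\<close> and the differentiated power of the two-form in the other slots. The first two
  factors are constant in the coordinates, so the derivatives can be taken outside, and what they
  then act on is \<open>cofactor\<close>.\<close>

lemma gauduchon_cofactor:
  assumes gau: "gauduchon A g" and c: "c \<in> A" and z: "z \<in> chart_img c"
  shows "(\<Sum>i\<in>UNIV. \<Sum>j\<in>UNIV. del_z i (del_zbar j (\<lambda>w. cofactor (local_metric g c w) i j)) z) = 0"
proof -
  define m where "m = CARD('n) - 1"
  have n: "CARD('n) = Suc m" by (simp add: m_def)
  note U = open_img[OF c]
  let ?P = "\<lambda>w u. pair_prod m (kaehler (local_metric g c w)) u"
  define T0 where "T0 w u = (1 / 2 ^ m) * ?P w u" for w u
  define T1 where "T1 w u = (\<Sum>j\<in>UNIV. cnj (u 0 $ j) * del_zbar j (\<lambda>w. T0 w (\<lambda>l. u (1 + l))) w)" for w and u :: "nat \<Rightarrow> complex^'n"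
  have td: "times_differentiable_on k (chart_img c) (\<lambda>w. ?P w u)" for k u
    by (rule smooth_pair_prod[OF c])
  have td0: "times_differentiable_on k (chart_img c) (\<lambda>w. T0 w u)" for k u
    unfolding T0_def by (intro times_differentiable_on_mult times_differentiable_on_const U td)
  have td1: "times_differentiable_on k (chart_img c) (\<lambda>w. T1 w u)" for k u
    unfolding T1_def del_zbar_eq_wirtinger
    by (intro times_differentiable_on_sum times_differentiable_on_mult times_differentiable_on_const U
        times_differentiable_on_wirtinger td0)
  have tdb: "times_differentiable_on k (chart_img c) (del_zbar j (\<lambda>w. ?P w u))" for k j u
    unfolding del_zbar_eq_wirtinger by (intro times_differentiable_on_wirtinger U td)
  note dif = times_differentiable_onD[OF _ zero_less_one]
  define \<Omega> where "\<Omega> w = wedge_power (fundamental_form (local_metric g c w)) m" for w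
  have \<Omega>: "\<Omega> w u = alternation (2 * m) (T0 w) u" for w u
    unfolding \<Omega>_def T0_def alternation_cmult
    by (subst wedge_power_eq_alternation[OF fundamental_form_eq_kaehler]) simp
  have "delbar_form (2 * m) \<Omega> w u = alternation (1 + 2 * m) (T1 w) u" if "w \<in> chart_img c" for w u
    unfolding T1_def by (rule delbar_form_alternation[OF U that \<Omega> dif[OF td0 that]])
  then have "del_form (1 + 2 * m) (delbar_form (2 * m) \<Omega>) z real_frame =
    alternation (1 + (1 + 2 * m)) (\<lambda>u. \<Sum>i\<in>UNIV. u 0 $ i * del_z i (\<lambda>w. T1 w (\<lambda>l. u (1 + l))) z) real_frame"
    by (rule del_form_alternation[OF U z _ dif[OF td1 z]])
  moreover have "del_form (1 + 2 * m) (delbar_form (2 * m) \<Omega>) z real_frame = 0"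
  proof -
    have e: "2 * CARD('n) - 1 = 1 + 2 * m" "2 * CARD('n) - 2 = 2 * m" by (simp_all add: n)
    show ?thesis using gau c z unfolding gauduchon_def e \<Omega>_def m_def by blast
  qed
  moreover have "1 + (1 + 2 * m) = 2 * CARD('n)" by (simp add: n)
  moreover have "(\<Sum>i\<in>UNIV. u 0 $ i * del_z i (\<lambda>w. T1 w (\<lambda>l. u (1 + l))) z) =
    (\<Sum>i\<in>UNIV. \<Sum>j\<in>UNIV. (1 / 2 ^ m) * (u 0 $ i * cnj (u 1 $ j) * del_z i (del_zbar j (\<lambda>w. ?P w (\<lambda>l. u (2 + l)))) z))"
    for u :: "nat \<Rightarrow> complex^'n"
  proof -
    have "del_z i (\<lambda>w. T1 w (\<lambda>l. u (1 + l))) z =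
      (\<Sum>j\<in>UNIV. cnj (u 1 $ j) * ((1 / 2 ^ m) * del_z i (del_zbar j (\<lambda>w. ?P w (\<lambda>l. u (2 + l)))) z))" for i
    proof -
      have "T1 w (\<lambda>l. u (1 + l)) = (\<Sum>j\<in>UNIV. cnj (u 1 $ j) * ((1 / 2 ^ m) * del_zbar j (\<lambda>w. ?P w (\<lambda>l. u (2 + l))) w))"
        if w: "w \<in> chart_img c" for w
        unfolding T1_def T0_def del_zbar_eq_wirtinger wirtinger_cmult[OF dif[OF td w]] by simp
      then have "del_z i (\<lambda>w. T1 w (\<lambda>l. u (1 + l))) z =
        del_z i (\<lambda>w. \<Sum>j\<in>UNIV. cnj (u 1 $ j) * ((1 / 2 ^ m) * del_zbar j (\<lambda>w. ?P w (\<lambda>l. u (2 + l))) w)) z"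
        unfolding del_z_eq_wirtinger by (rule wirtinger_cong[OF U z])
      also have "\<dots> = (\<Sum>j\<in>UNIV. cnj (u 1 $ j) * ((1 / 2 ^ m) * del_z i (del_zbar j (\<lambda>w. ?P w (\<lambda>l. u (2 + l)))) z))"
        unfolding del_z_eq_wirtinger using dif[OF tdb z]
        by (simp only: wirtinger_sum wirtinger_cmult differentiable_mult differentiable_const)
      finally show ?thesis .
    qed
    then show ?thesis by (simp add: sum_distrib_left mult_ac)
  qed
  ultimately have "0 = alternation (2 * CARD('n)) (\<lambda>u. \<Sum>i\<in>UNIV. \<Sum>j\<in>UNIV. (1 / 2 ^ m) *
      (u 0 $ i * cnj (u 1 $ j) * del_z i (del_zbar j (\<lambda>w. ?P w (\<lambda>l. u (2 + l)))) z)) real_frame"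
    by simp
  also have "\<dots> = (1 / 2 ^ m) * (\<Sum>i\<in>UNIV. \<Sum>j\<in>UNIV. alternation (2 * CARD('n))
      (\<lambda>u. u 0 $ i * cnj (u 1 $ j) * del_z i (del_zbar j (\<lambda>w. ?P w (\<lambda>l. u (2 + l)))) z) real_frame)"
    by (simp only: alternation_sum alternation_cmult sum_distrib_left[symmetric])
  finally have "(\<Sum>i\<in>UNIV. \<Sum>j\<in>UNIV. alternation (2 * CARD('n))
      (\<lambda>u. u 0 $ i * cnj (u 1 $ j) * del_z i (del_zbar j (\<lambda>w. ?P w (\<lambda>l. u (2 + l)))) z) real_frame) = 0"
    by simp
  moreover have "alternation (2 * CARD('n)) (\<lambda>u. u 0 $ i * cnj (u 1 $ j) * del_z i (del_zbar j (\<lambda>w. ?P w (\<lambda>l. u (2 + l)))) z) real_frame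
      = del_z i (del_zbar j (\<lambda>w. cofactor (local_metric g c w) i j)) z" for i j
  proof -
    have 1: "del_zbar j (\<lambda>w. cofactor (local_metric g c w) i j) w =
      alternation (2 * CARD('n)) (\<lambda>u. u 0 $ i * cnj (u 1 $ j) * del_zbar j (\<lambda>w. ?P w (\<lambda>l. u (2 + l))) w) real_frame"
      if w: "w \<in> chart_img c" for w
      unfolding cofactor_def del_zbar_eq_wirtinger m_def[symmetric] using dif[OF td w]
      by (subst wirtinger_alternation) (auto simp: wirtinger_cmult intro!: differentiable_mult)
    have "del_z i (del_zbar j (\<lambda>w. cofactor (local_metric g c w) i j)) z =
      del_z i (\<lambda>w. alternation (2 * CARD('n)) (\<lambda>u. u 0 $ i * cnj (u 1 $ j) * del_zbar j (\<lambda>w. ?P w (\<lambda>l. u (2 + l))) w) real_frame) z"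
      unfolding del_z_eq_wirtinger by (rule wirtinger_cong[OF U z 1])
    also have "\<dots> = alternation (2 * CARD('n)) (\<lambda>u. u 0 $ i * cnj (u 1 $ j) * del_z i (del_zbar j (\<lambda>w. ?P w (\<lambda>l. u (2 + l)))) z) real_frame"
      unfolding del_z_eq_wirtinger using dif[OF tdb z]
      by (subst wirtinger_alternation) (auto simp: wirtinger_cmult intro!: differentiable_mult)
    finally show ?thesis ..
  qed
  ultimately show ?thesis by (simp only:)
qed

lemma integral_vol_chart:
  fixes \<phi> :: "'m \<Rightarrow> real"
  assumes c: "c \<in> A" and \<phi>: "\<phi> \<in> borel_measurable borel" and supp: "\<And>x. x \<notin> chart_dom c \<Longrightarrow> \<phi> x = 0"
  shows "(\<integral>x. \<phi> x \<partial>vol) = (\<integral>z. density_at c z * indicator (chart_img c) z * \<phi> (chart_inv c z) \<partial>lborel)"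
proof -
  have dom: "chart_dom c \<in> sets borel" using open_dom[OF c] by simp
  have ind: "(\<integral>x. \<phi> x \<partial>M) = (\<integral>x. \<phi> x \<partial>density M (indicator (chart_dom c)))" if M: "sets M = sets borel" for M
  proof -
    have [measurable]: "\<phi> \<in> borel_measurable M" "(indicator (chart_dom c) :: 'm \<Rightarrow> real) \<in> borel_measurable M"
      using \<phi> dom M by (auto simp: measurable_cong_sets[OF M refl])
    have "(\<integral>x. \<phi> x \<partial>density M (\<lambda>x. ennreal (indicator (chart_dom c) x))) = (\<integral>x. indicator (chart_dom c) x *\<^sub>R \<phi> x \<partial>M)"
      by (intro integral_density) auto
    also have "\<dots> = (\<integral>x. \<phi> x \<partial>M)"
      by (intro Bochner_Integration.integral_cong) (auto simp: indicator_def supp)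
    finally show ?thesis by (simp add: ennreal_indicator)
  qed
  let ?i = "\<lambda>z. if z \<in> chart_img c then chart_inv c z else undefined"
  have mi: "?i \<in> borel_measurable borel" by (rule measurable_chart_inv[OF c])
  have [measurable]: "(\<lambda>z. density_at c z * indicator (chart_img c) z) \<in> borel_measurable borel"
    using open_img[OF c] by (intro borel_measurable_density_at[OF c]) auto
  have [measurable]: "(\<lambda>z. \<phi> (?i z)) \<in> borel_measurable borel"
    by (rule measurable_compose[OF mi \<phi>])
  have "(\<integral>x. \<phi> x \<partial>vol) = (\<integral>x. \<phi> x \<partial>chart_measure c)"
    using ind[OF sets_vol] ind[OF sets_chart_measure[of c]] density_vol_eq[OF c] by simp
  also have "\<dots> = (\<integral>z. \<phi> (?i z) \<partial>density lborel (\<lambda>z. ennreal (density_at c z * indicator (chart_img c) z)))"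
    unfolding chart_measure_def using mi \<phi> by (intro integral_distr) auto
  also have "\<dots> = (\<integral>z. (density_at c z * indicator (chart_img c) z) *\<^sub>R \<phi> (?i z) \<partial>lborel)"
  proof (intro integral_density)
    show "AE z in lborel. 0 \<le> density_at c z * indicator (chart_img c) z"
      by (intro AE_I2) (auto simp: indicator_def intro!: less_imp_le[OF density_at_pos[OF c]])
  qed auto
  also have "\<dots> = (\<integral>z. density_at c z * indicator (chart_img c) z * \<phi> (chart_inv c z) \<partial>lborel)"
    by (intro Bochner_Integration.integral_cong) (auto simp: indicator_def)
  finally show ?thesis .
qed

end

section \<open>Integration by parts in a chart\<close>

lemma times_differentiable_on_extend:
  assumes "open S" "closed K" "K \<subseteq> S" "times_differentiable_on k S f" "\<And>x. x \<notin> K \<Longrightarrow> f x = 0"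
  shows "times_differentiable_on k UNIV f"
proof -
  have "times_differentiable_on k (- K) f"
    using assms(2,5) times_differentiable_on_cong[of "- K" f "\<lambda>x. 0" k] by auto
  then have "times_differentiable_on k (S \<union> - K) f"
    using assms by (intro times_differentiable_on_Un) auto
  moreover have "S \<union> - K = UNIV" using assms(3) by auto
  ultimately show ?thesis by simp
qed

lemma integral_wirtinger_eq_0:
  fixes G :: "complex^'n::finite \<Rightarrow> complex"
  assumes G: "times_differentiable_on 1 UNIV G" and K: "bounded K" "closed K" "\<And>x. x \<notin> K \<Longrightarrow> G x = 0"
  shows "(\<integral>x. wirtinger s i G x \<partial>lborel) = 0"
proof -
  have int: "integrable lborel (\<lambda>x. frechet_derivative G (at x) v)" for v
  proof (rule integrable_continuous_bounded_support[OF _ K(1)])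
    show "continuous_on UNIV (\<lambda>x. frechet_derivative G (at x) v)" using G by simp
    show "frechet_derivative G (at x) v = 0" if "x \<notin> K" for x
    proof -
      have "frechet_derivative G (at x) = frechet_derivative (\<lambda>x. 0) (at x)"
        using that K by (intro frechet_derivative_cong_open[of "- K"]) auto
      then show ?thesis using frechet_derivative_at[OF has_derivative_const[of 0 "at x"]] by metis
    qed
  qed
  show ?thesis
    unfolding wirtinger_def using int integral_frechet_derivative_eq_0[OF G K(1,3)] by simp
qed

text \<open>Both \<open>C * del_z i H\<close> and \<open>del_zbar j C * H\<close> have support in
  \<open>K\<close> and extend by zero, so that the integrals of \<open>del_zbar j\<close> of the
  first and of \<open>del_z i\<close> of the second vanish. Both derivatives contain the same mixed
  term \<open>del_zbar j C * del_z i H\<close>, which is eliminated between the two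
  equations.\<close>

lemma wirtinger_integration_by_parts:
  fixes C H :: "complex^'n::finite \<Rightarrow> complex"
  assumes S: "open S" and K: "compact K" "K \<subseteq> S"
    and C: "times_differentiable_on 2 S C" and H: "times_differentiable_on 2 S H" "\<And>x. x \<notin> K \<Longrightarrow> H x = 0"
  shows "(\<integral>z. C z * del_zbar j (del_z i H) z \<partial>lborel) = (\<integral>z. del_z i (del_zbar j C) z * H z \<partial>lborel)"
    and "integrable lborel (\<lambda>z. C z * del_zbar j (del_z i H) z)"
    and "integrable lborel (\<lambda>z. del_z i (del_zbar j C) z * H z)"
proof -
  have cK: "closed K" "bounded K" using K(1) by (auto simp: compact_imp_closed compact_imp_bounded)
  have two: "(2::nat) = Suc 1" by simp
  have wK: "wirtinger s l f x = 0" if "\<And>x. x \<notin> K \<Longrightarrow> f x = 0" "x \<notin> K" for s l f x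
    using that cK(1) wirtinger_cong[of "- K" x f "\<lambda>x. 0" s l] by auto
  have tC: "times_differentiable_on 1 S (del_zbar j C)" "times_differentiable_on 1 S C"
    "times_differentiable_on 0 S (del_z i (del_zbar j C))"
  proof -
    show *: "times_differentiable_on 1 S (del_zbar j C)"
      unfolding del_zbar_eq_wirtinger by (rule times_differentiable_on_wirtinger[OF S]) (use C two in metis)
    show "times_differentiable_on 1 S C" by (rule times_differentiable_on_le[OF C]) simp
    show "times_differentiable_on 0 S (del_z i (del_zbar j C))"
      unfolding del_z_eq_wirtinger by (rule times_differentiable_on_wirtinger[OF S]) (use * in \<open>simp only: One_nat_def\<close>)
  qed
  have tH: "times_differentiable_on 1 S (del_z i H)" "times_differentiable_on 1 S H"
    "times_differentiable_on 0 S (del_zbar j (del_z i H))"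
  proof -
    show *: "times_differentiable_on 1 S (del_z i H)"
      unfolding del_z_eq_wirtinger by (rule times_differentiable_on_wirtinger[OF S]) (use H two in metis)
    show "times_differentiable_on 1 S H" by (rule times_differentiable_on_le[OF H(1)]) simp
    show "times_differentiable_on 0 S (del_zbar j (del_z i H))"
      unfolding del_zbar_eq_wirtinger by (rule times_differentiable_on_wirtinger[OF S]) (use * in \<open>simp only: One_nat_def\<close>)
  qed
  have zH: "del_z i H x = 0" "del_zbar j (del_z i H) x = 0" if "x \<notin> K" for x
  proof -
    have *: "del_z i H x = 0" if "x \<notin> K" for x
      unfolding del_z_eq_wirtinger by (rule wK[where f = H, OF H(2) that])
    show "del_z i H x = 0" by (rule *[OF that])
    show "del_zbar j (del_z i H) x = 0"
      unfolding del_zbar_eq_wirtinger by (rule wK[where f = "del_z i H", OF * that])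
  qed
  have int: "integrable lborel f" if "times_differentiable_on 0 S f" "\<And>x. x \<notin> K \<Longrightarrow> f x = 0" for f :: "complex^'n \<Rightarrow> complex"
    using times_differentiable_on_extend[OF S cK(1) K(2) that] integrable_continuous_bounded_support[OF _ cK(2) that(2)] by simp
  have t0: "times_differentiable_on 0 S f" if "times_differentiable_on 1 S f" for f :: "complex^'n \<Rightarrow> complex"
    by (rule times_differentiable_on_le[OF that]) simp
  show i1: "integrable lborel (\<lambda>z. C z * del_zbar j (del_z i H) z)"
    by (rule int) (use zH in \<open>auto intro!: times_differentiable_on_mult S t0[OF tC(2)] tH(3) simp del: times_differentiable_on.simps\<close>)
  show i2: "integrable lborel (\<lambda>z. del_z i (del_zbar j C) z * H z)"
    by (rule int) (use H(2) in \<open>auto intro!: times_differentiable_on_mult S t0[OF tH(2)] tC(3) simp del: times_differentiable_on.simps\<close>)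
  have i3: "integrable lborel (\<lambda>z. del_zbar j C z * del_z i H z)"
    by (rule int) (use zH in \<open>auto intro!: times_differentiable_on_mult S t0[OF tC(1)] t0[OF tH(1)] simp del: times_differentiable_on.simps\<close>)
  let ?X = "\<lambda>z. C z * del_z i H z" and ?Y = "\<lambda>z. del_zbar j C z * H z"
  have X: "times_differentiable_on 1 UNIV ?X"
  proof (rule times_differentiable_on_extend[OF S cK(1) K(2)])
    show "times_differentiable_on 1 S ?X" by (rule times_differentiable_on_mult[OF S tC(2) tH(1)])
  qed (simp add: zH)
  have Y: "times_differentiable_on 1 UNIV ?Y"
  proof (rule times_differentiable_on_extend[OF S cK(1) K(2)])
    show "times_differentiable_on 1 S ?Y" by (rule times_differentiable_on_mult[OF S tC(1) tH(2)])
  qed (simp add: H(2))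
  have X0: "?X x = 0" and Y0: "?Y x = 0" if "x \<notin> K" for x
    using zH H(2) that by auto
  have dX: "del_zbar j ?X z = C z * del_zbar j (del_z i H) z + del_zbar j C z * del_z i H z" for z
  proof (cases "z \<in> S")
    case True
    show ?thesis
      using wirtinger_mult[OF times_differentiable_onD[OF tC(2) zero_less_one True] times_differentiable_onD[OF tH(1) zero_less_one True], of \<i> j]
      unfolding del_zbar_eq_wirtinger .
  next
    case False
    then have "z \<notin> K" using K(2) by auto
    then show ?thesis using zH(1)[of z] zH(2)[of z] wK[where f = ?X, OF X0, of z \<i> j] unfolding del_zbar_eq_wirtinger by simp
  qed
  have dY: "del_z i ?Y z = del_zbar j C z * del_z i H z + del_z i (del_zbar j C) z * H z" for z
  proof (cases "z \<in> S")
    case True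
    show ?thesis
      using wirtinger_mult[OF times_differentiable_onD[OF tC(1) zero_less_one True] times_differentiable_onD[OF tH(2) zero_less_one True], of "- \<i>" i]
      unfolding del_z_eq_wirtinger .
  next
    case False
    then have "z \<notin> K" using K(2) by auto
    then show ?thesis using zH(1)[of z] H(2)[of z] wK[where f = ?Y, OF Y0, of z "- \<i>" i] unfolding del_z_eq_wirtinger by simp
  qed
  have "(\<integral>z. del_zbar j ?X z \<partial>lborel) = 0" "(\<integral>z. del_z i ?Y z \<partial>lborel) = 0"
    using integral_wirtinger_eq_0[OF X cK(2,1) X0, of \<i> j] integral_wirtinger_eq_0[OF Y cK(2,1) Y0, of "- \<i>" i]
    unfolding del_zbar_eq_wirtinger del_z_eq_wirtinger by simp_all
  then have "(\<integral>z. C z * del_zbar j (del_z i H) z \<partial>lborel) + (\<integral>z. del_zbar j C z * del_z i H z \<partial>lborel) = 0"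
    "(\<integral>z. del_z i (del_zbar j C) z * H z \<partial>lborel) + (\<integral>z. del_zbar j C z * del_z i H z \<partial>lborel) = 0"
    unfolding dX dY Bochner_Integration.integral_add[OF i1 i3] Bochner_Integration.integral_add[OF i3 i2]
    by (simp_all only: add.commute)
  then show "(\<integral>z. C z * del_zbar j (del_z i H) z \<partial>lborel) = (\<integral>z. del_z i (del_zbar j C) z * H z \<partial>lborel)"
    unfolding eq_neg_iff_add_eq_0[symmetric] by simp
qed

context hermitian_manifold
begin

text \<open>Locality of the Laplacian, in any chart \<open>c\<close>; with it, a function supported
  in one chart is seen to have zero Laplacian off its support in the others as well.\<close>

lemma laplacian_in_eq_0:
  assumes c: "c \<in> A" and K: "closed K" "\<And>x. x \<notin> K \<Longrightarrow> h x = 0" and z: "z \<in> chart_img c" "chart_inv c z \<notin> K"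
  shows "laplacian_in c h z = 0"
proof -
  let ?v = "\<lambda>w. complex_of_real (h (chart_inv c w))"
  define O' where "O' = chart_inv c -` (- K) \<inter> chart_img c"
  have O': "open O'" "z \<in> O'"
    unfolding O'_def using continuous_on_open_vimage[OF open_img[OF c], of "chart_inv c"] continuous_chart_inv[OF c] K(1) z by auto
  have "wirtinger s i ?v w = 0" if "w \<in> O'" for s i w
    using wirtinger_cong[OF O'(1) that, of ?v "\<lambda>w. 0" s i] K(2) by (auto simp: O'_def)
  then have "wirtinger t j (wirtinger s i ?v) z = 0" for t j s i
    using wirtinger_cong[OF O', of "wirtinger s i ?v" "\<lambda>w. 0" t j] by simp
  then show ?thesis
    by (simp add: laplacian_in_def complex_laplacian_def del_z_eq_wirtinger del_zbar_eq_wirtinger)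
qed

text \<open>Multiplied by the volume density, the coefficient \<open>inv_metric\<close> of the Laplacian becomes a constant
  multiple of \<open>cofactor\<close>, and the Gauduchon condition says that the formal adjoint kills constants.\<close>

lemma integral_laplacian_local:
  assumes gau: "gauduchon A g" and c: "c \<in> A" and h: "C2 h"
    and K: "compact K" "K \<subseteq> chart_img c" "\<And>x. x \<notin> chart_inv c ` K \<Longrightarrow> h x = 0"
  shows "(\<integral>x. laplacian h x \<partial>vol) = 0"
proof -
  \<comment> \<open>The values of \<open>chart_inv c\<close> off the image carry no meaning, so the
    local expression of \<open>h\<close> is extended by zero.\<close>
  let ?H = "\<lambda>z. if z \<in> chart_img c then complex_of_real (h (chart_inv c z)) else 0"
  let ?C = "\<lambda>i j z. cofactor (local_metric g c z) i j"
  note U = open_img[OF c]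
  have "compact (chart_inv c ` K)"
    using K(1,2) continuous_chart_inv[OF c] by (intro compact_continuous_image) (auto intro: continuous_on_subset)
  then have cl: "closed (chart_inv c ` K)" by (rule compact_imp_closed)
  have Kdom: "chart_inv c ` K \<subseteq> chart_dom c" using K(2) chart_inv_dom[OF c] by blast
  have notK: "chart_inv c z \<notin> chart_inv c ` K" if "z \<in> chart_img c" "z \<notin> K" for z
  proof
    assume "chart_inv c z \<in> chart_inv c ` K"
    then obtain w where w: "w \<in> K" "chart_inv c z = chart_inv c w" by blast
    then have "chart_map c (chart_inv c z) = chart_map c (chart_inv c w)" by simp
    moreover have "w \<in> chart_img c" using w(1) K(2) by blast
    ultimately have "z = w" using chart_map_inv[OF c] that(1) by metis
    then show False using that(2) w(1) by simp
  qed
  have H0: "?H z = 0" if "z \<notin> K" for z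
    using K(3) notK[of z] that by auto
  have HU: "times_differentiable_on 2 (chart_img c) ?H"
    using h c times_differentiable_on_cong[OF U, of ?H "\<lambda>z. complex_of_real (h (chart_inv c z))" 2] by (simp add: C2_def)
  note parts = wirtinger_integration_by_parts[OF U K(1,2) smooth_cofactor[OF c] HU H0]
  have lap0: "laplacian h x = 0" if "x \<notin> chart_inv c ` K" for x
  proof -
    define d where "d = (SOME c. c \<in> A \<and> x \<in> chart_dom c)"
    have d: "d \<in> A" "x \<in> chart_dom d" using some_chart unfolding d_def by auto
    show ?thesis
      unfolding laplacian_eq[OF d h]
      using laplacian_in_eq_0[OF d(1) cl K(3), where z = "chart_map d x"] d chart_inv_map[OF d] that by simp
  qed
  \<comment> \<open>The numerator is the constant of \<open>cofactor_eq_inv_metric\<close>, the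
    denominator that of \<open>volume_density_eq_top_form\<close>.\<close>
  define \<gamma> where "\<gamma> = 2 * \<i> * of_nat CARD('n) / (2 ^ CARD('n) * fact CARD('n))"
  have key: "of_real (density_at c z * indicator (chart_img c) z) * laplacian_in c h z =
    \<gamma> * (\<Sum>i\<in>UNIV. \<Sum>j\<in>UNIV. ?C i j z * del_zbar j (del_z i ?H) z)" for z
  proof (cases "z \<in> chart_img c")
    case True
    note G = hermitian_pos_local[OF c True]
    have dd: "del_zbar j (del_z i ?H) z = del_zbar j (del_z i (\<lambda>w. complex_of_real (h (chart_inv c w)))) z" for i j
    proof -
      have "wirtinger s i ?H w = wirtinger s i (\<lambda>w. complex_of_real (h (chart_inv c w))) w" if "w \<in> chart_img c" for s w
        by (rule wirtinger_cong[OF U that]) simp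
      then show ?thesis
        unfolding del_z_eq_wirtinger del_zbar_eq_wirtinger by (rule wirtinger_cong[OF U True])
    qed
    have "complex_of_real (density_at c z) = top_form (local_metric g c z) / (2 ^ CARD('n) * fact CARD('n))"
      using top_form_real[OF G] by (auto simp: volume_density_eq_top_form complex_is_Real_iff complex_eq_iff elim!: Reals_cases)
    then have "of_real (density_at c z) * inv_metric (local_metric g c z) i j = \<gamma> * ?C i j z" for i j
      using cofactor_eq_inv_metric[OF G, of i j] by (simp add: \<gamma>_def mult.commute)
    then show ?thesis
      using True by (simp add: laplacian_in_def complex_laplacian_def dd sum_distrib_left mult.assoc[symmetric])
  next
    case False
    then have "z \<notin> K" using K(2) by auto
    have cK: "open (- K)" using K(1) by (simp add: compact_imp_closed open_Compl)
    have "wirtinger s i ?H w = 0" if "w \<in> - K" for s i w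
      using wirtinger_cong[OF cK that, of ?H "\<lambda>w. 0" s i] H0 by simp
    then have "wirtinger t j (wirtinger s i ?H) z = 0" for t j s i
      using wirtinger_cong[OF cK, of z "wirtinger s i ?H" "\<lambda>w. 0" t j] \<open>z \<notin> K\<close> by simp
    then show ?thesis using False by (simp add: del_z_eq_wirtinger del_zbar_eq_wirtinger)
  qed
  have I: "(\<integral>z. \<gamma> * (\<Sum>i\<in>UNIV. \<Sum>j\<in>UNIV. ?C i j z * del_zbar j (del_z i ?H) z) \<partial>lborel) = 0"
  proof -
    have "(\<integral>z. (\<Sum>i\<in>UNIV. \<Sum>j\<in>UNIV. ?C i j z * del_zbar j (del_z i ?H) z) \<partial>lborel) =
      (\<Sum>i\<in>UNIV. \<Sum>j\<in>UNIV. \<integral>z. ?C i j z * del_zbar j (del_z i ?H) z \<partial>lborel)"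
      using parts(2) by simp
    also have "\<dots> = (\<Sum>i\<in>UNIV. \<Sum>j\<in>UNIV. \<integral>z. del_z i (del_zbar j (?C i j)) z * ?H z \<partial>lborel)"
      by (intro sum.cong refl parts(1))
    also have "\<dots> = (\<integral>z. (\<Sum>i\<in>UNIV. \<Sum>j\<in>UNIV. del_z i (del_zbar j (?C i j)) z * ?H z) \<partial>lborel)"
      using parts(3) by simp
    also have "\<dots> = 0"
    proof -
      have "(\<Sum>i\<in>UNIV. \<Sum>j\<in>UNIV. del_z i (del_zbar j (?C i j)) z * ?H z) = 0" for z
      proof -
        have "(\<Sum>i\<in>UNIV. \<Sum>j\<in>UNIV. del_z i (del_zbar j (?C i j)) z) * ?H z = 0"
          using gauduchon_cofactor[OF gau c, of z] by (cases "z \<in> chart_img c") auto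
        then show ?thesis by (simp only: sum_distrib_right)
      qed
      then show ?thesis by (simp only: integral_zero)
    qed
    finally have "(\<integral>z. (\<Sum>i\<in>UNIV. \<Sum>j\<in>UNIV. ?C i j z * del_zbar j (del_z i ?H) z) \<partial>lborel) = 0" .
    then show ?thesis by (simp only: integral_mult_right_zero mult_zero_right)
  qed
  have int: "integrable lborel (\<lambda>z. \<gamma> * (\<Sum>i\<in>UNIV. \<Sum>j\<in>UNIV. ?C i j z * del_zbar j (del_z i ?H) z))"
    using parts(2) by (intro integrable_mult_right Bochner_Integration.integrable_sum)
  have "(\<integral>x. laplacian h x \<partial>vol) = (\<integral>z. density_at c z * indicator (chart_img c) z * laplacian h (chart_inv c z) \<partial>lborel)"
    using continuous_laplacian[OF h] lap0 Kdom
    by (intro integral_vol_chart[OF c] borel_measurable_continuous_onI) auto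
  also have "\<dots> = (\<integral>z. Re (\<gamma> * (\<Sum>i\<in>UNIV. \<Sum>j\<in>UNIV. ?C i j z * del_zbar j (del_z i ?H) z)) \<partial>lborel)"
  proof (rule Bochner_Integration.integral_cong[OF refl])
    fix z
    show "density_at c z * indicator (chart_img c) z * laplacian h (chart_inv c z) =
      Re (\<gamma> * (\<Sum>i\<in>UNIV. \<Sum>j\<in>UNIV. ?C i j z * del_zbar j (del_z i ?H) z))"
      unfolding key[symmetric]
      using laplacian_eq[OF c chart_inv_dom[OF c] h, of z] chart_map_inv[OF c, of z] by (cases "z \<in> chart_img c") auto
  qed
  also have "\<dots> = Re (\<integral>z. \<gamma> * (\<Sum>i\<in>UNIV. \<Sum>j\<in>UNIV. ?C i j z * del_zbar j (del_z i ?H) z) \<partial>lborel)"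
    using int by (rule integral_Re)
  finally show ?thesis unfolding I by simp
qed

end

section \<open>Cut-off functions and localisation\<close>

lemma has_real_derivative_pos_part_power:
  "((\<lambda>t::real. max 0 t ^ Suc (Suc k)) has_real_derivative real (Suc (Suc k)) * max 0 t ^ Suc k) (at t)"
proof -
  consider "t > 0" | "t < 0" | "t = 0" by linarith
  then show ?thesis
  proof cases
    case 1
    have "((\<lambda>t. t ^ Suc (Suc k)) has_real_derivative real (Suc (Suc k)) * t ^ Suc k) (at t)"
      using DERIV_pow[of "Suc (Suc k)" t] by simp
    then have "((\<lambda>t. max 0 t ^ Suc (Suc k)) has_real_derivative real (Suc (Suc k)) * t ^ Suc k) (at t)"
      by (rule has_field_derivative_transform_within_open[of _ _ _ "{0<..}"]) (use 1 in auto)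
    then show ?thesis using 1 by (simp add: max_def)
  next
    case 2
    have "((\<lambda>t. max 0 t ^ Suc (Suc k)) has_real_derivative 0) (at t)"
      by (rule has_field_derivative_transform_within_open[of "\<lambda>t. 0" _ _ "{..<0}"]) (use 2 in auto)
    then show ?thesis using 2 by (simp add: max_def)
  next
    case 3
    have "((\<lambda>h. max 0 h ^ Suc k) \<longlongrightarrow> max 0 0 ^ Suc k) (at (0::real))"
      by (intro tendsto_intros)
    then have "((\<lambda>h. max 0 h ^ Suc k) \<longlongrightarrow> 0) (at (0::real))" by simp
    then have "((\<lambda>h. max 0 h ^ Suc (Suc k) / h) \<longlongrightarrow> 0) (at (0::real))"
      by (rule Lim_transform_eventually) (auto simp: eventually_at_filter max_def)
    then show ?thesis by (simp add: 3 DERIV_def)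
  qed
qed

text \<open>Three is the least integer exponent for which the power of the positive part is twice
  continuously differentiable at \<open>0\<close>.\<close>

lemma times_differentiable_on_pos_part_cube: "times_differentiable_on 2 UNIV (\<lambda>t::real. max 0 t ^ 3)"
proof -
  have "times_differentiable_on 1 UNIV (\<lambda>t::real. max 0 t ^ 2)"
    unfolding One_nat_def
  proof (rule times_differentiable_on_SucI[OF open_UNIV])
    show "((\<lambda>t. max 0 t ^ 2) has_derivative (*) (2 * max 0 t)) (at t)" for t :: real
      using has_field_derivative_imp_has_derivative[OF has_real_derivative_pos_part_power[of 0 t]] by (simp add: numeral_2_eq_2)
    show "times_differentiable_on 0 UNIV (\<lambda>t. 2 * max 0 t * v)" for v :: real
      by (auto intro!: continuous_intros)
  qed
  then have "times_differentiable_on 1 UNIV (\<lambda>t::real. 3 * max 0 t ^ 2 * v)" for v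
    by (intro times_differentiable_on_mult times_differentiable_on_const open_UNIV)
  moreover have "((\<lambda>t. max 0 t ^ 3) has_derivative (*) (3 * max 0 t ^ 2)) (at t)" for t :: real
    using has_field_derivative_imp_has_derivative[OF has_real_derivative_pos_part_power[of 1 t]] by (simp add: numeral_2_eq_2 numeral_3_eq_3)
  ultimately have "times_differentiable_on (Suc 1) UNIV (\<lambda>t::real. max 0 t ^ 3)"
    by (intro times_differentiable_on_SucI[OF open_UNIV])
  then show ?thesis by (simp only: Suc_1)
qed

lemma complex_laplacian_sum:
  assumes U: "open U" "z \<in> U" and v: "\<And>a. a \<in> I \<Longrightarrow> times_differentiable_on 2 U (v a)"
  shows "complex_laplacian G (\<lambda>w. \<Sum>a\<in>I. v a w) z = (\<Sum>a\<in>I. complex_laplacian G (v a) z)"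
proof -
  have 1: "v a differentiable (at w)" if "a \<in> I" "w \<in> U" for a w
    using times_differentiable_onD[OF v[OF that(1)] _ that(2)] by simp
  have 2: "wirtinger s i (v a) differentiable (at z)" if "a \<in> I" for a s i
  proof -
    have "times_differentiable_on 1 U (wirtinger s i (v a))"
      by (rule times_differentiable_on_wirtinger[OF U(1)]) (use v[OF that] in \<open>simp only: numeral_2_eq_2 One_nat_def\<close>)
    from times_differentiable_onD[OF this zero_less_one U(2)] show ?thesis .
  qed
  have "del_zbar j (del_z i (\<lambda>w. \<Sum>a\<in>I. v a w)) z = (\<Sum>a\<in>I. del_zbar j (del_z i (v a)) z)" for i j
  proof -
    have "wirtinger \<i> j (wirtinger (- \<i>) i (\<lambda>w. \<Sum>a\<in>I. v a w)) z = wirtinger \<i> j (\<lambda>w. \<Sum>a\<in>I. wirtinger (- \<i>) i (v a) w) z"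
      by (rule wirtinger_cong[OF U], rule wirtinger_sum, rule 1)
    also have "\<dots> = (\<Sum>a\<in>I. wirtinger \<i> j (wirtinger (- \<i>) i (v a)) z)"
      by (rule wirtinger_sum, rule 2)
    finally show ?thesis by (simp add: del_z_eq_wirtinger del_zbar_eq_wirtinger)
  qed
  then have "complex_laplacian G (\<lambda>w. \<Sum>a\<in>I. v a w) z = (\<Sum>i\<in>UNIV. \<Sum>j\<in>UNIV. \<Sum>a\<in>I. inv_metric G i j * del_zbar j (del_z i (v a)) z)"
    by (simp add: complex_laplacian_def sum_distrib_left)
  also have "\<dots> = (\<Sum>i\<in>UNIV. \<Sum>a\<in>I. \<Sum>j\<in>UNIV. inv_metric G i j * del_zbar j (del_z i (v a)) z)"
    by (rule sum.cong[OF refl], rule sum.swap)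
  also have "\<dots> = (\<Sum>a\<in>I. \<Sum>i\<in>UNIV. \<Sum>j\<in>UNIV. inv_metric G i j * del_zbar j (del_z i (v a)) z)"
    by (rule sum.swap)
  finally show ?thesis by (simp add: complex_laplacian_def)
qed

context hermitian_manifold
begin

lemma laplacian_sum:
  assumes "\<And>a. a \<in> I \<Longrightarrow> C2 (h a)"
  shows "laplacian (\<lambda>x. \<Sum>a\<in>I. h a x) x = (\<Sum>a\<in>I. laplacian (h a) x)"
proof -
  define c where "c = (SOME c. c \<in> A \<and> x \<in> chart_dom c)"
  have c: "c \<in> A" "x \<in> chart_dom c" using some_chart unfolding c_def by auto
  have "laplacian_in c (\<lambda>x. \<Sum>a\<in>I. h a x) (chart_map c x) = (\<Sum>a\<in>I. laplacian_in c (h a) (chart_map c x))"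
    unfolding laplacian_in_def of_real_sum
    by (rule complex_laplacian_sum[OF open_img[OF c(1)]]) (use assms c in \<open>auto simp: C2_def simp del: times_differentiable_on.simps\<close>)
  then show ?thesis
    unfolding laplacian_def c_def[symmetric] Let_def by simp
qed

lemma C2_mult: "C2 f \<Longrightarrow> C2 h \<Longrightarrow> C2 (\<lambda>x. f x * h x)"
  unfolding C2_def of_real_mult using times_differentiable_on_mult open_img by blast

lemma C2_sum: "(\<And>a. a \<in> I \<Longrightarrow> C2 (h a)) \<Longrightarrow> C2 (\<lambda>x. \<Sum>a\<in>I. h a x)"
  unfolding C2_def of_real_sum by (intro ballI times_differentiable_on_sum open_img) auto

lemma C2_divide: "C2 f \<Longrightarrow> C2 h \<Longrightarrow> (\<And>x. h x \<noteq> 0) \<Longrightarrow> C2 (\<lambda>x. f x / h x)"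
  unfolding C2_def of_real_divide by (intro ballI times_differentiable_on_divide open_img) auto

text \<open>Two derivatives suffice, so that the cut-off functions need not be smooth.\<close>

definition bump :: "('m, 'n) chart \<times> (complex^'n) \<times> real \<Rightarrow> 'm \<Rightarrow> real" where
  "bump = (\<lambda>(c, z, r) x. if x \<in> chart_dom c then max 0 (r\<^sup>2 - (chart_map c x - z) \<bullet> (chart_map c x - z)) ^ 3 else 0)"

lemma bump_nonneg: "0 \<le> bump a x"
  by (auto simp: bump_def split: prod.splits)

lemma bump_pos: "coordinate_ball a \<Longrightarrow> x \<in> ball_nhd a \<Longrightarrow> 0 < bump a x"
  by (auto simp: bump_def coordinate_ball_def ball_nhd_def dist_norm norm_minus_commute power2_norm_eq_inner[symmetric]
      intro!: zero_less_power power_strict_mono split: prod.splits)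

lemma bump_eq_0:
  assumes "coordinate_ball (c, z, r)" "x \<notin> chart_inv c ` cball z r"
  shows "bump (c, z, r) x = 0"
proof (cases "x \<in> chart_dom c")
  case True
  have c: "c \<in> A" "r > 0" using assms(1) by (auto simp: coordinate_ball_def)
  have "chart_map c x \<notin> cball z r"
    using assms(2) chart_inv_map[OF c(1) True] by (metis imageI)
  then have "r < norm (chart_map c x - z)" by (simp add: dist_norm norm_minus_commute)
  then have "r\<^sup>2 < (norm (chart_map c x - z))\<^sup>2" using c(2) by (intro power_strict_mono) auto
  then show ?thesis by (simp add: bump_def power2_norm_eq_inner)
qed (simp add: bump_def)

text \<open>The image of a chart \<open>d\<close> is the union of two open sets. On the overlap with
  \<open>c\<close>, the function is a fixed function of the coordinates composed with a transition
  map; off the compact preimage of the closed ball it is zero. That this preimage is closed uses the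
  Hausdorff property.\<close>

lemma C2_bump:
  assumes "coordinate_ball a"
  shows "C2 (bump a)"
  unfolding C2_def
proof
  fix d assume d: "d \<in> A"
  obtain c z r where a: "a = (c, z, r)" by (cases a)
  have c: "c \<in> A" "cball z r \<subseteq> chart_img c" using assms by (auto simp: a coordinate_ball_def)
  let ?K = "chart_inv c ` cball z r"
  have "compact ?K"
    using c continuous_chart_inv[OF c(1)] by (intro compact_continuous_image) (auto intro: continuous_on_subset)
  then have K: "closed ?K" by (rule compact_imp_closed)
  have Kdom: "?K \<subseteq> chart_dom c" using c chart_inv_dom by blast
  let ?f = "\<lambda>w. complex_of_real (bump a (chart_inv d w))"
  define \<beta> where "\<beta> w = complex_of_real (max 0 (r\<^sup>2 - (w - z) \<bullet> (w - z)) ^ 3)" for w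
  define O' where "O' = chart_inv d -` (- ?K) \<inter> chart_img d"
  have "times_differentiable_on 2 UNIV (\<lambda>w. r\<^sup>2 - (w - z) \<bullet> (w - z))"
    by (intro times_differentiable_on_diff times_differentiable_on_inner times_differentiable_on_ident times_differentiable_on_const open_UNIV)
  from times_differentiable_on_compose[OF open_UNIV open_UNIV times_differentiable_on_pos_part_cube this]
  have "times_differentiable_on 2 UNIV (\<lambda>w. max 0 (r\<^sup>2 - (w - z) \<bullet> (w - z)) ^ 3)" by simp
  from times_differentiable_on_bounded_linear[OF open_UNIV bounded_linear_of_real this]
  have "times_differentiable_on 2 UNIV \<beta>" unfolding \<beta>_def .
  from times_differentiable_on_compose[OF open_overlap[OF d c(1)] open_UNIV this transition_smooth[OF d c(1)]]
  have "times_differentiable_on 2 (overlap d c) (\<lambda>w. \<beta> (transition d c w))" by simp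
  moreover have "?f w = \<beta> (transition d c w)" if "w \<in> overlap d c" for w
    using that by (auto simp: a bump_def \<beta>_def transition_def chart_inv_map[OF d])
  ultimately have 1: "times_differentiable_on 2 (overlap d c) ?f"
    using times_differentiable_on_cong[OF open_overlap[OF d c(1)], of ?f "\<lambda>w. \<beta> (transition d c w)"] by blast
  have O': "open O'"
    unfolding O'_def using continuous_on_open_vimage[OF open_img[OF d], of "chart_inv d"] continuous_chart_inv[OF d] K by auto
  have "?f w = 0" if "w \<in> O'" for w
    using that bump_eq_0[of c z r] assms by (auto simp: a O'_def)
  then have 2: "times_differentiable_on 2 O' ?f"
    using times_differentiable_on_cong[OF O', of ?f "\<lambda>w. 0" 2] times_differentiable_on_const by blast
  have "chart_img d = overlap d c \<union> O'"
  proof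
    show "overlap d c \<union> O' \<subseteq> chart_img d" by (auto simp: O'_def)
    show "chart_img d \<subseteq> overlap d c \<union> O'"
    proof
      fix w assume w: "w \<in> chart_img d"
      then obtain x where x: "x \<in> chart_dom d" "w = chart_map d x" by blast
      then have inv: "chart_inv d w = x" by (simp add: chart_inv_map[OF d])
      show "w \<in> overlap d c \<union> O'"
      proof (cases "x \<in> ?K")
        case True
        then have "x \<in> chart_dom c" using Kdom by (rule rev_subsetD)
        then show ?thesis using x by blast
      next
        case False
        then show ?thesis using w inv by (simp add: O'_def)
      qed
    qed
  qed
  then show "times_differentiable_on 2 (chart_img d) ?f"
    using times_differentiable_on_Un[OF open_overlap[OF d c(1)] O' 1 2] by simp
qed

section \<open>Finiteness and positivity of the total volume\<close>

lemma emeasure_ball_nhd_finite: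
  assumes "coordinate_ball a"
  shows "emeasure vol (ball_nhd a) < \<infinity>"
proof -
  obtain c z r where a: "a = (c, z, r)" by (cases a)
  have c: "c \<in> A" "cball z r \<subseteq> chart_img c" using assms by (auto simp: a coordinate_ball_def)
  have "compact (density_at c ` cball z r)"
    using c continuous_density_at[OF c(1)] by (intro compact_continuous_image) (auto intro: continuous_on_subset)
  then have "bounded (density_at c ` cball z r)" by (rule compact_imp_bounded)
  then obtain M where M: "\<forall>y\<in>density_at c ` cball z r. norm y \<le> M"
    unfolding bounded_iff by blast
  have N: "ball_nhd a \<subseteq> chart_dom c" by (auto simp: a ball_nhd_def)
  have img: "chart_map c ` ball_nhd a \<subseteq> cball z r" by (auto simp: a ball_nhd_def)
  have "emeasure vol (ball_nhd a) = (\<integral>\<^sup>+ w. ennreal (density_at c w) * indicator (chart_map c ` ball_nhd a) w \<partial>lborel)"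
    using open_ball_nhd[OF assms] N by (simp add: emeasure_vol[OF c(1)] emeasure_chart_measure[OF c(1)])
  also have "\<dots> \<le> (\<integral>\<^sup>+ w. ennreal M * indicator (cball z r) w \<partial>lborel)"
  proof (rule nn_integral_mono)
    fix w
    have "density_at c w \<le> M" if "w \<in> cball z r"
      using M that by (force simp: abs_le_iff)
    then show "ennreal (density_at c w) * indicator (chart_map c ` ball_nhd a) w \<le> ennreal M * indicator (cball z r) w"
      using img by (cases "w \<in> chart_map c ` ball_nhd a") (auto simp: indicator_def intro!: ennreal_leI)
  qed
  also have "\<dots> = ennreal M * emeasure lborel (cball z r)"
    by (subst nn_integral_cmult_indicator) auto
  also have "\<dots> < \<infinity>"
    using emeasure_bounded_finite[OF bounded_cball, of z r] by (simp add: ennreal_mult_less_top)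
  finally show ?thesis .
qed

lemma finite_measure_vol: "finite_measure vol"
proof
  obtain I where I: "finite I" "\<forall>a\<in>I. coordinate_ball a" "(\<Union>a\<in>I. ball_nhd a) = UNIV"
    using finite_cover by blast
  have "emeasure vol (\<Union>a\<in>I. ball_nhd a) \<le> (\<Sum>a\<in>I. emeasure vol (ball_nhd a))"
    using I open_ball_nhd by (intro emeasure_subadditive_finite) auto
  also have "\<dots> < \<infinity>"
    using I emeasure_ball_nhd_finite by simp
  finally show "emeasure vol (space vol) \<noteq> \<infinity>" unfolding I(3) by simp
qed

text \<open>The density is positive on a ball of positive Lebesgue measure. Positivity of the volume
  is what allows its real powers to be differentiated.\<close>

lemma measure_vol_pos: "0 < measure vol UNIV"
proof -
  interpret finite_measure vol by (rule finite_measure_vol)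
  obtain a where a: "coordinate_ball a" using coordinate_ball_exists by blast
  obtain c z r where acr: "a = (c, z, r)" by (cases a)
  have c: "c \<in> A" "r > 0" "cball z r \<subseteq> chart_img c" using a by (auto simp: acr coordinate_ball_def)
  have N: "ball_nhd a \<subseteq> chart_dom c" "ball_nhd a \<in> sets borel"
    using open_ball_nhd[OF a] by (auto simp: acr ball_nhd_def)
  have img: "chart_map c ` ball_nhd a = ball z r"
  proof
    show "ball z r \<subseteq> chart_map c ` ball_nhd a"
    proof
      fix w assume w: "w \<in> ball z r"
      then have "w \<in> chart_img c" using c(3) ball_subset_cball by blast
      then have "chart_inv c w \<in> ball_nhd a"
        using w chart_inv_dom[OF c(1)] chart_map_inv[OF c(1)] by (simp add: acr ball_nhd_def)
      then show "w \<in> chart_map c ` ball_nhd a"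
        using chart_map_inv[OF c(1) \<open>w \<in> chart_img c\<close>] by (metis imageI)
    qed
  qed (auto simp: acr ball_nhd_def)
  have "emeasure vol (ball_nhd a) \<noteq> 0"
  proof
    assume "emeasure vol (ball_nhd a) = 0"
    then have "(\<integral>\<^sup>+ w. ennreal (density_at c w * indicator (ball z r) w) \<partial>lborel) = 0"
      using N by (simp add: emeasure_vol[OF c(1)] emeasure_chart_measure[OF c(1)] img ennreal_times_indicator)
    moreover have "(\<lambda>w. density_at c w * indicator (ball z r) w) \<in> borel_measurable borel"
      using c(3) by (intro borel_measurable_density_at[OF c(1)]) auto
    ultimately have "AE w in lborel. ennreal (density_at c w * indicator (ball z r) w) = 0"
      by (subst (asm) nn_integral_0_iff_AE) auto
    then have "AE w in lborel. w \<notin> ball z r"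
    proof (rule AE_mp, intro AE_I2 impI notI)
      fix w assume w: "ennreal (density_at c w * indicator (ball z r) w) = 0" "w \<in> ball z r"
      then have "0 < density_at c w" using c(3) by (intro density_at_pos[OF c(1)]) auto
      then show False using w by simp
    qed
    then have "ball z r \<in> null_sets lborel"
      by (subst (asm) AE_iff_null_sets[symmetric]) auto
    then have "measure lborel (ball z r) = 0" by (simp add: null_sets_def measure_def)
    then show False using content_ball_pos[OF c(2), of z] by simp
  qed
  then have "0 < measure vol (ball_nhd a)"
    by (simp add: emeasure_eq_measure zero_less_measure_iff)
  also have "\<dots> \<le> measure vol UNIV"
    using N by (intro finite_measure_mono) auto
  finally show ?thesis .
qed

lemma continuous_bounded:
  fixes F :: "'m \<Rightarrow> real"
  assumes "continuous_on UNIV F"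
  obtains B where "B \<ge> 0" "\<And>x. \<bar>F x\<bar> \<le> B"
proof -
  have "bounded (F ` UNIV)"
    using compact_continuous_image[OF assms compact_UNIV] by (rule compact_imp_bounded)
  then obtain B where B: "\<forall>y\<in>F ` UNIV. norm y \<le> B" unfolding bounded_iff by blast
  have "\<bar>F x\<bar> \<le> B" for x using B by auto
  moreover from this[of undefined] have "B \<ge> 0" by linarith
  ultimately show ?thesis using that by blast
qed

lemma integrable_vol_continuous:
  fixes F :: "'m \<Rightarrow> real"
  assumes "continuous_on UNIV F"
  shows "integrable vol F"
proof -
  interpret finite_measure vol by (rule finite_measure_vol)
  obtain B where "B \<ge> 0" "\<And>x. \<bar>F x\<bar> \<le> B" using continuous_bounded[OF assms] by blast
  moreover have "F \<in> borel_measurable vol"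
    using borel_measurable_continuous_onI[OF assms] by (simp add: measurable_cong_sets[OF sets_vol refl])
  ultimately show ?thesis by (intro integrable_const_bound[of _ B]) auto
qed

text \<open>The quotients \<open>bump a x / \<sigma> x\<close> form the partition of unity;
  \<open>\<sigma>\<close> is positive because the coordinate balls cover. Each piece of
  \<open>f\<close> vanishes off a closed ball inside one chart, which is the compact set that the
  local statement asks for.\<close>

lemma integral_laplacian:
  assumes gau: "gauduchon A g" and f: "C2 f"
  shows "(\<integral>x. laplacian f x \<partial>vol) = 0"
proof -
  obtain I where I: "finite I" "\<forall>a\<in>I. coordinate_ball a" "(\<Union>a\<in>I. ball_nhd a) = UNIV"
    using finite_cover by blast
  define \<sigma> where "\<sigma> x = (\<Sum>a\<in>I. bump a x)" for x
  define h where "h a x = bump a x * (f x / \<sigma> x)" for a x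
  have \<sigma>: "0 < \<sigma> x" for x
  proof -
    obtain a where a: "a \<in> I" "x \<in> ball_nhd a" using I(3) by blast
    then have "0 < bump a x" using I(2) by (intro bump_pos) auto
    then show ?thesis
      unfolding \<sigma>_def using a(1) I(1) bump_nonneg by (intro sum_pos2[of I a]) auto
  qed
  have "C2 \<sigma>" unfolding \<sigma>_def[abs_def] using I(2) by (intro C2_sum C2_bump) auto
  have h: "C2 (h a)" if "a \<in> I" for a
    unfolding h_def[abs_def]
    using that I(2) \<sigma> \<open>C2 \<sigma>\<close> f by (intro C2_mult C2_divide C2_bump) (auto simp: less_imp_neq[symmetric])
  have "f x = (\<Sum>a\<in>I. h a x)" for x
    using \<sigma>[of x] unfolding h_def sum_distrib_right[symmetric] \<sigma>_def[of x, symmetric] by simp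
  then have "f = (\<lambda>x. \<Sum>a\<in>I. h a x)" by (rule ext)
  then have "laplacian f x = laplacian (\<lambda>x. \<Sum>a\<in>I. h a x) x" for x
    by (rule arg_cong[where f = "\<lambda>F. laplacian F x"])
  then have "laplacian f x = (\<Sum>a\<in>I. laplacian (h a) x)" for x
    using laplacian_sum[of I h x] h by simp
  then have "(\<integral>x. laplacian f x \<partial>vol) = (\<Sum>a\<in>I. \<integral>x. laplacian (h a) x \<partial>vol)"
    using h by (simp add: integrable_vol_continuous continuous_laplacian)
  also have "\<dots> = 0"
  proof (rule sum.neutral, rule ballI)
    fix a assume a: "a \<in> I"
    obtain c z r where acr: "a = (c, z, r)" by (cases a)
    have cb: "coordinate_ball (c, z, r)" using I(2) a acr by auto
    then have "c \<in> A" "cball z r \<subseteq> chart_img c" by (auto simp: coordinate_ball_def)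
    then show "(\<integral>x. laplacian (h a) x \<partial>vol) = 0"
      using bump_eq_0[OF cb] by (intro integral_laplacian_local[OF gau _ h[OF a], of c "cball z r"]) (auto simp: h_def acr)
  qed
  finally show ?thesis .
qed

text \<open>By uniqueness it is enough that the right-hand side has the prescribed density in each
  chart. The exponent comes from \<open>volume_density\<close> being homogeneous of degree
  \<open>CARD('n)\<close> in the metric.\<close>

lemma volume_measure_conformal:
  assumes u: "continuous_on UNIV u"
  shows "volume_measure A (conformal u g) = density vol (\<lambda>x. ennreal (exp (real CARD('n) * u x)))"
proof (rule volume_measure_eqI, unfold volume_measure_for_def, intro conjI ballI impI)
  show "sets (density vol (\<lambda>x. ennreal (exp (real CARD('n) * u x)))) = sets borel" by simp
  fix c B assume c: "c \<in> A" and B: "B \<in> sets borel" "B \<subseteq> chart_dom c"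
  let ?h = "\<lambda>x. ennreal (exp (real CARD('n) * u x))"
  have mh [measurable]: "?h \<in> borel_measurable borel"
    using borel_measurable_continuous_onI[OF u] by measurable
  have dom: "chart_dom c \<in> sets borel" using open_dom[OF c] by simp
  have restrict: "(\<integral>\<^sup>+x. F x * indicator B x \<partial>M) = (\<integral>\<^sup>+x. F x * indicator B x \<partial>density M (indicator (chart_dom c)))"
    if M: "sets M = sets borel" and F: "F \<in> borel_measurable borel" for M F
  proof -
    have [measurable]: "F \<in> borel_measurable M" "B \<in> sets M" "chart_dom c \<in> sets M"
      using F B dom M by (auto simp: measurable_cong_sets[OF M refl])
    have "(\<integral>\<^sup>+x. F x * indicator B x \<partial>density M (indicator (chart_dom c))) =
      (\<integral>\<^sup>+x. indicator (chart_dom c) x * (F x * indicator B x) \<partial>M)"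
      by (intro nn_integral_density) measurable
    also have "\<dots> = (\<integral>\<^sup>+x. F x * indicator B x \<partial>M)"
      using B(2) by (intro nn_integral_cong) (auto simp: indicator_def)
    finally show ?thesis ..
  qed
  have "emeasure (density vol ?h) B = (\<integral>\<^sup>+x. ?h x * indicator B x \<partial>vol)"
    using B mh by (intro emeasure_density) (auto simp: measurable_cong_sets[OF sets_vol refl])
  also have "\<dots> = (\<integral>\<^sup>+x. ?h x * indicator B x \<partial>chart_measure c)"
    using restrict[OF sets_vol mh] restrict[OF sets_chart_measure[of c] mh] density_vol_eq[OF c] by simp
  also have "\<dots> = (\<integral>\<^sup>+z. ennreal (density_at c z * indicator (chart_img c) z) * (?h (chart_inv c z) * indicator B (chart_inv c z)) \<partial>lborel)"
    using B mh by (intro nn_integral_chart_measure[OF c] borel_measurable_times_ennreal) auto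
  also have "\<dots> = (\<integral>\<^sup>+z. ennreal (volume_density (local_metric (conformal u g) c z)) * indicator (chart_map c ` B) z \<partial>lborel)"
  proof (rule nn_integral_cong)
    fix z
    have "local_metric (conformal u g) c z = exp (u (chart_inv c z)) *\<^sub>R local_metric g c z"
      by (simp add: local_metric_def conformal_def)
    then have v: "volume_density (local_metric (conformal u g) c z) = exp (real CARD('n) * u (chart_inv c z)) * density_at c z"
      by (simp add: volume_density_scaleR exp_of_nat_mult)
    show "ennreal (density_at c z * indicator (chart_img c) z) * (?h (chart_inv c z) * indicator B (chart_inv c z)) =
      ennreal (volume_density (local_metric (conformal u g) c z)) * indicator (chart_map c ` B) z"
    proof (cases "z \<in> chart_img c")
      case True
      then show ?thesis
        using chart_map_image_eq[OF c B(2), of z] density_at_pos[OF c True]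
        unfolding v by (auto simp: indicator_def ennreal_mult'[symmetric] mult.commute)
    next
      case False
      then show ?thesis using chart_map_image_eq[OF c B(2), of z] by simp
    qed
  qed
  finally show "emeasure (density vol ?h) B =
    (\<integral>\<^sup>+ z. ennreal (volume_density (local_metric (conformal u g) c z)) * indicator (chart_map c ` B) z \<partial>lborel)" .
qed

end

section \<open>Derivatives of integrals and of powers\<close>

text \<open>Dominated convergence along sequences: by the mean value theorem the difference
  quotients are bounded by the constant \<open>K\<close>, which is integrable as the measure is
  finite.\<close>

lemma has_real_derivative_integral:
  fixes \<phi> :: "real \<Rightarrow> 'a \<Rightarrow> real"
  assumes "finite_measure M"
    and int: "\<And>t. integrable M (\<phi> t)"
    and der: "\<And>t x. \<bar>t\<bar> \<le> 1 \<Longrightarrow> ((\<lambda>t. \<phi> t x) has_real_derivative \<phi>' t x) (at t)"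
    and bound: "\<And>t x. \<bar>t\<bar> \<le> 1 \<Longrightarrow> \<bar>\<phi>' t x\<bar> \<le> K"
    and meas: "\<phi>' 0 \<in> borel_measurable M"
  shows "((\<lambda>t. \<integral>x. \<phi> t x \<partial>M) has_real_derivative (\<integral>x. \<phi>' 0 x \<partial>M)) (at 0)"
proof -
  interpret finite_measure M by fact
  have quot: "\<bar>(\<phi> t x - \<phi> 0 x) / t\<bar> \<le> K" if "\<bar>t\<bar> \<le> 1" "t \<noteq> 0" for t x
  proof -
    have "norm (\<phi> t x - \<phi> 0 x) \<le> K * norm (t - 0)"
    proof (rule field_differentiable_bound[where S = "{-1..1}" and f' = "\<lambda>t. \<phi>' t x"])
      show "((\<lambda>t. \<phi> t x) has_field_derivative \<phi>' s x) (at s within {-1..1})" if "s \<in> {-1..1}" for s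
        by (rule has_field_derivative_at_within, rule der) (use that in auto)
      show "norm (\<phi>' s x) \<le> K" if "s \<in> {-1..1}" for s
        using bound[of s x] that by auto
    qed (use that in auto)
    then show ?thesis using that by (simp add: field_simps)
  qed
  have K: "\<bar>\<phi>' 0 x\<bar> \<le> K" for x using bound[of 0 x] by simp
  show ?thesis
    unfolding DERIV_def tendsto_at_iff_sequentially
  proof (intro allI impI)
    fix X :: "nat \<Rightarrow> real" assume X: "\<forall>i. X i \<in> UNIV - {0}" "X \<longlonglongrightarrow> 0"
    \<comment> \<open>Where the increment is too large for the bound, the quotient is replaced by
      the limit itself, so that domination holds for every \<open>i\<close>; this concerns only
      finitely many \<open>i\<close>.\<close>
    define s where "s i x = (if \<bar>X i\<bar> \<le> 1 then (\<phi> (X i) x - \<phi> 0 x) / X i else \<phi>' 0 x)" for i x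
    have small: "eventually (\<lambda>i. \<bar>X i\<bar> \<le> 1) sequentially"
    proof -
      have "eventually (\<lambda>i. \<bar>X i - 0\<bar> < 1) sequentially"
        using tendstoD[OF X(2), of 1] by (simp add: dist_real_def)
      then show ?thesis by (rule eventually_mono) simp
    qed
    have "(\<lambda>i. \<integral>x. s i x \<partial>M) \<longlonglongrightarrow> (\<integral>x. \<phi>' 0 x \<partial>M)"
    proof (rule integral_dominated_convergence[where w = "\<lambda>x. K"])
      show "s i \<in> borel_measurable M" for i
        unfolding s_def using borel_measurable_integrable[OF int] meas by auto
      show "AE x in M. (\<lambda>i. s i x) \<longlonglongrightarrow> \<phi>' 0 x"
      proof (rule AE_I2)
        fix x
        have "((\<lambda>h. (\<phi> (0 + h) x - \<phi> 0 x) / h) \<longlongrightarrow> \<phi>' 0 x) (at 0)"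
          using der[of 0 x] unfolding DERIV_def by simp
        then have "((\<lambda>h. (\<phi> (0 + h) x - \<phi> 0 x) / h) \<circ> X) \<longlonglongrightarrow> \<phi>' 0 x"
          using X unfolding tendsto_at_iff_sequentially by blast
        then show "(\<lambda>i. s i x) \<longlonglongrightarrow> \<phi>' 0 x"
          by (rule Lim_transform_eventually) (use small in \<open>auto elim!: eventually_mono simp: s_def\<close>)
      qed
      show "AE x in M. norm (s i x) \<le> K" for i
        using quot[of "X i"] K X(1) by (intro AE_I2) (auto simp: s_def)
    qed (use meas in auto)
    then show "((\<lambda>h. ((\<integral>x. \<phi> (0 + h) x \<partial>M) - (\<integral>x. \<phi> 0 x \<partial>M)) / h) \<circ> X) \<longlonglongrightarrow> (\<integral>x. \<phi>' 0 x \<partial>M)"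
      by (rule Lim_transform_eventually) (use small int in \<open>auto elim!: eventually_mono simp: s_def\<close>)
  qed
qed

text \<open>At \<open>y = 0\<close> the difference quotient is at most
  \<open>\<bar>h\<bar> powr (p - 1)\<close> in absolute value, and this tends to zero precisely
  because \<open>p > 1\<close>. The formula has value \<open>0\<close> there.\<close>

lemma has_real_derivative_abs_powr:
  fixes p y :: real
  assumes "p > 1"
  shows "((\<lambda>y. \<bar>y\<bar> powr p) has_real_derivative p * \<bar>y\<bar> powr (p - 1) * sgn y) (at y)"
proof -
  consider "y > 0" | "y < 0" | "y = 0" by linarith
  then show ?thesis
  proof cases
    case 1
    have "((\<lambda>y. \<bar>y\<bar> powr p) has_real_derivative p * y powr (p - 1)) (at y)"
      by (rule has_field_derivative_transform_within_open[OF has_real_derivative_powr[OF 1], of "{0<..}"]) (use 1 in auto)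
    then show ?thesis using 1 by simp
  next
    case 2
    have "((\<lambda>y. (- y) powr p) has_real_derivative p * (- y) powr (p - 1) * (- 1)) (at y)"
      by (rule DERIV_chain2[where f = "\<lambda>y. y powr p" and g = uminus]) (use 2 in \<open>auto intro!: has_real_derivative_powr derivative_eq_intros\<close>)
    then have "((\<lambda>y. \<bar>y\<bar> powr p) has_real_derivative p * (- y) powr (p - 1) * (- 1)) (at y)"
      by (rule has_field_derivative_transform_within_open[of _ _ _ "{..<0}"]) (use 2 in auto)
    then show ?thesis using 2 by simp
  next
    case 3
    have "((\<lambda>h. \<bar>h\<bar> powr (p - 1)) \<longlongrightarrow> 0) (at (0::real))"
      using assms tendsto_powr2[of "\<lambda>h::real. \<bar>h\<bar>" 0 "at 0" "\<lambda>h. p - 1" "p - 1"]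
      by (auto intro!: tendsto_eq_intros)
    then have "((\<lambda>h. \<bar>h\<bar> powr p / h) \<longlongrightarrow> 0) (at (0::real))"
    proof (rule Lim_null_comparison[rotated])
      show "\<forall>\<^sub>F h in at (0::real). norm (\<bar>h\<bar> powr p / h) \<le> \<bar>h\<bar> powr (p - 1)"
        by (simp add: eventually_at_filter powr_diff)
    qed
    then show ?thesis using 3 by (simp add: DERIV_def)
  qed
qed

section \<open>The conformal variation of the Calabi functional\<close>

context hermitian_manifold
begin

context
  fixes p \<kappa> n :: real and f :: "'m \<Rightarrow> real"
  assumes p: "p > 1" and \<kappa>: "\<And>x. chern_scalar A g x = \<kappa>" and f: "C2 f"
    and n: "n = real CARD('n)"
begin

lemma n_pos: "0 < n" by (simp add: n)

text \<open>The integrand of the first factor of \<open>calabi\<close> with respect to the fixed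
  measure \<open>vol\<close>: the power of the curvature contributes
  \<open>exp (- (p * (t * f x)))\<close>, the volume form
  \<open>exp (n * (t * f x))\<close>.\<close>

definition energy_density :: "real \<Rightarrow> 'm \<Rightarrow> real" where
  "energy_density t x = exp ((n - p) * (t * f x)) * \<bar>\<kappa> - n * t * laplacian f x\<bar> powr p"

definition energy_density' :: "real \<Rightarrow> 'm \<Rightarrow> real" where
  "energy_density' t x = (n - p) * f x * exp ((n - p) * (t * f x)) * \<bar>\<kappa> - n * t * laplacian f x\<bar> powr p +
     exp ((n - p) * (t * f x)) *
       (p * \<bar>\<kappa> - n * t * laplacian f x\<bar> powr (p - 1) * sgn (\<kappa> - n * t * laplacian f x) * (- (n * laplacian f x)))"

lemma energy_density'_0:
  "energy_density' 0 x = (n - p) * \<bar>\<kappa>\<bar> powr p * f x + (- (n * p * \<bar>\<kappa>\<bar> powr (p - 1) * sgn \<kappa>)) * laplacian f x"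
  by (simp add: energy_density'_def algebra_simps)

lemma continuous_conformal_scalar: "continuous_on UNIV (\<lambda>x. \<kappa> - n * t * laplacian f x)"
  by (intro continuous_intros continuous_laplacian f)

lemma calabi_conformal:
  "calabi p A (conformal (\<lambda>x. t * f x) g) =
     (\<integral>x. energy_density t x \<partial>vol) * (\<integral>x. exp (n * (t * f x)) \<partial>vol) powr (- ((n - p) / n))"
proof -
  have cf: "continuous_on UNIV (\<lambda>x. t * f x)" by (intro continuous_intros continuous_C2 f)
  have vm: "volume_measure A (conformal (\<lambda>x. t * f x) g) = density vol (\<lambda>x. ennreal (exp (n * (t * f x))))"
    using volume_measure_conformal[OF cf] by (simp add: n)
  have bm: "F \<in> borel_measurable vol" if "continuous_on UNIV F" for F :: "'m \<Rightarrow> real"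
    using borel_measurable_continuous_onI[OF that] by (simp add: measurable_cong_sets[OF sets_vol refl])
  have me: "(\<lambda>x. exp (n * (t * f x))) \<in> borel_measurable vol"
    by (intro bm continuous_intros continuous_C2 f)
  have s: "\<bar>chern_scalar A (conformal (\<lambda>x. t * f x) g) x\<bar> powr p =
      exp (- (p * (t * f x))) * \<bar>\<kappa> - n * t * laplacian f x\<bar> powr p" for x
    by (simp add: chern_scalar_conformal[OF f] \<kappa> abs_mult powr_mult exp_powr_real mult.commute n)
  have ms: "(\<lambda>x. \<bar>chern_scalar A (conformal (\<lambda>x. t * f x) g) x\<bar> powr p) \<in> borel_measurable vol"
    unfolding s using p
    by (intro bm continuous_on_mult continuous_on_exp continuous_on_minus continuous_on_powr' continuous_on_rabs
        continuous_on_const continuous_conformal_scalar continuous_C2 f) auto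
  have "(\<integral>x. \<bar>chern_scalar A (conformal (\<lambda>x. t * f x) g) x\<bar> powr p \<partial>density vol (\<lambda>x. ennreal (exp (n * (t * f x))))) =
    (\<integral>x. exp (n * (t * f x)) *\<^sub>R \<bar>chern_scalar A (conformal (\<lambda>x. t * f x) g) x\<bar> powr p \<partial>vol)"
    by (rule integral_density[OF ms me]) simp
  also have "\<dots> = (\<integral>x. energy_density t x \<partial>vol)"
  proof (rule Bochner_Integration.integral_cong[OF refl])
    fix x
    have "exp ((n - p) * (t * f x)) = exp (n * (t * f x)) * exp (- (p * (t * f x)))"
      by (simp add: exp_add[symmetric] algebra_simps)
    then show "exp (n * (t * f x)) *\<^sub>R \<bar>chern_scalar A (conformal (\<lambda>x. t * f x) g) x\<bar> powr p = energy_density t x"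
      unfolding s energy_density_def by simp
  qed
  finally have 1: "(\<integral>x. \<bar>chern_scalar A (conformal (\<lambda>x. t * f x) g) x\<bar> powr p \<partial>density vol (\<lambda>x. ennreal (exp (n * (t * f x))))) =
    (\<integral>x. energy_density t x \<partial>vol)" .
  have 2: "(\<integral>x. 1 \<partial>density vol (\<lambda>x. ennreal (exp (n * (t * f x))))) = (\<integral>x. exp (n * (t * f x)) \<partial>vol)"
    using integral_density[of "\<lambda>x. 1 :: real" vol "\<lambda>x. exp (n * (t * f x))"] me by simp
  show ?thesis
    unfolding calabi_def n[symmetric] vm 1 2 ..
qed

lemma energy_derivative:
  "((\<lambda>t. \<integral>x. energy_density t x \<partial>vol) has_real_derivative (\<integral>x. energy_density' 0 x \<partial>vol)) (at 0)"
proof -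
  obtain F where F: "F \<ge> 0" "\<And>x. \<bar>f x\<bar> \<le> F" using continuous_bounded[OF continuous_C2[OF f]] by blast
  obtain \<Lambda> where \<Lambda>: "\<Lambda> \<ge> 0" "\<And>x. \<bar>laplacian f x\<bar> \<le> \<Lambda>" using continuous_bounded[OF continuous_laplacian[OF f]] by blast
  \<comment> \<open>For \<open>\<bar>t\<bar> \<le> 1\<close>, \<open>E\<close> bounds the
    exponential and \<open>Y\<close>, defined next, bounds the base of the power. The bounds
    \<open>F\<close> and \<open>\<Lambda>\<close> exist by compactness.\<close>
  define E where "E = exp (\<bar>n - p\<bar> * F)"
  define Y where "Y = \<bar>\<kappa>\<bar> + n * \<Lambda>"
  show ?thesis
  proof (rule has_real_derivative_integral[OF finite_measure_vol,
        where K = "\<bar>n - p\<bar> * F * E * Y powr p + E * (p * Y powr (p - 1) * 1 * (n * \<Lambda>))"])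
    show "integrable vol (energy_density t)" for t
      unfolding energy_density_def[abs_def] using p
      by (intro integrable_vol_continuous continuous_on_mult continuous_on_exp continuous_on_powr' continuous_on_rabs
          continuous_on_const continuous_conformal_scalar continuous_C2 f) auto
    show "((\<lambda>t. energy_density t x) has_real_derivative energy_density' t x) (at t)" for t x
    proof -
      have a: "((\<lambda>t. \<bar>\<kappa> - n * t * laplacian f x\<bar> powr p) has_real_derivative
          p * \<bar>\<kappa> - n * t * laplacian f x\<bar> powr (p - 1) * sgn (\<kappa> - n * t * laplacian f x) * (- (n * laplacian f x))) (at t)"
        by (rule DERIV_chain2[OF has_real_derivative_abs_powr[OF p]]) (auto intro!: derivative_eq_intros)
      have b: "((\<lambda>t. exp ((n - p) * (t * f x))) has_real_derivative (n - p) * f x * exp ((n - p) * (t * f x))) (at t)"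
        by (auto intro!: derivative_eq_intros)
      show ?thesis
        unfolding energy_density_def energy_density'_def using DERIV_mult'[OF b a] by (simp only: add.commute)
    qed
    show "\<bar>energy_density' t x\<bar> \<le> \<bar>n - p\<bar> * F * E * Y powr p + E * (p * Y powr (p - 1) * 1 * (n * \<Lambda>))" if t: "\<bar>t\<bar> \<le> 1" for t x
    proof -
      have tF: "\<bar>t * f x\<bar> \<le> 1 * F" unfolding abs_mult using t F by (intro mult_mono) auto
      have "(n - p) * (t * f x) \<le> \<bar>n - p\<bar> * \<bar>t * f x\<bar>" by (metis abs_ge_self abs_mult)
      also have "\<dots> \<le> \<bar>n - p\<bar> * F" using tF by (intro mult_left_mono) auto
      finally have e: "exp ((n - p) * (t * f x)) \<le> E" by (simp add: E_def)
      have "\<bar>n * t * laplacian f x\<bar> \<le> n * 1 * \<Lambda>" unfolding abs_mult using t \<Lambda> n_pos by (intro mult_mono) auto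
      then have y: "\<bar>\<kappa> - n * t * laplacian f x\<bar> \<le> Y"
        using abs_triangle_ineq4[of \<kappa> "n * t * laplacian f x"] by (simp add: Y_def)
      have y1: "\<bar>\<kappa> - n * t * laplacian f x\<bar> powr p \<le> Y powr p" "\<bar>\<kappa> - n * t * laplacian f x\<bar> powr (p - 1) \<le> Y powr (p - 1)"
        using y p by (auto intro!: powr_mono2)
      have E0: "E \<ge> 0" by (simp add: E_def)
      have sg: "\<bar>sgn (\<kappa> - n * t * laplacian f x)\<bar> \<le> 1" by (simp add: sgn_if)
      have "\<bar>energy_density' t x\<bar> \<le> \<bar>(n - p) * f x * exp ((n - p) * (t * f x)) * \<bar>\<kappa> - n * t * laplacian f x\<bar> powr p\<bar> +
        \<bar>exp ((n - p) * (t * f x)) *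
         (p * \<bar>\<kappa> - n * t * laplacian f x\<bar> powr (p - 1) * sgn (\<kappa> - n * t * laplacian f x) * (- (n * laplacian f x)))\<bar>"
        unfolding energy_density'_def by (rule abs_triangle_ineq)
      also have "\<dots> = \<bar>n - p\<bar> * \<bar>f x\<bar> * exp ((n - p) * (t * f x)) * \<bar>\<kappa> - n * t * laplacian f x\<bar> powr p +
        exp ((n - p) * (t * f x)) *
         (p * \<bar>\<kappa> - n * t * laplacian f x\<bar> powr (p - 1) * \<bar>sgn (\<kappa> - n * t * laplacian f x)\<bar> * (n * \<bar>laplacian f x\<bar>))"
        using p n_pos by (simp add: abs_mult)
      also have "\<dots> \<le> \<bar>n - p\<bar> * F * E * Y powr p + E * (p * Y powr (p - 1) * 1 * (n * \<Lambda>))"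
        using F \<Lambda> e y1 E0 sg p n_pos by (intro add_mono mult_mono mult_nonneg_nonneg) auto
      finally show ?thesis .
    qed
    have "continuous_on UNIV (\<lambda>x. energy_density' 0 x)"
      unfolding energy_density'_0
      by (intro continuous_on_add continuous_on_mult continuous_on_const continuous_C2 continuous_laplacian f)
    then show "energy_density' 0 \<in> borel_measurable vol"
      using borel_measurable_continuous_onI by (simp add: measurable_cong_sets[OF sets_vol refl])
  qed
qed

lemma volume_derivative:
  "((\<lambda>t. \<integral>x. exp (n * (t * f x)) \<partial>vol) has_real_derivative n * (\<integral>x. f x \<partial>vol)) (at 0)"
proof -
  obtain F where F: "F \<ge> 0" "\<And>x. \<bar>f x\<bar> \<le> F" using continuous_bounded[OF continuous_C2[OF f]] by blast
  have "((\<lambda>t. \<integral>x. exp (n * (t * f x)) \<partial>vol) has_real_derivative (\<integral>x. n * f x * exp (n * (0 * f x)) \<partial>vol)) (at 0)"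
  proof (rule has_real_derivative_integral[OF finite_measure_vol, where K = "n * F * exp (n * F)" and \<phi>' = "\<lambda>t x. n * f x * exp (n * (t * f x))"])
    show "integrable vol (\<lambda>x. exp (n * (t * f x)))" for t
      by (intro integrable_vol_continuous continuous_intros continuous_C2 f)
    show "((\<lambda>t. exp (n * (t * f x))) has_real_derivative n * f x * exp (n * (t * f x))) (at t)" for t x
      by (auto intro!: derivative_eq_intros)
    show "\<bar>n * f x * exp (n * (t * f x))\<bar> \<le> n * F * exp (n * F)" if t: "\<bar>t\<bar> \<le> 1" for t x
    proof -
      have "t * f x \<le> \<bar>t\<bar> * \<bar>f x\<bar>" by (metis abs_ge_self abs_mult)
      also have "\<dots> \<le> 1 * F" using t F by (intro mult_mono) auto
      finally have "n * (t * f x) \<le> n * F" using n_pos by (intro mult_left_mono) auto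
      then show ?thesis
        unfolding abs_mult abs_exp_cancel abs_of_pos[OF n_pos] using F n_pos by (intro mult_mono) auto
    qed
    show "(\<lambda>x. n * f x * exp (n * (0 * f x))) \<in> borel_measurable vol"
      using borel_measurable_continuous_onI[OF continuous_C2[OF f]] by (simp add: measurable_cong_sets[OF sets_vol refl])
  qed
  then show ?thesis by simp
qed

text \<open>Once the integral of the Laplacian is gone, the logarithmic derivatives of volume and
  energy would be \<open>n\<close> and \<open>n - p\<close> times the mean of \<open>f\<close>, as
  for a constant \<open>f\<close>. The exponent \<open>q\<close> of the volume satisfies
  \<open>q * n + (n - p) = 0\<close>, that is, it makes the functional invariant under scaling, so
  the two terms cancel. The computation avoids logarithms since the energy vanishes for
  \<open>\<kappa> = 0\<close>.\<close>

lemma calabi_derivative_eq_0: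
  assumes gau: "gauduchon A g"
  shows "((\<lambda>t. calabi p A (conformal (\<lambda>x. t * f x) g)) has_real_derivative 0) (at 0)"
proof -
  define V where "V = measure vol UNIV"
  define q where "q = - ((n - p) / n)"
  have V: "V > 0" unfolding V_def by (rule measure_vol_pos)
  have e0: "(\<integral>x. energy_density 0 x \<partial>vol) = \<bar>\<kappa>\<bar> powr p * V"
    by (simp add: energy_density_def V_def)
  have v0: "(\<integral>x. exp (n * (0 * f x)) \<partial>vol) = V"
    by (simp add: V_def)
  have e1: "(\<integral>x. energy_density' 0 x \<partial>vol) = (n - p) * \<bar>\<kappa>\<bar> powr p * (\<integral>x. f x \<partial>vol)"
  proof -
    have "(\<integral>x. energy_density' 0 x \<partial>vol) =
        (n - p) * \<bar>\<kappa>\<bar> powr p * (\<integral>x. f x \<partial>vol) + (- (n * p * \<bar>\<kappa>\<bar> powr (p - 1) * sgn \<kappa>)) * (\<integral>x. laplacian f x \<partial>vol)"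
      unfolding energy_density'_0 using integrable_vol_continuous[OF continuous_C2[OF f]] integrable_vol_continuous[OF continuous_laplacian[OF f]]
      by simp
    then show ?thesis by (simp add: integral_laplacian[OF gau f])
  qed
  have "((\<lambda>t. (\<integral>x. exp (n * (t * f x)) \<partial>vol) powr q) has_real_derivative
      q * V powr (q - 1) * (n * (\<integral>x. f x \<partial>vol))) (at 0)"
    by (rule DERIV_chain2[where f = "\<lambda>y. y powr q", OF _ volume_derivative]) (use V in \<open>simp only: v0 has_real_derivative_powr\<close>)
  from DERIV_mult'[OF energy_derivative this]
  have "((\<lambda>t. calabi p A (conformal (\<lambda>x. t * f x) g)) has_real_derivative
      (\<bar>\<kappa>\<bar> powr p * V) * (q * V powr (q - 1) * (n * (\<integral>x. f x \<partial>vol))) +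
      ((n - p) * \<bar>\<kappa>\<bar> powr p * (\<integral>x. f x \<partial>vol)) * V powr q) (at 0)"
    unfolding calabi_conformal q_def[symmetric] e0 v0 e1 .
  moreover have "(\<bar>\<kappa>\<bar> powr p * V) * (q * V powr (q - 1) * (n * (\<integral>x. f x \<partial>vol))) +
      ((n - p) * \<bar>\<kappa>\<bar> powr p * (\<integral>x. f x \<partial>vol)) * V powr q = 0"
  proof -
    \<comment> \<open>With one power of \<open>V\<close> split off, both summands share the factor
      \<open>V * V powr (q - 1)\<close>, and a polynomial identity remains.\<close>
    have W: "V powr q = V * V powr (q - 1)" using V by (simp add: powr_diff)
    have "q * n + (n - p) = 0" using n_pos by (simp add: q_def)
    moreover have "(k * V) * (q * W * (n * J)) + ((n - p) * k * J) * (V * W) = k * V * W * J * (q * n + (n - p))" for k W J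
      by (simp add: algebra_simps)
    ultimately show ?thesis unfolding W by simp
  qed
  ultimately show ?thesis by simp
qed

end

end

theorem corollary1p7:
  fixes A :: "('m::t2_space, 'n::finite) chart set"
    and g :: "('m, 'n) metric"
    and p :: real
  assumes "compact (UNIV :: 'm set)"
    and "complex_atlas A"
    and "CARD('n) \<ge> 2"
    and "hermitian_metric A g"
    and "gauduchon A g"
    and "\<exists>\<kappa>. \<forall>x. chern_scalar A g x = \<kappa>"
    and "p > 1"
  shows "conformal_extremal p A g"
proof -
  interpret hermitian_manifold A g
    using assms by unfold_locales
  obtain \<kappa> where \<kappa>: "\<And>x. chern_scalar A g x = \<kappa>" using assms(6) by blast
  show ?thesis
    unfolding conformal_extremal_def
    using calabi_derivative_eq_0[OF assms(7) \<kappa> C2_if_smooth_function refl assms(5)] by blast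
qed

end
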